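(* For two-qubit unitaries $U$, with quasiprobability extent $\gamma(U)$, entangling power $e_{\mathrm p}(U)\in[0,2/9]$ and gate typicality $g_{\mathrm t}(U)\in[0,1]$, the sharp extrema of $\gamma$ at fixed $e_{\mathrm p}$ and at fixed $g_{\mathrm t}$ are as follows. (i) Entangling power. Every two-qubit unitary with $0\le e_{\mathrm p}\le 2/9$ satisfies $$1+3\sqrt{2e_{\mathrm p}}\;\le\;\gamma\;\le\;7,$$ and for every value $e_{\mathrm p}\in[0,2/9]$ both bounds are attained: the lower bound by the controlled family $(\theta,0,0)$, and the upper bound by the iSWAP--SWAP family $(\pi/4,\pi/4,\theta)$. (ii) Gate typicality. For every $0\le g_{\mathrm t}\le 1$, the minimum and maximum of $\gamma(U)$ over all two-qubit unitaries $U$ with gate typicality $g_{\mathrm t}$ are respectively $$\gamma_{\min}(g_{\mathrm t})=\begin{cases}1+2\sqrt{3g_{\mathrm t}}, & 0\le g_{\mathrm t}\le\frac13,\\ 3+2\sqrt{(3g_{\mathrm t}-1)(5-3g_{\mathrm t})}, & \frac13\le g_{\mathrm t}\le\frac23,\\ 1+3g_{\mathrm t}+3\sqrt{g_{\mathrm t}(4-3g_{\mathrm t})}, & \frac23\le g_{\mathrm t}\le 1,\end{cases}$$ and $$\gamma_{\max}(g_{\mathrm t})=\begin{cases}1+3g_{\mathrm t}+3\sqrt{g_{\mathrm t}(4-3g_{\mathrm t})}, & 0\le g_{\mathrm t}\le\frac49,\\ 1+3g_{\mathrm t}+4\sqrt{\frac{3g_{\mathrm t}}{2}}, & \frac49\le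 g_{\mathrm t}\le\frac23,\\ 7, & \frac23\le g_{\mathrm t}\le 1.\end{cases}$$ On the three successive intervals of $g_{\mathrm t}$, the lower boundary is attained respectively by the controlled family $(\theta,0,0)$, the CNOT--SWAP family $(\pi/4,\theta,\theta)$ and the fractional SWAP family $(\theta,\theta,\theta)$, while the upper boundary is attained respectively by the fractional SWAP family $(\theta,\theta,\theta)$, the XY/iSWAP family $(\theta,\theta,0)$ and the iSWAP--SWAP family $(\pi/4,\pi/4,\theta)$.
   Context: Cartan form. Every two-qubit unitary $U\in U(4)$ can be written $U=(V_1\otimes V_2)\,U_{\mathrm d}\,(V_3\otimes V_4)$ with single-qubit unitaries $V_j$ and $U_{\mathrm d}=U_{\mathrm d}(\theta_1,\theta_2,\theta_3)=\exp[\mathrm i(\theta_1X\otimes X+\theta_2Y\otimes Y+\theta_3Z\otimes Z)]$, where $X,Y,Z$ are the Pauli matrices and $|\theta_3|\le\theta_2\le\theta_1\le\pi/4$. A "family" $(\theta_1(\theta),\theta_2(\theta),\theta_3(\theta))$ means the gates $U_{\mathrm d}(\theta_1(\theta),\theta_2(\theta),\theta_3(\theta))$ for $0\le\theta\le\pi/4$. A family "attains" a boundary on a range of descriptor values if for each value in that range some member of the family has that descriptor value and has $\gamma$ equal to the boundary value. Operator-Schmidt spectrum. Write $U_{\mathrm d}=\sum_{j=0}^3u_j\,\sigma_j\otimes\sigma_j$ with $\sigma_0=\mathbb I,\sigma_1=X,\sigma_2=Y,\sigma_3=Z$, and put $p_j=|u_j|^2$, so $\sum_jp_j=1$. (Intrinsically,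 the operator-Schmidt singular values of $U$ with respect to Hilbert--Schmidt-orthonormal local operator bases are $2\sqrt{p_j}$.) Explicitly, with $c_j=\cos\theta_j$, $s_j=\sin\theta_j$: $p_0=c_1^2c_2^2c_3^2+s_1^2s_2^2s_3^2$, $p_1=s_1^2c_2^2c_3^2+c_1^2s_2^2s_3^2$, $p_2=c_1^2s_2^2c_3^2+s_1^2c_2^2s_3^2$, $p_3=c_1^2c_2^2s_3^2+s_1^2s_2^2c_3^2$. Quasiprobability extent. $\gamma(U)$ is the optimal gate-cutting (quasiprobability decomposition) cost of $U$; for two-qubit unitaries it is given by the known formula, taken here as its definition, $\gamma(U)=2\big(\sum_{j=0}^3\sqrt{p_j}\big)^2-1$. Entangling power. $e_{\mathrm p}(U)=\int \mathrm d\psi_A\,\mathrm d\psi_B\,[1-\operatorname{Tr}(\rho_A^2)]$, averaging uniformly (Haar) over pure product inputs, where $\rho_A=\operatorname{Tr}_B[U(|\psi_A\rangle\langle\psi_A|\otimes|\psi_B\rangle\langle\psi_B|)U^\dagger]$. In Cartan parameters this is known to equal $e_{\mathrm p}=\frac1{18}[3-\cos(4\theta_1)\cos(4\theta_2)-\cos(4\theta_2)\cos(4\theta_3)-\cos(4\theta_3)\cos(4\theta_1)]$. Gate typicality. $g_{\mathrm t}(U)=\frac13\sum_{j=1}^3\sin^2(2\theta_j)$. *)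

theory Defs
  imports "HOL-Analysis.Analysis"
begin

section \<open>Matrices\<close>

text \<open>The product \<open>*\<close> that the library puts on \<^typ>\<open>complex ^ 'n ^ 'n\<close> is entrywise, and so
  would be the powers built from it; the exponential below therefore iterates the matrix
  product \<open>**\<close>.\<close>

definition cscale :: "complex \<Rightarrow> complex ^ 'n ^ 'm \<Rightarrow> complex ^ 'n ^ 'm" where
  "cscale c A = (\<chi> i j. c * A $ i $ j)"

definition dagger :: "complex ^ 'n ^ 'm \<Rightarrow> complex ^ 'm ^ 'n" where
  "dagger A = (\<chi> i j. cnj (A $ j $ i))"

definition unitary :: "complex ^ 'n ^ 'n \<Rightarrow> bool" where
  "unitary U \<longleftrightarrow> dagger U ** U = mat 1 \<and> U ** dagger U = mat 1"

definition mat_exp :: "complex ^ 'n ^ 'n \<Rightarrow> complex ^ 'n ^ 'n" where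
  "mat_exp A = (\<Sum>n. (1 / fact n) *\<^sub>R (((**) A) ^^ n) (mat 1))"

text \<open>The index type of a tensor product is the product of the index types: qubit \<open>A\<close> is the first
  component, qubit \<open>B\<close> the second.\<close>

definition kron :: "complex ^ 'n ^ 'm \<Rightarrow> complex ^ 'l ^ 'k \<Rightarrow> complex ^ ('n \<times> 'l) ^ ('m \<times> 'k)" where
  "kron A B = (\<chi> i j. A $ fst i $ fst j * B $ snd i $ snd j)"

definition rank_one_proj :: "complex ^ 'n \<Rightarrow> complex ^ 'n ^ 'n" where
  "rank_one_proj v = (\<chi> i j. v $ i * cnj (v $ j))"

definition partial_trace_B :: "complex ^ ('n::finite \<times> 'm::finite) ^ ('n \<times> 'm) \<Rightarrow> complex ^ 'n ^ 'n" where
  "partial_trace_B R = (\<chi> i j. \<Sum>k\<in>UNIV. R $ (i, k) $ (j, k))"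

type_synonym one_qubit = "complex ^ 2 ^ 2"
type_synonym two_qubit = "complex ^ (2 \<times> 2) ^ (2 \<times> 2)"


section \<open>Cartan form\<close>

definition pauli_X :: one_qubit where
  "pauli_X = vector [vector [0, 1], vector [1, 0]]"

definition pauli_Y :: one_qubit where
  "pauli_Y = vector [vector [0, - \<i>], vector [\<i>, 0]]"

definition pauli_Z :: one_qubit where
  "pauli_Z = vector [vector [1, 0], vector [0, - 1]]"

text \<open>The type \<^typ>\<open>4\<close> consists of \<open>0, 1, 2, 3\<close>, with \<open>4 = 0\<close>.\<close>

definition pauli :: "4 \<Rightarrow> one_qubit" where
  "pauli j = (if j = 0 then mat 1 else if j = 1 then pauli_X else if j = 2 then pauli_Y else pauli_Z)"

definition U_d :: "real \<Rightarrow> real \<Rightarrow> real \<Rightarrow> two_qubit" where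
  "U_d \<theta>1 \<theta>2 \<theta>3 = mat_exp (cscale \<i>
     (\<theta>1 *\<^sub>R kron pauli_X pauli_X + \<theta>2 *\<^sub>R kron pauli_Y pauli_Y + \<theta>3 *\<^sub>R kron pauli_Z pauli_Z))"

definition cartan_form :: "two_qubit \<Rightarrow> real \<Rightarrow> real \<Rightarrow> real \<Rightarrow> bool" where
  "cartan_form U \<theta>1 \<theta>2 \<theta>3 \<longleftrightarrow>
     \<bar>\<theta>3\<bar> \<le> \<theta>2 \<and> \<theta>2 \<le> \<theta>1 \<and> \<theta>1 \<le> pi / 4 \<and>
     (\<exists>V1 V2 V3 V4 :: one_qubit. unitary V1 \<and> unitary V2 \<and> unitary V3 \<and> unitary V4 \<and>
        U = kron V1 V2 ** U_d \<theta>1 \<theta>2 \<theta>3 ** kron V3 V4)"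


section \<open>Operator-Schmidt spectrum and quasiprobability extent\<close>

definition pauli_coeffs :: "real \<Rightarrow> real \<Rightarrow> real \<Rightarrow> complex ^ 4" where
  "pauli_coeffs \<theta>1 \<theta>2 \<theta>3 =
     (THE u. U_d \<theta>1 \<theta>2 \<theta>3 = (\<Sum>j\<in>UNIV. cscale (u $ j) (kron (pauli j) (pauli j))))"

definition schmidt_prob :: "real \<Rightarrow> real \<Rightarrow> real \<Rightarrow> 4 \<Rightarrow> real" where
  "schmidt_prob \<theta>1 \<theta>2 \<theta>3 j = (cmod (pauli_coeffs \<theta>1 \<theta>2 \<theta>3 $ j))\<^sup>2"

text \<open>A two-qubit unitary can have more than one Cartan form (for instance
  \<open>\<theta>3\<close> may change sign when \<open>\<theta>1 = \<pi>/4\<close>). The extent and the gate typicality are the values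
  common to all its Cartan forms.\<close>

definition quasi_extent :: "two_qubit \<Rightarrow> real" where
  "quasi_extent U = (THE g. \<exists>\<theta>1 \<theta>2 \<theta>3. cartan_form U \<theta>1 \<theta>2 \<theta>3 \<and>
     g = 2 * (\<Sum>j\<in>UNIV. sqrt (schmidt_prob \<theta>1 \<theta>2 \<theta>3 j))\<^sup>2 - 1)"


section \<open>Entangling power and gate typicality\<close>

text \<open>The radial projection of the uniform distribution on the unit ball of \<open>\<complex>\<^sup>2\<close> is the
  \<open>U(2)\<close>-invariant probability measure on unit vectors. The purity below depends on a vector
  only through its rank-one projection, so integrating over unit vectors is integrating over
  pure states.\<close>

definition haar_state :: "(complex ^ 2) measure" where
  "haar_state = distr (uniform_measure lborel (ball 0 1)) borel (\<lambda>v. v /\<^sub>R norm v)"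

definition reduced_output :: "two_qubit \<Rightarrow> complex ^ 2 \<Rightarrow> complex ^ 2 \<Rightarrow> one_qubit" where
  "reduced_output U \<psi>A \<psi>B =
     partial_trace_B (U ** kron (rank_one_proj \<psi>A) (rank_one_proj \<psi>B) ** dagger U)"

definition entangling_power :: "two_qubit \<Rightarrow> real" where
  "entangling_power U =
     (\<integral>\<psi>A. (\<integral>\<psi>B. 1 - Re (trace (reduced_output U \<psi>A \<psi>B ** reduced_output U \<psi>A \<psi>B))
        \<partial>haar_state) \<partial>haar_state)"

definition gate_typicality :: "two_qubit \<Rightarrow> real" where
  "gate_typicality U = (THE g. \<exists>\<theta>1 \<theta>2 \<theta>3. cartan_form U \<theta>1 \<theta>2 \<theta>3 \<and>
     g = ((sin (2 * \<theta>1))\<^sup>2 + (sin (2 * \<theta>2))\<^sup>2 + (sin (2 * \<theta>3))\<^sup>2) / 3)"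


section \<open>Boundaries and attainment\<close>

text \<open>Neighbouring pieces agree at the breakpoints.\<close>

definition gamma_min :: "real \<Rightarrow> real" where
  "gamma_min g =
     (if g \<le> 1/3 then 1 + 2 * sqrt (3 * g)
      else if g \<le> 2/3 then 3 + 2 * sqrt ((3 * g - 1) * (5 - 3 * g))
      else 1 + 3 * g + 3 * sqrt (g * (4 - 3 * g)))"

definition gamma_max :: "real \<Rightarrow> real" where
  "gamma_max g =
     (if g \<le> 4/9 then 1 + 3 * g + 3 * sqrt (g * (4 - 3 * g))
      else if g \<le> 2/3 then 1 + 3 * g + 4 * sqrt (3 * g / 2)
      else 7)"

definition is_minimum :: "real set \<Rightarrow> real \<Rightarrow> bool" where
  "is_minimum S m \<longleftrightarrow> m \<in> S \<and> (\<forall>x\<in>S. m \<le> x)"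

definition is_maximum :: "real set \<Rightarrow> real \<Rightarrow> bool" where
  "is_maximum S m \<longleftrightarrow> m \<in> S \<and> (\<forall>x\<in>S. x \<le> m)"

definition attains ::
  "(real \<Rightarrow> two_qubit) \<Rightarrow> (two_qubit \<Rightarrow> real) \<Rightarrow> real set \<Rightarrow> (real \<Rightarrow> real) \<Rightarrow> bool" where
  "attains family descriptor R boundary \<longleftrightarrow>
     (\<forall>d\<in>R. \<exists>\<theta>\<in>{0..pi/4}. descriptor (family \<theta>) = d \<and> quasi_extent (family \<theta>) = boundary d)"

end

theory Submission
  imports Defs
begin

text \<open>
  In Cartan coordinates with \<open>a\<^sub>j = cos 2\<theta>\<^sub>j \<in> [0, 1]\<close> the operator-Schmidt probabilities are
  \<open>p\<^sub>0 = (1 + a\<^sub>2a\<^sub>3 + a\<^sub>1a\<^sub>3 + a\<^sub>1a\<^sub>2)/4\<close> and its sign changes, \<open>e\<^sub>p\<close> and \<open>g\<^sub>t\<close> are affine in the first two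
  elementary symmetric functions of \<open>a\<^sub>j\<^sup>2\<close>, and \<open>\<gamma> = 2 (\<Sum> \<surd>p\<^sub>j)\<^sup>2 - 1\<close>. Cauchy--Schwarz gives
  \<open>(\<Sum> \<surd>p\<^sub>j)\<^sup>2 \<ge> 1 + \<surd>(3 g\<^sub>t)\<close>, hence the bound in \<open>e\<^sub>p\<close> and the first piece of \<open>\<gamma>\<^sub>m\<^sub>i\<^sub>n\<close>. For the other
  pieces let \<open>r\<close> be half the Hadamard transform of \<open>\<surd>p\<close>. Fixing \<open>\<gamma>\<close> means fixing \<open>r\<^sub>0\<close>; with
  \<open>v = r\<^sub>1r\<^sub>2r\<^sub>3\<close> also fixed, \<open>g\<^sub>t\<close> is monotone in \<open>\<Sum> r\<^sub>i\<^sup>2r\<^sub>j\<^sup>2\<close>, so it is extremal when two of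
  the \<open>r\<^sub>i\<close> coincide, and on that curve the difference to each boundary factors explicitly.

  Cartan forms exist because in the magic basis \<open>U\<^sup>T U\<close> is a symmetric unitary matrix, hence has a real
  orthonormal eigenbasis, and every real orthonormal frame is moved to the magic basis by a local
  unitary. Their invariants are well defined because the power sums of \<open>p\<close> are traces of powers of the
  Gram matrix of the realigned gate, and \<open>e\<^sub>p\<close> is determined by \<open>U\<close>.
\<close>

subsection \<open>Extremal gate typicality at fixed extent\<close>

text \<open>The Hadamard transform turns the squaring p = q^2 into a convolution: b c / 2 = r0 r1 +
  r2 r3, and likewise for a c and a b. So g_t becomes a rational function of r, while the extent
  depends on r0 alone. In \<open>h_rel\<close> the right-hand side is nonnegative and
  \<open>G\<close> grows with \<open>pairs\<close>; this is why \<open>h\<close> falls as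
  \<open>pairs\<close> grows. Two obstacles shape the argument. At v = 0 both sides of
  \<open>h_rel\<close> vanish, so \<open>h_zero\<close> carries separate bounds for the gates with a
  = 0. And in the lower bound on \<open>h\<close>, a point (t, t, s) with s \<le> sig obeys the
  constraints \<open>dom\<close> only if s \<ge> 1 - r0, with equality on the XY family. For smaller
  v this point is inadmissible, and the product of the three constraints gives the bound instead.
  The breakpoint 2/3 of \<open>gamma_min\<close> is where the CNOT-SWAP bound hands over to the
  fractional SWAP bound; the breakpoint 4/9 of \<open>gamma_max\<close> is where the fractional SWAP
  bound hands over to the XY bound.\<close>

lemmas poly_simps = algebra_simps power2_eq_square power3_eq_cube

text \<open>The monic cubics with roots x, y, z and t, t, s agree except in their linear term, so at
  a root of the first only that term separates them.\<close>

lemma cubic_double_root: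
  fixes x y z s t w :: real
  assumes sum: "x + y + z = 2 * t + s" and prod: "x * y * z = t\<^sup>2 * s" and w: "w \<in> {x, y, z}"
  shows "(w - t)\<^sup>2 * (w - s) + (x * y + y * z + z * x - t\<^sup>2 - 2 * t * s) * w = 0"
proof -
  have "(w - x) * (w - y) * (w - z) =
      w^3 - (x + y + z) * w\<^sup>2 + (x * y + y * z + z * x) * w - x * y * z"
    by (simp add: poly_simps)
  also have "\<dots> = (w - t)\<^sup>2 * (w - s) + (x * y + y * z + z * x - t\<^sup>2 - 2 * t * s) * w"
    unfolding sum prod by (simp add: poly_simps)
  finally show ?thesis using w by auto
qed

text \<open>Were the pair sum smaller, the linear defect would be negative at each root, so every
  root would exceed s, and the total would exceed 3 s \<ge> 2 t + s. The companion lemma reverses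
  all signs. Both are applied to the squares of r1, r2, r3.\<close>

lemma sum_pairs_ge_double_root:
  fixes x y z s t :: real
  assumes pos: "0 < x" "0 < y" "0 < z" and sum: "x + y + z = 2 * t + s"
    and prod: "x * y * z = t\<^sup>2 * s" and "t \<le> s"
  shows "t\<^sup>2 + 2 * t * s \<le> x * y + y * z + z * x"
proof (rule ccontr)
  assume neg: "\<not> ?thesis"
  have "s < w" if "w \<in> {x, y, z}" for w
  proof (rule ccontr)
    assume "\<not> s < w"
    then have "(w - t)\<^sup>2 * (w - s) \<le> 0" by (simp add: mult_nonneg_nonpos)
    moreover have "(x * y + y * z + z * x - t\<^sup>2 - 2 * t * s) * w < 0"
      using neg that pos by (intro mult_neg_pos) auto
    moreover note cubic_double_root[OF sum prod that]
    ultimately show False by linarith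
  qed
  then have "s < x" "s < y" "s < z" by auto
  then show False using sum \<open>t \<le> s\<close> by linarith
qed

lemma sum_pairs_le_double_root:
  fixes x y z s t :: real
  assumes pos: "0 < x" "0 < y" "0 < z" and sum: "x + y + z = 2 * t + s"
    and prod: "x * y * z = t\<^sup>2 * s" and "s \<le> t"
  shows "x * y + y * z + z * x \<le> t\<^sup>2 + 2 * t * s"
proof (rule ccontr)
  assume neg: "\<not> ?thesis"
  have "w < s" if "w \<in> {x, y, z}" for w
  proof (rule ccontr)
    assume "\<not> w < s"
    then have "0 \<le> (w - t)\<^sup>2 * (w - s)" by simp
    moreover have "0 < (x * y + y * z + z * x - t\<^sup>2 - 2 * t * s) * w"
      using neg that pos by (intro mult_pos_pos) auto
    moreover note cubic_double_root[OF sum prod that]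
    ultimately show False by linarith
  qed
  then have "x < s" "y < s" "z < s" by auto
  then show False using sum \<open>s \<le> t\<close> by linarith
qed

lemma amgm3:
  fixes x y z :: real
  assumes "0 \<le> x" "0 \<le> y" "0 \<le> z"
  shows "27 * (x * y * z) \<le> (x + y + z)^3"
proof -
  have "(x + y + z)^3 - 27 * (x * y * z) =
      (x + y + z) * ((x - y)\<^sup>2 + (y - z)\<^sup>2 + (z - x)\<^sup>2) / 2
      + 3 * (x * (y - z)\<^sup>2 + y * (z - x)\<^sup>2 + z * (x - y)\<^sup>2)"
    by (simp add: field_simps power2_eq_square power3_eq_cube)
  also have "\<dots> \<ge> 0" using assms by (intro add_nonneg_nonneg divide_nonneg_pos mult_nonneg_nonneg) auto
  finally show ?thesis by simp
qed

lemma eq_product_le: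
  fixes a b c d e :: real
  assumes "a \<le> b" "0 < a" "a * c = e" "b * d = e" "0 \<le> e"
  shows "d \<le> c"
proof -
  have "0 \<le> d" using assms by (smt (verit) mult_pos_neg)
  then have "a * d \<le> a * c" using assms mult_right_mono[of a b d] by linarith
  then show ?thesis using assms(2) by simp
qed

text \<open>Here \<open>4 r\<^sub>0\<^sup>2 - 1 = (\<gamma> - 1) / 2\<close> and \<open>h = 3 g\<^sub>t - 1\<close>.\<close>

locale hadamard_spectrum =
  fixes r0 r1 r2 r3 h :: real
  assumes nonneg: "0 \<le> r1" "0 \<le> r2" "0 \<le> r3" and half: "1/2 \<le> r0"
    and norm1: "r0\<^sup>2 + r1\<^sup>2 + r2\<^sup>2 + r3\<^sup>2 = 1"
    and dom: "r2 * r3 \<le> r0 * r1" "r1 * r3 \<le> r0 * r2" "r1 * r2 \<le> r0 * r3"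
    and h_rel: "(r0\<^sup>2 * (r1\<^sup>2 * r2\<^sup>2 + r2\<^sup>2 * r3\<^sup>2 + r3\<^sup>2 * r1\<^sup>2) + r0 * (r1 * r2 * r3) + (r1 * r2 * r3)\<^sup>2)
        * (h * r0 + 8 * (r1 * r2 * r3))
      = 2 * (r1 * r2 * r3) * (r0 * (2 * r0\<^sup>2 - 1) - 2 * (r1 * r2 * r3))\<^sup>2"
    and h_zero: "r1 * r2 * r3 = 0 \<Longrightarrow>
      (2 * r0\<^sup>2 - 1)\<^sup>2 \<le> h \<and> h \<le> 2 - 4 * r0 * sqrt (1 - r0\<^sup>2)"
begin

abbreviation "v \<equiv> r1 * r2 * r3"
abbreviation "pairs \<equiv> r1\<^sup>2 * r2\<^sup>2 + r2\<^sup>2 * r3\<^sup>2 + r3\<^sup>2 * r1\<^sup>2"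
abbreviation "G \<equiv> r0\<^sup>2 * pairs + r0 * v + v\<^sup>2"
abbreviation "k \<equiv> r0 * (2 * r0\<^sup>2 - 1) - 2 * v"
text \<open>For given r0, \<open>sig\<close> is the common value of r1 = r2 = r3 (fractional SWAP)
  and \<open>eta\<close> is the value of one of them when the other two vanish (CNOT-SWAP).\<close>

abbreviation "sig \<equiv> sqrt ((1 - r0\<^sup>2) / 3)"
abbreviation "eta \<equiv> sqrt (1 - r0\<^sup>2)"

lemma r0_le1: "r0 \<le> 1"
proof -
  have "r0\<^sup>2 \<le> 1" using norm1 by (smt (verit) zero_le_power2)
  then show ?thesis by (metis abs_le_square_iff abs_one one_power2 abs_le_D1)
qed

lemma r0_sq: "r0\<^sup>2 \<le> 1" using norm1 by (smt (verit) zero_le_power2)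

lemma v_nonneg: "0 \<le> v" using nonneg by simp

lemma sig_sq: "3 * sig\<^sup>2 = 1 - r0\<^sup>2" and eta_sq: "eta\<^sup>2 = 1 - r0\<^sup>2" and sig_nonneg: "0 \<le> sig"
  and eta_nonneg: "0 \<le> eta"
  using r0_sq by auto

lemma sig_le_eta: "sig \<le> eta" by (rule real_sqrt_le_mono) (use r0_sq in auto)

lemma v_le_sig: "v \<le> sig^3"
proof (rule power2_le_imp_le)
  have "27 * (r1\<^sup>2 * r2\<^sup>2 * r3\<^sup>2) \<le> (r1\<^sup>2 + r2\<^sup>2 + r3\<^sup>2)^3" by (rule amgm3) auto
  also have "r1\<^sup>2 + r2\<^sup>2 + r3\<^sup>2 = 3 * sig\<^sup>2" using sig_sq norm1 by linarith
  finally have *: "27 * (r1\<^sup>2 * r2\<^sup>2 * r3\<^sup>2) \<le> (3 * sig\<^sup>2)^3" .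
  have e1: "v\<^sup>2 = r1\<^sup>2 * r2\<^sup>2 * r3\<^sup>2" by (simp only: power_mult_distrib)
  have e2: "(3 * z\<^sup>2)^3 = 27 * (z^3)\<^sup>2" for z :: real by (simp add: power_mult_distrib flip: power_mult)
  show "v\<^sup>2 \<le> (sig^3)\<^sup>2" using * unfolding e1 e2 by linarith
  show "0 \<le> sig^3" using sig_nonneg by simp
qed

text \<open>In the application the three factors are b c / 2, a c / 2 and a b / 2. The normalisation
  raises the term r0 v from degree four to degree six, after which the identity is
  polynomial.\<close>

lemma ABC: "G = (r0 * r1 + r2 * r3) * (r0 * r2 + r1 * r3) * (r0 * r3 + r1 * r2)"
proof -
  have "r0 * v = r0 * v * (r0\<^sup>2 + r1\<^sup>2 + r2\<^sup>2 + r3\<^sup>2)" using norm1 by simp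
  then show ?thesis by (simp add: poly_simps)
qed

text \<open>This is the product of the three constraints \<open>dom\<close>, so it is an equality as
  soon as one of them is tight.\<close>

lemma F_le: "r0\<^sup>2 * pairs \<le> r0 * v - v\<^sup>2"
proof -
  have "0 \<le> (r0 * r1 - r2 * r3) * (r0 * r2 - r1 * r3) * (r0 * r3 - r1 * r2)" using dom by simp
  also have "\<dots> = r0 * v * (r0\<^sup>2 + r1\<^sup>2 + r2\<^sup>2 + r3\<^sup>2) - r0\<^sup>2 * pairs - v\<^sup>2"
    by (simp add: poly_simps)
  finally show ?thesis using norm1 by simp
qed

text \<open>\<open>double_value s hs\<close> says that \<open>hs\<close> is the value of \<open>h\<close> at the point \<open>(t, t, s)\<close> with the same
  norm as \<open>(r\<^sub>1, r\<^sub>2, r\<^sub>3)\<close>.\<close>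

abbreviation "double_value s hs \<equiv>
  hs * (1 - (r0 - s)\<^sup>2) = 4 * r0 * s * (3 * r0\<^sup>2 + 3 * s\<^sup>2 - 2 * r0 * s - 2)"

text \<open>With r0 and v fixed, the product of \<open>G\<close> and h r0 + 8 v is a fixed
  nonnegative number, so comparing \<open>G\<close> here and at (t, t, s) compares the two values of
  h in the opposite order. Since \<open>sig\<close> squared is the mean of the squares, sig \<le> s
  says that the double root t^2 is at most s^2.\<close>

lemma double_point:
  assumes s: "s * (1 - r0\<^sup>2 - s\<^sup>2) = 2 * v" and "0 < v" "0 < s" and t: "t\<^sup>2 = (1 - r0\<^sup>2 - s\<^sup>2) / 2"
    and hs: "double_value s hs"
  shows "sig \<le> s \<Longrightarrow> h \<le> hs" "s \<le> sig \<Longrightarrow> hs \<le> h"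
proof -
  have r0: "0 < r0" using half by simp
  have vts: "v = t\<^sup>2 * s"
  proof -
    have "2 * (t\<^sup>2 * s) = s * (1 - r0\<^sup>2 - s\<^sup>2)" unfolding t by simp
    then show ?thesis using s by linarith
  qed
  have tpos: "0 < t\<^sup>2" using vts \<open>0 < v\<close> \<open>0 < s\<close> by (metis zero_less_mult_pos2)
  have one: "1 = r0\<^sup>2 + 2 * t\<^sup>2 + s\<^sup>2" using t by (simp add: field_simps)
  \<comment> \<open>\<open>Gs\<close> is \<open>G\<close> at the point (t, t, s). Once 1 is replaced
    by the norm, both \<open>Gs\<close> and \<open>k\<close> split off the factor r0 + s, which is
    what collapses \<open>h_rel\<close> to \<open>double_value\<close>.\<close>
  define Gs where "Gs = r0\<^sup>2 * ((t\<^sup>2)\<^sup>2 + 2 * t\<^sup>2 * s\<^sup>2) + r0 * v + v\<^sup>2"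
  have Gs: "Gs = t\<^sup>2 * (r0 + s)\<^sup>2 * (r0 * s + t\<^sup>2)"
  proof -
    have "Gs = r0\<^sup>2 * ((t\<^sup>2)\<^sup>2 + 2 * t\<^sup>2 * s\<^sup>2) + r0 * (t\<^sup>2 * s) * (r0\<^sup>2 + 2 * t\<^sup>2 + s\<^sup>2) + (t\<^sup>2 * s)\<^sup>2"
      unfolding Gs_def vts using one by simp
    then show ?thesis by (simp add: poly_simps)
  qed
  have Gspos: "0 < Gs" unfolding Gs using tpos r0 \<open>0 < s\<close> by (simp add: add_pos_pos)
  have ks: "k = (r0 + s) * (r0\<^sup>2 - r0 * s - 2 * t\<^sup>2)"
  proof -
    have "k = r0 * (2 * r0\<^sup>2 - (r0\<^sup>2 + 2 * t\<^sup>2 + s\<^sup>2)) - 2 * (t\<^sup>2 * s)" using vts one by simp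
    then show ?thesis by (simp add: poly_simps)
  qed
  have den: "1 - (r0 - s)\<^sup>2 = 2 * (r0 * s + t\<^sup>2)"
    by (subst one) (simp add: poly_simps)
  have num: "3 * r0\<^sup>2 + 3 * s\<^sup>2 - 2 * r0 * s - 2 = (r0 - s)\<^sup>2 - 4 * t\<^sup>2"
    using one by (simp add: poly_simps)
  have hs': "hs * (r0 * s + t\<^sup>2) = 2 * r0 * s * ((r0 - s)\<^sup>2 - 4 * t\<^sup>2)"
    using hs unfolding den num by (simp add: algebra_simps)
  have rel: "Gs * (hs * r0 + 8 * v) = 2 * v * k\<^sup>2"
  proof -
    have "Gs * (hs * r0 + 8 * v) = t\<^sup>2 * (r0 + s)\<^sup>2 * ((hs * (r0 * s + t\<^sup>2)) * r0 + 8 * (t\<^sup>2 * s) * (r0 * s + t\<^sup>2))"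
      unfolding Gs vts by (simp add: algebra_simps)
    also have "\<dots> = 2 * v * k\<^sup>2" unfolding hs' ks unfolding vts by (simp add: poly_simps)
    finally show ?thesis .
  qed
  have rpos: "0 < r1" "0 < r2" "0 < r3" using nonneg \<open>0 < v\<close> by (auto simp: zero_less_mult_iff)
  have sq: "0 < r1\<^sup>2" "0 < r2\<^sup>2" "0 < r3\<^sup>2" using rpos by auto
  have sums: "r1\<^sup>2 + r2\<^sup>2 + r3\<^sup>2 = 2 * t\<^sup>2 + s\<^sup>2" using norm1 one by linarith
  have prods: "r1\<^sup>2 * r2\<^sup>2 * r3\<^sup>2 = (t\<^sup>2)\<^sup>2 * s\<^sup>2" using arg_cong[OF vts, of "\<lambda>x. x\<^sup>2"] by (simp only: power_mult_distrib)
  have Gpos: "0 < G" unfolding ABC using rpos r0 by (simp add: add_pos_pos)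
  have rhs: "0 \<le> 2 * v * k\<^sup>2" using nonneg by (intro mult_nonneg_nonneg) auto
  { assume "sig \<le> s"
    then have "sig\<^sup>2 \<le> s\<^sup>2" using sig_nonneg by (intro power_mono)
    then have "t\<^sup>2 \<le> s\<^sup>2" using sig_sq one by linarith
    from sum_pairs_ge_double_root[OF sq sums prods this]
    have "Gs \<le> G" unfolding Gs_def using r0 by (intro add_right_mono mult_left_mono) auto
    from eq_product_le[OF this Gspos rel h_rel rhs] have "h * r0 + 8 * v \<le> hs * r0 + 8 * v" .
    then show "h \<le> hs" using r0 by simp }
  { assume "s \<le> sig"
    then have "s\<^sup>2 \<le> sig\<^sup>2" using \<open>0 < s\<close> by (intro power_mono) auto
    then have "s\<^sup>2 \<le> t\<^sup>2" using sig_sq one by linarith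
    from sum_pairs_le_double_root[OF sq sums prods this]
    have "G \<le> Gs" unfolding Gs_def using r0 by (intro add_right_mono mult_left_mono) auto
    from eq_product_le[OF this Gpos h_rel rel rhs] have "hs * r0 + 8 * v \<le> h * r0 + 8 * v" .
    then show "hs \<le> h" using r0 by simp }
qed


text \<open>The cubic s (1 - r0^2 - s^2) rises up to s = sig and falls after it. The two
  alternatives let the intermediate value theorem be used on the falling branch up to
  \<open>eta\<close> and on the rising branch.\<close>

lemma double_point_exists:
  assumes "a \<le> b" "0 \<le> a" "b \<le> eta"
    and "2 * v \<le> a * (1 - r0\<^sup>2 - a\<^sup>2) \<and> b * (1 - r0\<^sup>2 - b\<^sup>2) \<le> 2 * v
       \<or> a * (1 - r0\<^sup>2 - a\<^sup>2) \<le> 2 * v \<and> 2 * v \<le> b * (1 - r0\<^sup>2 - b\<^sup>2)" and "0 < v"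
  obtains s hs where "a \<le> s" "s \<le> b" "0 < s" "0 < 1 - (r0 - s)\<^sup>2"
    "double_value s hs"
    "sig \<le> s \<Longrightarrow> h \<le> hs" "s \<le> sig \<Longrightarrow> hs \<le> h"
proof -
  have "continuous_on {a..b} (\<lambda>s. s * (1 - r0\<^sup>2 - s\<^sup>2))" by (intro continuous_intros)
  from IVT'[OF _ _ \<open>a \<le> b\<close> this] IVT2'[OF _ _ \<open>a \<le> b\<close> this] assms(4)
  obtain s where s: "a \<le> s" "s \<le> b" "s * (1 - r0\<^sup>2 - s\<^sup>2) = 2 * v" by meson
  have "s \<noteq> 0" using s(3) \<open>0 < v\<close> by auto
  then have s0: "0 < s" using s(1) assms(2) by linarith
  have "s\<^sup>2 \<le> eta\<^sup>2" using s assms s0 by (intro power_mono) auto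
  then have t: "(sqrt ((1 - r0\<^sup>2 - s\<^sup>2) / 2))\<^sup>2 = (1 - r0\<^sup>2 - s\<^sup>2) / 2" using eta_sq by simp
  have pos: "0 < 1 - (r0 - s)\<^sup>2"
  proof -
    have "1 - (r0 - s)\<^sup>2 = (1 - r0\<^sup>2 - s\<^sup>2) + 2 * r0 * s" by (simp add: poly_simps)
    moreover have "0 < 2 * r0 * s" using half s0 by simp
    ultimately show ?thesis using \<open>s\<^sup>2 \<le> eta\<^sup>2\<close> eta_sq by linarith
  qed
  define hs where "hs = 4 * r0 * s * (3 * r0\<^sup>2 + 3 * s\<^sup>2 - 2 * r0 * s - 2) / (1 - (r0 - s)\<^sup>2)"
  have hs: "double_value s hs"
    unfolding hs_def using pos by simp
  from double_point[OF s(3) \<open>0 < v\<close> s0 t hs] show ?thesis using that s s0 pos hs by blast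
qed

text \<open>The subtracted value belongs to the isotropic point s = t = sig, where the two curves
  touch; hence the double zero. The sign is left to the linear factor 2 s + 3 sig - r0.\<close>

lemma iso_difference:
  assumes "double_value s hs"
  shows "(hs - (2 * r0\<^sup>2 - 6 * r0 * sig)) * (1 - (r0 - s)\<^sup>2) = 6 * r0 * (s - sig)\<^sup>2 * (2 * s + 3 * sig - r0)"
proof -
  obtain z where z: "z = sig" by simp
  have one: "1 = r0\<^sup>2 + 3 * z\<^sup>2" using sig_sq unfolding z by linarith
  have "(hs - (2 * r0\<^sup>2 - 6 * r0 * z)) * (1 - (r0 - s)\<^sup>2)
      = 4 * r0 * s * (3 * r0\<^sup>2 + 3 * s\<^sup>2 - 2 * r0 * s - 2 * 1) - (2 * r0\<^sup>2 - 6 * r0 * z) * (1 - (r0 - s)\<^sup>2)"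
    using assms by (simp add: algebra_simps)
  also have "\<dots> = 6 * r0 * (s - z)\<^sup>2 * (2 * s + 3 * z - r0)"
    unfolding one by (simp add: poly_simps)
  finally show ?thesis unfolding z .
qed

lemma sig_cube: "sig * (1 - r0\<^sup>2 - sig\<^sup>2) = 2 * sig^3"
proof -
  have *: "z * (3 * z\<^sup>2 - z\<^sup>2) = 2 * z^3" for z :: real
    by (simp add: power2_eq_square power3_eq_cube)
  show ?thesis using *[of sig] unfolding sig_sq .
qed

lemma sqrt3_sig: "eta = sqrt 3 * sig"
  by (simp flip: real_sqrt_mult)

lemma lower_point_exists:
  assumes "0 < v"
  obtains s hs where "sig \<le> s" "s \<le> eta" "0 < s" "0 < 1 - (r0 - s)\<^sup>2" "double_value s hs" "h \<le> hs"
proof -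
  have "2 * v \<le> sig * (1 - r0\<^sup>2 - sig\<^sup>2)" using v_le_sig sig_cube by linarith
  moreover have "eta * (1 - r0\<^sup>2 - eta\<^sup>2) = 0" unfolding eta_sq by simp
  then have "eta * (1 - r0\<^sup>2 - eta\<^sup>2) \<le> 2 * v" using assms by linarith
  ultimately show ?thesis
    by (rule double_point_exists[OF sig_le_eta sig_nonneg order_refl disjI1[OF conjI] assms]) (use that in blast)
qed

text \<open>At the far end s = eta = sqrt 3 sig the linear factor of \<open>iso_difference\<close>
  is (3 + 2 sqrt 3) sig - r0, so the hypothesis makes it nonpositive for every possible s.\<close>

lemma h_le_iso:
  assumes r0: "(3 + 2 * sqrt 3) * sig \<le> r0"
  shows "h \<le> 2 * r0\<^sup>2 - 6 * r0 * sig"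
proof (cases "v = 0")
  case True
  then have "h \<le> 2 - 4 * r0 * eta" using h_zero by blast
  also have "\<dots> = 2 * (r0\<^sup>2 + 3 * sig\<^sup>2) - 4 * r0 * (sqrt 3 * sig)" using sig_sq sqrt3_sig by simp
  also have "\<dots> \<le> 2 * r0\<^sup>2 - 6 * r0 * sig"
  proof -
    have "3/2 \<le> sqrt (3::real)" by (rule real_le_rsqrt) (simp add: power2_eq_square)
    then have "(4 * sqrt 3 - 6) * ((3 + 2 * sqrt 3) * sig) \<le> (4 * sqrt 3 - 6) * r0"
      using r0 by (intro mult_left_mono) auto
    moreover have "(4 * sqrt 3 - 6) * ((3 + 2 * sqrt 3) * sig) = 6 * sig"
      by (simp add: algebra_simps)
    ultimately have "sig * (6 * sig) \<le> sig * ((4 * sqrt 3 - 6) * r0)"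
      using sig_nonneg by (intro mult_left_mono) auto
    then show ?thesis by (simp add: poly_simps)
  qed
  finally show ?thesis .
next
  case False
  with v_nonneg have "0 < v" by linarith
  then obtain s hs where s: "sig \<le> s" "s \<le> eta" "0 < 1 - (r0 - s)\<^sup>2"
    "double_value s hs" "h \<le> hs"
    by (rule lower_point_exists)
  have "2 * s + 3 * sig - r0 \<le> 0" using s(2) r0 unfolding sqrt3_sig by (simp add: algebra_simps)
  then have "6 * r0 * (s - sig)\<^sup>2 * (2 * s + 3 * sig - r0) \<le> 0"
    using half by (intro mult_nonneg_nonpos) auto
  then have "hs \<le> 2 * r0\<^sup>2 - 6 * r0 * sig"
    using iso_difference[OF s(4)] s(3) by (smt (verit) mult_pos_pos)
  then show ?thesis using s(5) by linarith
qed

text \<open>The CNOT-SWAP point is the end s = eta of the curve of double points, so the difference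
  contains s - eta; the work is to show that the remaining quadratic K in s is nonnegative.\<close>

lemma h_le_cnot_swap:
  assumes r0: "r0 \<le> (3 + 2 * sqrt 3) * sig"
  shows "h \<le> 2 - 4 * r0 * eta"
proof (cases "v = 0")
  case True
  then show ?thesis using h_zero by blast
next
  case False
  with v_nonneg have "0 < v" by linarith
  then obtain s hs where s: "sig \<le> s" "s \<le> eta" "0 < s" "0 < 1 - (r0 - s)\<^sup>2"
    "double_value s hs" "h \<le> hs"
    by (rule lower_point_exists)
  obtain y where y: "y = eta" by simp
  have y0: "0 \<le> y" using eta_nonneg y by simp
  have one: "1 = r0\<^sup>2 + y\<^sup>2" using eta_sq unfolding y by linarith
  define b where "b = y\<^sup>2 + 4 * y * r0 - 3 * r0\<^sup>2"
  define K where "K = 6 * r0 * s\<^sup>2 + b * s + y * (r0 - y)\<^sup>2"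
  have diff: "(hs - (2 - 4 * r0 * y)) * (1 - (r0 - s)\<^sup>2) = 2 * ((s - y) * K)"
  proof -
    have "(hs - (2 - 4 * r0 * y)) * (1 - (r0 - s)\<^sup>2)
      = 4 * r0 * s * (3 * r0\<^sup>2 + 3 * s\<^sup>2 - 2 * r0 * s - 2 * 1) - (2 * 1 - 4 * r0 * y) * (1 - (r0 - s)\<^sup>2)"
      using s(5) by (simp add: algebra_simps)
    also have "\<dots> = 2 * ((s - y) * K)"
      unfolding one K_def b_def by (simp add: poly_simps)
    finally show ?thesis .
  qed
  \<comment> \<open>The discriminant of K is the product of two quadratic forms in y and r0. The
    first is nonpositive between the slopes 2 - sqrt 3 and 2 + sqrt 3; the lower slope comes from
    the hypothesis through (2 - sqrt 3)(3 + 2 sqrt 3) = sqrt 3. If the second form is negative, then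
    b is nonnegative and K has no negative coefficient.\<close>
  have "0 \<le> K"
  proof (cases "0 \<le> y\<^sup>2 - 12 * y * r0 + 9 * r0\<^sup>2")
    case True
    have "y \<le> (2 + sqrt 3) * r0"
    proof (rule power2_le_imp_le)
      have "(1/2)\<^sup>2 \<le> r0\<^sup>2" using half by (intro power_mono) auto
      then have "y\<^sup>2 \<le> 3 * r0\<^sup>2" using one by (simp add: power2_eq_square)
      also have "\<dots> \<le> (2 + sqrt 3)\<^sup>2 * r0\<^sup>2" by (intro mult_right_mono) (auto simp: poly_simps)
      finally show "y\<^sup>2 \<le> ((2 + sqrt 3) * r0)\<^sup>2" by (simp add: power_mult_distrib)
      show "0 \<le> (2 + sqrt 3) * r0" using half by simp
    qed
    moreover have "(2 - sqrt 3) * r0 \<le> y"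
    proof -
      have "(2 - sqrt 3) * r0 \<le> (2 - sqrt 3) * ((3 + 2 * sqrt 3) * sig)"
        using r0 by (intro mult_left_mono) (auto intro: real_le_lsqrt)
      also have "\<dots> = y" unfolding y sqrt3_sig by (simp add: algebra_simps)
      finally show ?thesis .
    qed
    ultimately have "(y - (2 - sqrt 3) * r0) * (y - (2 + sqrt 3) * r0) \<le> 0"
      by (intro mult_nonneg_nonpos) auto
    then have "y\<^sup>2 - 4 * y * r0 + r0\<^sup>2 \<le> 0" by (simp add: poly_simps)
    with True have "(y\<^sup>2 - 4 * y * r0 + r0\<^sup>2) * (y\<^sup>2 - 12 * y * r0 + 9 * r0\<^sup>2) \<le> 0"
      by (intro mult_nonpos_nonneg) auto
    moreover have "24 * r0 * K = (12 * r0 * s + b)\<^sup>2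
        - (y\<^sup>2 - 4 * y * r0 + r0\<^sup>2) * (y\<^sup>2 - 12 * y * r0 + 9 * r0\<^sup>2)"
      unfolding K_def b_def by (simp add: poly_simps)
    ultimately have "0 \<le> 24 * r0 * K" using zero_le_power2[of "12 * r0 * s + b"] by linarith
    then show ?thesis using half by (simp add: zero_le_mult_iff)
  next
    case False
    then have "0 \<le> b" unfolding b_def using zero_le_power2[of y] by linarith
    then show ?thesis unfolding K_def using half y0 s(3) by simp
  qed
  moreover have "s - y \<le> 0" using s(2) y by simp
  ultimately have "(s - y) * K \<le> 0" by (intro mult_nonpos_nonneg)
  then have "hs \<le> 2 - 4 * r0 * y" using diff s(4) by (smt (verit) mult_pos_pos)
  then show ?thesis using s(6) unfolding y by linarith
qed

text \<open>The threshold is the value of v at the XY gate with the same r0, where (r1, r2, r3) =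
  (t, t, 1 - r0) and t^2 = r0 (1 - r0). Below it the double point violates \<open>dom\<close>, so
  \<open>G\<close> is bounded by 2 r0 v through \<open>F_le\<close> instead.\<close>

lemma h_ge_small_v:
  assumes v: "v \<le> r0 * (1 - r0)\<^sup>2"
  shows "8 * r0\<^sup>2 - 8 * r0 + 1 \<le> h"
proof (cases "v = 0")
  case True
  have "(2 * r0\<^sup>2 - 1)\<^sup>2 - (8 * r0\<^sup>2 - 8 * r0 + 1) = 4 * r0 * (r0 - 1)\<^sup>2 * (r0 + 2)"
    by (simp add: poly_simps)
  also have "\<dots> \<ge> 0" using half by simp
  finally show ?thesis using h_zero[OF True] by linarith
next
  case False
  with v_nonneg have vpos: "0 < v" by linarith
  have r0: "0 < r0" using half by simp
  have rpos: "0 < r1" "0 < r2" "0 < r3" using nonneg vpos by (auto simp: zero_less_mult_iff)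
  have Gpos: "0 < G" unfolding ABC using rpos r0 by (simp add: add_pos_pos)
  have "0 \<le> G * (h * r0 + 8 * v)" unfolding h_rel using nonneg by (intro mult_nonneg_nonneg) auto
  then have "0 \<le> h * r0 + 8 * v" using Gpos by (simp add: zero_le_mult_iff)
  then have "G * (h * r0 + 8 * v) \<le> (2 * r0 * v) * (h * r0 + 8 * v)"
    using F_le by (intro mult_right_mono) auto
  then have "2 * v * k\<^sup>2 \<le> 2 * v * (r0 * (h * r0 + 8 * v))" unfolding h_rel by (simp add: algebra_simps)
  then have le: "k\<^sup>2 \<le> r0 * (h * r0 + 8 * v)" using vpos by (simp only: mult_le_cancel_left_pos)
  \<comment> \<open>After division by r0^2 the bound is a quadratic in w that meets the XY value at
    w = (1 - r0)^2.\<close>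
  define w where "w = v / r0"
  have w: "v = w * r0" "0 \<le> w" "w \<le> (1 - r0)\<^sup>2" unfolding w_def using r0 v v_nonneg by (auto simp: field_simps)
  have "r0\<^sup>2 * (2 * r0\<^sup>2 - 1 - 2 * w)\<^sup>2 \<le> r0\<^sup>2 * (h + 8 * w)"
    using le unfolding w(1) by (simp add: poly_simps)
  then have "(2 * r0\<^sup>2 - 1 - 2 * w)\<^sup>2 - 8 * w \<le> h" using r0 by simp
  moreover have "(2 * r0\<^sup>2 - 1 - 2 * w)\<^sup>2 - 8 * w - (8 * r0\<^sup>2 - 8 * r0 + 1)
      = 4 * ((1 - r0)\<^sup>2 - w) * (4 * r0 - 1 + ((1 - r0)\<^sup>2 - w))"
    by (simp add: poly_simps)
  moreover have "\<dots> \<ge> 0" using w(3) half by simp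
  ultimately show ?thesis by linarith
qed

text \<open>By the normalisation, s \<ge> 1 - r0 is equivalent to t^2 \<le> r0 s, the constraint
  from \<open>dom\<close> at the double point.\<close>

lemma upper_point_exists:
  assumes v: "r0 * (1 - r0)\<^sup>2 < v"
  obtains s hs where "1 - r0 \<le> s" "s \<le> sig" "0 < s" "0 < 1 - (r0 - s)\<^sup>2"
    "double_value s hs" "hs \<le> h"
proof -
  have le: "1 - r0 \<le> sig"
  proof (rule power2_le_imp_le)
    have "3 * (1 - r0)\<^sup>2 = (1 - r0) * (3 - 3 * r0)" by (simp add: poly_simps)
    also have "\<dots> \<le> (1 - r0) * (1 + r0)" using r0_le1 half by (intro mult_left_mono) auto
    also have "\<dots> = 3 * sig\<^sup>2" unfolding sig_sq by (simp add: poly_simps)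
    finally show "(1 - r0)\<^sup>2 \<le> sig\<^sup>2" by linarith
  qed (rule sig_nonneg)
  have "(1 - r0) * (1 - r0\<^sup>2 - (1 - r0)\<^sup>2) = 2 * (r0 * (1 - r0)\<^sup>2)"
    by (simp add: poly_simps)
  then have "(1 - r0) * (1 - r0\<^sup>2 - (1 - r0)\<^sup>2) \<le> 2 * v" using v by linarith
  moreover have "2 * v \<le> sig * (1 - r0\<^sup>2 - sig\<^sup>2)" using v_le_sig sig_cube by linarith
  note ends = calculation this
  have "0 \<le> r0 * (1 - r0)\<^sup>2" using half by simp
  then have vpos: "0 < v" using v by linarith
  have "0 \<le> 1 - r0" using r0_le1 by simp
  from double_point_exists[OF le this sig_le_eta disjI2[OF conjI[OF ends]] vpos]
  show ?thesis using that by metis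
qed

text \<open>At the near end s = 1 - r0 the linear factor of \<open>iso_difference\<close> is 2 - 3
  r0 + 3 sig, and it increases with s. For small v the XY point itself, s = 1 - r0, takes the place
  of the double point.\<close>

lemma h_ge_iso:
  assumes r0: "3 * r0 - 2 \<le> 3 * sig"
  shows "2 * r0\<^sup>2 - 6 * r0 * sig \<le> h"
proof -
  obtain s hs where s: "1 - r0 \<le> s" "0 < 1 - (r0 - s)\<^sup>2"
    "double_value s hs" "hs \<le> h"
  proof (cases "v \<le> r0 * (1 - r0)\<^sup>2")
    case True
    have "r0 \<noteq> 1" using r0 by auto
    then have "0 < 4 * r0 * (1 - r0)" using half r0_le1 by simp
    then have "0 < 1 - (r0 - (1 - r0))\<^sup>2" by (simp add: poly_simps)
    moreover have "(8 * r0\<^sup>2 - 8 * r0 + 1) * (1 - (r0 - (1 - r0))\<^sup>2)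
        = 4 * r0 * (1 - r0) * (3 * r0\<^sup>2 + 3 * (1 - r0)\<^sup>2 - 2 * r0 * (1 - r0) - 2)"
      by (simp add: poly_simps)
    ultimately show ?thesis using h_ge_small_v[OF True] that by blast
  next
    case False
    then have "r0 * (1 - r0)\<^sup>2 < v" by simp
    then show ?thesis by (rule upper_point_exists) (use that in blast)
  qed
  have "0 \<le> 6 * r0 * (s - sig)\<^sup>2 * (2 * s + 3 * sig - r0)"
    using half s(1) r0 by (intro mult_nonneg_nonneg) auto
  then have "2 * r0\<^sup>2 - 6 * r0 * sig \<le> hs"
    using iso_difference[OF s(3)] s(2) by (smt (verit) mult_neg_pos)
  then show ?thesis using s(4) by linarith
qed

lemma h_ge_xy:
  assumes r0: "3 * sig \<le> 3 * r0 - 2"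
  shows "8 * r0\<^sup>2 - 8 * r0 + 1 \<le> h"
proof (cases "v \<le> r0 * (1 - r0)\<^sup>2")
  case True
  then show ?thesis by (rule h_ge_small_v)
next
  case False
  then have "r0 * (1 - r0)\<^sup>2 < v" by simp
  then obtain s hs where s: "1 - r0 \<le> s" "0 < 1 - (r0 - s)\<^sup>2"
    "double_value s hs" "hs \<le> h"
    by (rule upper_point_exists)
  define K where "K = 12 * r0 * s\<^sup>2 + (1 + 6 * r0) * (1 - 2 * r0) * s + (1 + r0) * (8 * r0\<^sup>2 - 8 * r0 + 1)"
  have diff: "(hs - (8 * r0\<^sup>2 - 8 * r0 + 1)) * (1 - (r0 - s)\<^sup>2) = (s - (1 - r0)) * K"
  proof -
    have "(hs - (8 * r0\<^sup>2 - 8 * r0 + 1)) * (1 - (r0 - s)\<^sup>2) =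
       4 * r0 * s * (3 * r0\<^sup>2 + 3 * s\<^sup>2 - 2 * r0 * s - 2) - (8 * r0\<^sup>2 - 8 * r0 + 1) * (1 - (r0 - s)\<^sup>2)"
      using s(3) by (simp add: algebra_simps)
    also have "\<dots> = (s - (1 - r0)) * K" unfolding K_def by (simp add: poly_simps)
    finally show ?thesis .
  qed
  \<comment> \<open>Squaring the hypothesis yields the sign of one factor of the negated
    discriminant of K; the other factor is positive for r0 \<ge> 1/2.\<close>
  have "(3 * sig)\<^sup>2 \<le> (3 * r0 - 2)\<^sup>2" using r0 sig_nonneg by (intro power_mono) auto
  moreover have "(3 * sig)\<^sup>2 = 3 * (1 - r0\<^sup>2)" using sig_sq by (simp add: power_mult_distrib)
  ultimately have disc: "0 \<le> 12 * r0\<^sup>2 - 12 * r0 + 1" by (simp add: poly_simps)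
  have "0 \<le> 20 * r0\<^sup>2 + 28 * r0 - 1" using half zero_le_power2[of r0] by linarith
  with disc have "0 \<le> (12 * r0\<^sup>2 - 12 * r0 + 1) * (20 * r0\<^sup>2 + 28 * r0 - 1)" by simp
  moreover have "48 * r0 * K = (24 * r0 * s + (1 + 6 * r0) * (1 - 2 * r0))\<^sup>2
      + (12 * r0\<^sup>2 - 12 * r0 + 1) * (20 * r0\<^sup>2 + 28 * r0 - 1)"
    unfolding K_def by (simp add: poly_simps)
  ultimately have "0 \<le> 48 * r0 * K"
    using zero_le_power2[of "24 * r0 * s + (1 + 6 * r0) * (1 - 2 * r0)"] by linarith
  then have "0 \<le> K" using half by (simp add: zero_le_mult_iff)
  then have "0 \<le> (s - (1 - r0)) * K" using s(1) by simp
  then have "8 * r0\<^sup>2 - 8 * r0 + 1 \<le> hs" using diff s(2) by (smt (verit) mult_neg_pos)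
  then show ?thesis using s(4) by linarith
qed

end

subsection \<open>The boundary curves\<close>

text \<open>Multiplying the increment by the sum of the two roots rationalises it. On [0, 1] each
  root is at least its argument, so the cofactor is at least 4 - 2 (g + g') \<ge> 0.\<close>

lemma iso_value_mono:
  fixes g g' :: real
  assumes "0 \<le> g" "g \<le> g'" "g' \<le> 1"
  shows "g + sqrt (g * (4 - 3 * g)) \<le> g' + sqrt (g' * (4 - 3 * g'))"
proof (cases "g = g'")
  case False
  have le: "x \<le> sqrt (x * (4 - 3 * x))" if "0 \<le> x" "x \<le> 1" for x :: real
  proof (rule real_le_rsqrt)
    have "x * x \<le> x * (4 - 3 * x)" using that by (intro mult_left_mono) auto
    then show "x\<^sup>2 \<le> x * (4 - 3 * x)" by (simp add: power2_eq_square)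
  qed
  define u w where "u = sqrt (g * (4 - 3 * g))" and "w = sqrt (g' * (4 - 3 * g'))"
  have u: "g \<le> u" "u\<^sup>2 = g * (4 - 3 * g)" and w: "g' \<le> w" "w\<^sup>2 = g' * (4 - 3 * g')"
    unfolding u_def w_def using le[of g] le[of g'] assms by auto
  have "(w - u + (g' - g)) * (w + u) = (g' - g) * (4 - 3 * (g + g') + (w + u))"
    using u(2) w(2) by (simp add: poly_simps)
  also have "\<dots> \<ge> 0" using assms u w by (intro mult_nonneg_nonneg) auto
  finally have "0 \<le> (w - u + (g' - g)) * (w + u)" .
  moreover have "0 < w + u" using u w assms False by linarith
  ultimately have "0 \<le> w - u + (g' - g)" by (simp add: zero_le_mult_iff)
  then show ?thesis unfolding u_def w_def by simp
qed simp

context hadamard_spectrum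
begin

text \<open>So g_t = (r0 - sig)^2 on the fractional SWAP curve, which turns bounds on h into
  comparisons of two values of g_t.\<close>

lemma h_iso_sq: "2 * r0\<^sup>2 - 6 * r0 * sig = 3 * (r0 - sig)\<^sup>2 - 1"
proof -
  have "z\<^sup>2 * 3 = 1 - r0\<^sup>2 \<Longrightarrow> 2 * r0\<^sup>2 - 6 * r0 * z = 3 * (r0 - z)\<^sup>2 - 1" for z
    by (simp add: poly_simps)
  then show ?thesis using sig_sq by (metis mult.commute)
qed

lemma sig_le_r0: "sig \<le> r0"
proof (rule power2_le_imp_le)
  have "(1/2)\<^sup>2 \<le> r0\<^sup>2" using half by (intro power_mono) auto
  then show "sig\<^sup>2 \<le> r0\<^sup>2" using sig_sq by (simp add: power2_eq_square)
qed (use half in auto)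

lemma iso_value:
  "1 + 3 * (r0 - sig)\<^sup>2 + 3 * sqrt ((r0 - sig)\<^sup>2 * (4 - 3 * (r0 - sig)\<^sup>2)) = 8 * r0\<^sup>2 - 1"
proof -
  obtain z where z: "z = sig" by simp
  have one: "1 = r0\<^sup>2 + 3 * z\<^sup>2" using sig_sq unfolding z by linarith
  have "4 - 3 * (r0 - z)\<^sup>2 = 4 * 1 - 3 * (r0 - z)\<^sup>2" by simp
  also have "\<dots> = (r0 + 3 * z)\<^sup>2" unfolding one by (simp add: poly_simps)
  finally have "sqrt ((r0 - z)\<^sup>2 * (4 - 3 * (r0 - z)\<^sup>2)) = \<bar>r0 - z\<bar> * \<bar>r0 + 3 * z\<bar>"
    by (simp add: real_sqrt_mult)
  also have "\<dots> = (r0 - z) * (r0 + 3 * z)" using sig_le_r0 sig_nonneg half unfolding z by simp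
  finally have "1 + 3 * (r0 - z)\<^sup>2 + 3 * sqrt ((r0 - z)\<^sup>2 * (4 - 3 * (r0 - z)\<^sup>2))
     = 1 + 3 * (r0 - z)\<^sup>2 + 3 * ((r0 - z) * (r0 + 3 * z))" by simp
  also have "\<dots> = 8 * r0\<^sup>2 - 1"
    using one by (simp add: poly_simps)
  finally show ?thesis unfolding z .
qed

text \<open>The regimes change where the CNOT-SWAP bound 2 - 4 r0 eta equals 1, that is, at g_t =
  2/3.\<close>

lemma cnot_swap_regime:
  "(3 + 2 * sqrt 3) * sig \<le> r0 \<Longrightarrow> 4 * r0 * eta \<le> 1"
  "r0 < (3 + 2 * sqrt 3) * sig \<Longrightarrow> 1 < 4 * r0 * eta"
proof -
  obtain y where y: "y = eta" by simp
  have one: "1 = r0\<^sup>2 + y\<^sup>2" using eta_sq unfolding y by linarith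
  have diff: "1 - 4 * r0 * y = (y - (2 - sqrt 3) * r0) * (y - (2 + sqrt 3) * r0)"
    by (subst one) (simp add: poly_simps)
  have y3: "y < (2 + sqrt 3) * r0"
  proof -
    have "y \<le> sqrt 3 * r0"
      using mult_left_mono[OF sig_le_r0, of "sqrt 3"] unfolding y sqrt3_sig by simp
    also have "\<dots> < (2 + sqrt 3) * r0" using half by (intro mult_strict_right_mono) auto
    finally show ?thesis .
  qed
  have y_eq: "(2 - sqrt 3) * ((3 + 2 * sqrt 3) * sig) = y"
    unfolding y sqrt3_sig by (simp add: algebra_simps)
  have s3: "sqrt 3 < (2::real)" by (rule real_less_lsqrt) auto
  { assume "(3 + 2 * sqrt 3) * sig \<le> r0"
    then have "y \<le> (2 - sqrt 3) * r0" unfolding y_eq[symmetric] using s3 by (intro mult_left_mono) auto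
    then have "0 \<le> 1 - 4 * r0 * y" unfolding diff using y3 by (intro mult_nonpos_nonpos) auto
    then show "4 * r0 * eta \<le> 1" unfolding y by simp }
  { assume "r0 < (3 + 2 * sqrt 3) * sig"
    then have "(2 - sqrt 3) * r0 < y" unfolding y_eq[symmetric] using s3 by (intro mult_strict_left_mono) auto
    then have "1 - 4 * r0 * y < 0" unfolding diff using y3 by (intro mult_pos_neg) auto
    then show "1 < 4 * r0 * eta" unfolding y by simp }
qed

text \<open>The polynomial is a positive multiple of the XY value of h minus 1/3, so the regimes
  change at g_t = 4/9.\<close>

lemma xy_regime:
  "3 * sig < 3 * r0 - 2 \<Longrightarrow> 0 < 12 * r0\<^sup>2 - 12 * r0 + 1"
  "3 * r0 - 2 \<le> 3 * sig \<Longrightarrow> 12 * r0\<^sup>2 - 12 * r0 + 1 \<le> 0"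
proof -
  have sq: "(3 * sig)\<^sup>2 = 3 * (1 - r0\<^sup>2)" using sig_sq by (simp add: power_mult_distrib)
  { assume "3 * sig < 3 * r0 - 2"
    then have "(3 * sig)\<^sup>2 < (3 * r0 - 2)\<^sup>2" using sig_nonneg by (intro power_strict_mono) auto
    then show "0 < 12 * r0\<^sup>2 - 12 * r0 + 1" unfolding sq by (simp add: poly_simps) }
  { assume le: "3 * r0 - 2 \<le> 3 * sig"
    show "12 * r0\<^sup>2 - 12 * r0 + 1 \<le> 0"
    proof (cases "0 \<le> 3 * r0 - 2")
      case True
      then have "(3 * r0 - 2)\<^sup>2 \<le> (3 * sig)\<^sup>2" using le by (intro power_mono) auto
      then show ?thesis unfolding sq by (simp add: poly_simps)
    next
      case False
      then have "(r0 - 1/3) * (r0 - 2/3) \<le> 0" using half by (intro mult_nonneg_nonpos) auto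
      moreover have "(r0 - 1/3) * (r0 - 2/3) = r0\<^sup>2 - r0 + 2/9" by (simp add: power2_eq_square field_simps)
      ultimately show ?thesis by linarith
    qed }
qed

text \<open>The bound on h is quadratic in the extent; 1 \<le> 2 r0^2 selects its upper branch and
  is supplied by Cauchy--Schwarz when g_t \<ge> 1/3.\<close>

lemma min_mid:
  assumes "h \<le> 1" "1 \<le> 2 * r0\<^sup>2"
  shows "3 + 2 * sqrt (h * (4 - h)) \<le> 8 * r0\<^sup>2 - 1"
proof -
  have le: "4 * r0 * eta \<le> 2 - h"
    using h_le_cnot_swap cnot_swap_regime(1) assms by (cases "(3 + 2 * sqrt 3) * sig \<le> r0") auto
  have "sqrt (h * (4 - h)) \<le> 4 * r0\<^sup>2 - 2"
  proof (rule real_le_lsqrt)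
    have "(4 * r0 * eta)\<^sup>2 \<le> (2 - h)\<^sup>2" using le half eta_nonneg by (intro power_mono) auto
    moreover have "(4 * r0 * eta)\<^sup>2 = 16 * r0\<^sup>2 * (1 - r0\<^sup>2)" using eta_sq by (simp only: power_mult_distrib) simp
    ultimately show "h * (4 - h) \<le> (4 * r0\<^sup>2 - 2)\<^sup>2" by (simp add: poly_simps)
  qed (use assms in simp)
  then show ?thesis by simp
qed

lemma min_high:
  assumes "1 < h" and g: "3 * g = h + 1"
  shows "1 + 3 * g + 3 * sqrt (g * (4 - 3 * g)) \<le> 8 * r0\<^sup>2 - 1"
proof -
  have "(3 + 2 * sqrt 3) * sig \<le> r0"
  proof (rule ccontr)
    assume "\<not> ?thesis"
    then show False using h_le_cnot_swap cnot_swap_regime(2) \<open>1 < h\<close> by auto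
  qed
  from h_le_iso[OF this] have "g \<le> (r0 - sig)\<^sup>2" unfolding h_iso_sq using g by simp
  moreover have "0 \<le> r0 - sig" "r0 - sig \<le> 1" using sig_le_r0 sig_nonneg r0_le1 by linarith+
  then have "(r0 - sig)\<^sup>2 \<le> 1" by (rule power_le_one)
  ultimately have "g + sqrt (g * (4 - 3 * g)) \<le> (r0 - sig)\<^sup>2 + sqrt ((r0 - sig)\<^sup>2 * (4 - 3 * (r0 - sig)\<^sup>2))"
    using g \<open>1 < h\<close> by (intro iso_value_mono) auto
  then show ?thesis unfolding iso_value[symmetric] by linarith
qed

lemma max_low:
  assumes "h \<le> 1/3" and g: "3 * g = h + 1"
  shows "8 * r0\<^sup>2 - 1 \<le> 1 + 3 * g + 3 * sqrt (g * (4 - 3 * g))"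
proof -
  have "3 * r0 - 2 \<le> 3 * sig"
  proof (rule ccontr)
    assume "\<not> ?thesis"
    then show False using h_ge_xy xy_regime(1) \<open>h \<le> 1/3\<close> by fastforce
  qed
  from h_ge_iso[OF this] have "(r0 - sig)\<^sup>2 \<le> g" unfolding h_iso_sq using g by simp
  then have "(r0 - sig)\<^sup>2 + sqrt ((r0 - sig)\<^sup>2 * (4 - 3 * (r0 - sig)\<^sup>2)) \<le> g + sqrt (g * (4 - 3 * g))"
    using g \<open>h \<le> 1/3\<close> by (intro iso_value_mono) auto
  then show ?thesis unfolding iso_value[symmetric] by linarith
qed

lemma max_mid:
  assumes "1/3 < h" and g: "3 * g = h + 1"
  shows "8 * r0\<^sup>2 - 1 \<le> 1 + 3 * g + 4 * sqrt (3 * g / 2)"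
proof -
  have le: "8 * r0\<^sup>2 - 8 * r0 + 1 \<le> h"
    using h_ge_xy xy_regime(2) assms(1) by (cases "3 * sig \<le> 3 * r0 - 2") auto
  have sq: "(2 * r0 - 1)\<^sup>2 \<le> 3 * g / 2" using le g by (simp add: poly_simps)
  then have "2 * r0 - 1 \<le> sqrt (3 * g / 2)" by (rule real_le_rsqrt)
  with sq show ?thesis by (simp add: poly_simps)
qed

end

section \<open>From the Cartan cosines to the Hadamard spectrum\<close>

definition sum_sqrt :: "real \<Rightarrow> real \<Rightarrow> real \<Rightarrow> real" where
  "sum_sqrt a b c = sqrt ((1 + b * c + a * c + a * b) / 4) + sqrt ((1 + b * c - a * c - a * b) / 4)
     + sqrt ((1 - b * c + a * c - a * b) / 4) + sqrt ((1 - b * c - a * c + a * b) / 4)"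

text \<open>Cauchy--Schwarz, from \<open>p\<^sub>0 = c\<^sup>2 K + s\<^sup>2 L\<close> and \<open>p\<^sub>1 = s\<^sup>2 K + c\<^sup>2 L\<close>.\<close>

lemma sqrt_pair_ge:
  fixes a b c :: real
  assumes "0 \<le> a" "a \<le> 1" "\<bar>b\<bar> \<le> 1" "\<bar>c\<bar> \<le> 1"
  shows "sqrt (1 - a\<^sup>2) * (1 + b * c) / 4
    \<le> sqrt ((1 + b * c + a * c + a * b) / 4) * sqrt ((1 + b * c - a * c - a * b) / 4)"
proof -
  have "0 \<le> a\<^sup>2 * ((1 + b) * (1 - b)) * ((1 + c) * (1 - c))" using assms by (intro mult_nonneg_nonneg) auto
  moreover have "(1 + b * c + a * c + a * b) / 4 * ((1 + b * c - a * c - a * b) / 4) - (1 - a\<^sup>2) * (1 + b * c)\<^sup>2 / 16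
      = a\<^sup>2 * ((1 + b) * (1 - b)) * ((1 + c) * (1 - c)) / 16"
    by (simp add: power2_eq_square field_simps)
  ultimately have "(1 - a\<^sup>2) * (1 + b * c)\<^sup>2 / 16 \<le> (1 + b * c + a * c + a * b) / 4 * ((1 + b * c - a * c - a * b) / 4)"
    by linarith
  moreover have "0 \<le> 1 + b * c"
    using assms mult_le_one[of "\<bar>b\<bar>" "\<bar>c\<bar>"] by (simp add: abs_mult[symmetric])
  moreover have "a\<^sup>2 \<le> 1" using assms by (simp add: power_le_one)
  then have "sqrt (1 - a\<^sup>2) * (1 + b * c) / 4 = sqrt ((1 - a\<^sup>2) * (1 + b * c)\<^sup>2 / 16)"
    using \<open>0 \<le> 1 + b * c\<close> by (simp add: real_sqrt_mult real_sqrt_divide)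
  ultimately show ?thesis by (simp add: real_sqrt_mult[symmetric])
qed

lemma schmidt_nonneg:
  fixes a b c :: real
  assumes "0 \<le> a" "a \<le> b" "b \<le> c" "c \<le> 1"
  shows "0 \<le> 1 + b * c + a * c + a * b" (is ?A) "0 \<le> 1 + b * c - a * c - a * b" (is ?B)
    "0 \<le> 1 - b * c + a * c - a * b" (is ?C) "0 \<le> 1 - b * c - a * c + a * b" (is ?D)
proof -
  have m: "0 \<le> (1 - x) * (1 - y)" if "x \<le> 1" "y \<le> 1" for x y :: real using that by simp
  have le: "a * b + a * c \<le> b + c" "a * b + b * c \<le> a + c" "a * c + b * c \<le> a + b"
    using assms mult_right_mono[of a 1 "b + c"] mult_right_mono[of b 1 "a + c"] mult_right_mono[of c 1 "a + b"]
    by (auto simp: algebra_simps)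
  have nn: "0 \<le> b * c" "0 \<le> a * c" "0 \<le> a * b" using assms by auto
  show ?A ?B ?C ?D
    using le nn m[of b c] m[of a c] m[of a b] assms by (auto simp: algebra_simps)
qed

lemma sum_sqrt_bounds:
  assumes abc: "0 \<le> a" "a \<le> b" "b \<le> c" "c \<le> 1" and g: "3 * g = 3 - a\<^sup>2 - b\<^sup>2 - c\<^sup>2"
  shows "gamma_min g \<le> 2 * (sum_sqrt a b c)\<^sup>2 - 1" (is ?A) "2 * (sum_sqrt a b c)\<^sup>2 - 1 \<le> gamma_max g" (is ?B)
    "(sum_sqrt a b c)\<^sup>2 \<le> 4" (is ?C)
    "1 + sqrt (3 - a\<^sup>2 - b\<^sup>2 - c\<^sup>2) \<le> (sum_sqrt a b c)\<^sup>2" (is ?D)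
proof -
  define q0 q1 q2 q3 where "q0 = sqrt ((1 + b * c + a * c + a * b) / 4)"
    and "q1 = sqrt ((1 + b * c - a * c - a * b) / 4)"
    and "q2 = sqrt ((1 - b * c + a * c - a * b) / 4)"
    and "q3 = sqrt ((1 - b * c - a * c + a * b) / 4)"
  note q_defs = q0_def q1_def q2_def q3_def
  have m: "0 \<le> (1 - x) * (1 - y)" if "x \<le> 1" "y \<le> 1" for x y :: real using that by simp
  have nn: "0 \<le> b * c" "0 \<le> a * c" "0 \<le> a * b" using abc by auto
  have ord: "a * b \<le> a * c" "a * c \<le> b * c" using abc by (auto intro: mult_left_mono mult_right_mono)
  note p = schmidt_nonneg[OF abc]
  have sq: "q0\<^sup>2 = (1 + b * c + a * c + a * b) / 4" "q1\<^sup>2 = (1 + b * c - a * c - a * b) / 4"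
    "q2\<^sup>2 = (1 - b * c + a * c - a * b) / 4" "q3\<^sup>2 = (1 - b * c - a * c + a * b) / 4"
    unfolding q_defs using p by auto
  have q_nonneg: "0 \<le> q0" "0 \<le> q1" "0 \<le> q2" "0 \<le> q3"
    unfolding q_defs using p by auto
  have q_ord: "q1 \<le> q0" "q2 \<le> q1" "q3 \<le> q2"
    unfolding q_defs using ord nn by auto
  have S: "sum_sqrt a b c = q0 + q1 + q2 + q3" unfolding sum_sqrt_def q0_def q1_def q2_def q3_def ..
  have qsum: "q0\<^sup>2 + q1\<^sup>2 + q2\<^sup>2 + q3\<^sup>2 = 1" unfolding sq by (simp add: field_simps)
  \<comment> \<open>Changing the sign of b exchanges the pairs (p0, p1) and (p3, p2), and the
    weights (1 + b c) / 4 and (1 - b c) / 4 add up to 1/2.\<close>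
  have A: "sqrt (1 - a\<^sup>2) / 2 \<le> q0 * q1 + q2 * q3"
    using sqrt_pair_ge[of a b c] sqrt_pair_ge[of a "-b" c] abc
    unfolding q_defs by (simp add: algebra_simps)
  have B: "sqrt (1 - b\<^sup>2) / 2 \<le> q0 * q2 + q1 * q3"
    using sqrt_pair_ge[of b a c] sqrt_pair_ge[of b "-a" c] abc
    unfolding q_defs by (simp add: algebra_simps)
  have C: "sqrt (1 - c\<^sup>2) / 2 \<le> q0 * q3 + q1 * q2"
    using sqrt_pair_ge[of c a b] sqrt_pair_ge[of c "-a" b] abc
    unfolding q_defs by (simp add: algebra_simps)
  have "a\<^sup>2 \<le> 1" "b\<^sup>2 \<le> 1" "c\<^sup>2 \<le> 1" using abc by (simp_all add: power_le_one)
  then have "sqrt ((1 - a\<^sup>2) + (1 - b\<^sup>2) + (1 - c\<^sup>2)) \<le> sqrt (1 - a\<^sup>2) + sqrt (1 - b\<^sup>2) + sqrt (1 - c\<^sup>2)"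
    by (smt (verit) sqrt_add_le_add_sqrt)
  then have "sqrt (3 - a\<^sup>2 - b\<^sup>2 - c\<^sup>2) \<le> sqrt (1 - a\<^sup>2) + sqrt (1 - b\<^sup>2) + sqrt (1 - c\<^sup>2)"
    by (simp add: algebra_simps)
  moreover have expand: "(q0 + q1 + q2 + q3)\<^sup>2 = q0\<^sup>2 + q1\<^sup>2 + q2\<^sup>2 + q3\<^sup>2
      + 2 * (q0 * q1 + q2 * q3) + 2 * (q0 * q2 + q1 * q3) + 2 * (q0 * q3 + q1 * q2)"
    by (simp add: poly_simps)
  moreover have "1 + s \<le> 1 + 2 * x + 2 * y + 2 * z"
    if "s \<le> u + v + w" "u / 2 \<le> x" "v / 2 \<le> y" "w / 2 \<le> z" for s u v w x y z :: real
    using that by linarith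
  ultimately have ge: "1 + sqrt (3 - a\<^sup>2 - b\<^sup>2 - c\<^sup>2) \<le> (sum_sqrt a b c)\<^sup>2"
    unfolding S expand qsum using A B C by blast
  define r0 r1 r2 r3 where "r0 = (q0 + q1 + q2 + q3) / 2" and "r1 = (q0 + q1 - q2 - q3) / 2"
    and "r2 = (q0 - q1 + q2 - q3) / 2" and "r3 = (q0 - q1 - q2 + q3) / 2"
  note r_def = r0_def r1_def r2_def r3_def
  have norm1: "r0\<^sup>2 + r1\<^sup>2 + r2\<^sup>2 + r3\<^sup>2 = 1"
    using qsum unfolding r_def by (simp add: power2_eq_square field_simps)
  have dom_eq: "r0 * r1 - r2 * r3 = q0 * q1 - q2 * q3" "r0 * r2 - r1 * r3 = q0 * q2 - q1 * q3"
    "r0 * r3 - r1 * r2 = q0 * q3 - q1 * q2" unfolding r_def by (simp_all add: field_simps)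
  \<comment> \<open>Products of Hadamard coefficients are Hadamard coefficients of the squares, and
    those of p are read off from its definition.\<close>
  have prod_eq: "r0 * r1 + r2 * r3 = b * c / 2" "r0 * r2 + r1 * r3 = a * c / 2" "r0 * r3 + r1 * r2 = a * b / 2"
  proof -
    have "r0 * r1 + r2 * r3 = (q0\<^sup>2 + q1\<^sup>2 - q2\<^sup>2 - q3\<^sup>2) / 2"
      "r0 * r2 + r1 * r3 = (q0\<^sup>2 - q1\<^sup>2 + q2\<^sup>2 - q3\<^sup>2) / 2"
      "r0 * r3 + r1 * r2 = (q0\<^sup>2 - q1\<^sup>2 - q2\<^sup>2 + q3\<^sup>2) / 2"
      unfolding r_def by (simp_all add: power2_eq_square field_simps)
    then show "r0 * r1 + r2 * r3 = b * c / 2" "r0 * r2 + r1 * r3 = a * c / 2" "r0 * r3 + r1 * r2 = a * b / 2"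
      unfolding sq by (simp_all add: field_simps)
  qed
  have half2: "1 + sqrt (3 * g) \<le> 4 * r0\<^sup>2"
    using ge unfolding S g r0_def by (simp add: power_divide)
  have g0: "0 \<le> g" "g \<le> 1"
    using g abc power_le_one[of a 2] power_le_one[of b 2] power_le_one[of c 2]
      zero_le_power2[of a] zero_le_power2[of b] zero_le_power2[of c] by linarith+
  have r0half: "1/2 \<le> r0"
  proof (rule power2_le_imp_le)
    show "(1/2)\<^sup>2 \<le> r0\<^sup>2" using half2 g0 by (simp add: power2_eq_square) (smt (verit) real_sqrt_ge_zero)
    show "0 \<le> r0" unfolding r0_def using q_nonneg by simp
  qed
  have dom1: "0 \<le> r0 * r1 - r2 * r3" unfolding dom_eq using q_ord q_nonneg by (simp add: mult_mono)
  have dom2: "0 \<le> r0 * r2 - r1 * r3" unfolding dom_eq using q_ord q_nonneg by (simp add: mult_mono)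
  \<comment> \<open>The order of the q's settles the first two constraints but not this one, where
    the largest and the smallest face the middle two. Comparing squares leaves a b (1 - c^2) /
    4.\<close>
  have dom3: "0 \<le> r0 * r3 - r1 * r2"
  proof -
    have "0 \<le> a * b * (1 - c\<^sup>2)" using abc nn power_le_one[of c 2] by simp
    also have "\<dots> = 4 * ((q0 * q3)\<^sup>2 - (q1 * q2)\<^sup>2)"
      unfolding power_mult_distrib sq by (simp add: field_simps power2_eq_square)
    finally have "(q1 * q2)\<^sup>2 \<le> (q0 * q3)\<^sup>2" by simp
    then have "q1 * q2 \<le> q0 * q3" by (rule power2_le_imp_le) (use q_nonneg in simp)
    then show ?thesis unfolding dom_eq by simp
  qed
  have r12: "0 \<le> r1" "0 \<le> r2" unfolding r_def using q_ord by auto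
  then have "0 \<le> r0 * r3" using dom3 by (smt (verit) mult_nonneg_nonneg)
  then have r3: "0 \<le> r3" using r0half by (simp add: zero_le_mult_iff)
  \<comment> \<open>Multiplying a^2 + b^2 + c^2 by A B C makes it polynomial in A, B, C, hence in r.
    Writing 1 as \<open>N\<close> makes the identity homogeneous, so that it holds without using the
    normalisation.\<close>
  have h_rel: "(r0\<^sup>2 * (r1\<^sup>2 * r2\<^sup>2 + r2\<^sup>2 * r3\<^sup>2 + r3\<^sup>2 * r1\<^sup>2) + r0 * (r1 * r2 * r3) + (r1 * r2 * r3)\<^sup>2)
        * ((3 * g - 1) * r0 + 8 * (r1 * r2 * r3))
      = 2 * (r1 * r2 * r3) * (r0 * (2 * r0\<^sup>2 - 1) - 2 * (r1 * r2 * r3))\<^sup>2"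
  proof -
    define A B C where "A = r0 * r1 + r2 * r3" and "B = r0 * r2 + r1 * r3" and "C = r0 * r3 + r1 * r2"
    define N where "N = r0\<^sup>2 + r1\<^sup>2 + r2\<^sup>2 + r3\<^sup>2"
    have N: "N = 1" unfolding N_def by (rule norm1)
    have G: "r0\<^sup>2 * (r1\<^sup>2 * r2\<^sup>2 + r2\<^sup>2 * r3\<^sup>2 + r3\<^sup>2 * r1\<^sup>2) + r0 * (r1 * r2 * r3) * N + (r1 * r2 * r3)\<^sup>2 = A * B * C"
      unfolding A_def B_def C_def N_def by (simp add: poly_simps)
    have "A * B * C * (a\<^sup>2 + b\<^sup>2 + c\<^sup>2) = 2 * ((B * C)\<^sup>2 + (A * C)\<^sup>2 + (A * B)\<^sup>2)"
      unfolding A_def B_def C_def prod_eq by (simp add: field_simps power2_eq_square)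
    then have *: "A * B * C * (3 * g - 1) = 2 * (A * B * C * N - (B * C)\<^sup>2 - (A * C)\<^sup>2 - (A * B)\<^sup>2)"
      unfolding N g by (simp add: algebra_simps)
    have "A * B * C * ((3 * g - 1) * r0 + 8 * (r1 * r2 * r3))
       = A * B * C * (3 * g - 1) * r0 + 8 * (r1 * r2 * r3) * (A * B * C)"
      by (simp add: algebra_simps)
    also have "\<dots> = 2 * (A * B * C * N - (B * C)\<^sup>2 - (A * C)\<^sup>2 - (A * B)\<^sup>2) * r0 + 8 * (r1 * r2 * r3) * (A * B * C)"
      unfolding * ..
    also have "\<dots> = 2 * (r1 * r2 * r3) * (r0 * (2 * r0\<^sup>2 - N) - 2 * (r1 * r2 * r3))\<^sup>2"
      unfolding A_def B_def C_def N_def by (simp add: poly_simps)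
    finally show ?thesis using G unfolding N by simp
  qed
  \<comment> \<open>If some r vanishes, \<open>dom\<close> kills the product of the other two, so
    one of b c, a c, a b is zero, and hence so is the smallest cosine a. Then h = 2 - b^2 - c^2 with
    b c determined by r0: the upper bound is 2 b c \<le> b^2 + c^2, the lower one (1 - b^2)(1 - c^2)
    \<ge> 0.\<close>
  have h_zero: "(2 * r0\<^sup>2 - 1)\<^sup>2 \<le> 3 * g - 1 \<and> 3 * g - 1 \<le> 2 - 4 * r0 * sqrt (1 - r0\<^sup>2)"
    if "r1 * r2 * r3 = 0"
  proof -
    have "a = 0"
    proof -
      have *: "r1 = 0 \<Longrightarrow> r2 * r3 = 0" "r2 = 0 \<Longrightarrow> r1 * r3 = 0" "r3 = 0 \<Longrightarrow> r1 * r2 = 0"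
        using dom1 dom2 dom3 r12 r3 by (auto simp: mult_le_0_iff zero_le_mult_iff)
      have "b * c = 0 \<or> a * c = 0 \<or> a * b = 0"
        using that * prod_eq by (auto simp: algebra_simps)
      then show ?thesis using abc by auto
    qed
    then have q01: "q1 = q0" "q3 = q2" unfolding q_defs by simp_all
    have "r0\<^sup>2 = q0\<^sup>2 + q2\<^sup>2 + 2 * (q0 * q2)" unfolding r0_def q01 by (simp add: power2_eq_square field_simps)
    also have "\<dots> = 1 / 2 + 2 * (q0 * q2)" unfolding sq \<open>a = 0\<close> by (simp add: field_simps)
    finally have r0sq: "2 * r0\<^sup>2 - 1 = 4 * (q0 * q2)" by simp
    have qq: "(4 * (q0 * q2))\<^sup>2 = 1 - b\<^sup>2 * c\<^sup>2"
      unfolding power_mult_distrib sq \<open>a = 0\<close> by (simp add: field_simps power2_eq_square)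
    have "4 * r0\<^sup>2 * (1 - r0\<^sup>2) = 1 - (2 * r0\<^sup>2 - 1)\<^sup>2" by (simp add: poly_simps)
    also have "\<dots> = (b * c)\<^sup>2" unfolding r0sq qq by (simp add: power_mult_distrib)
    finally have "(2 * r0)\<^sup>2 * (1 - r0\<^sup>2) = (b * c)\<^sup>2" by (simp add: power_mult_distrib)
    then have "sqrt ((2 * r0)\<^sup>2 * (1 - r0\<^sup>2)) = b * c" using nn by simp
    then have e: "2 * r0 * sqrt (1 - r0\<^sup>2) = b * c" using r0half by (simp add: real_sqrt_mult)
    have "0 \<le> (b - c)\<^sup>2" by simp
    then have "2 * (b * c) \<le> b\<^sup>2 + c\<^sup>2" by (simp add: poly_simps)
    moreover have "0 \<le> (1 - b\<^sup>2) * (1 - c\<^sup>2)" using abc by (intro m power_le_one) auto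
    then have "b\<^sup>2 + c\<^sup>2 \<le> 1 + b\<^sup>2 * c\<^sup>2" by (simp add: algebra_simps)
    ultimately show ?thesis using e g unfolding r0sq qq \<open>a = 0\<close> by auto
  qed
  interpret hadamard_spectrum r0 r1 r2 r3 "3 * g - 1"
    using r12 r3 r0half norm1 dom1 dom2 dom3 h_rel h_zero by unfold_locales auto
  have gam: "2 * (sum_sqrt a b c)\<^sup>2 - 1 = 8 * r0\<^sup>2 - 1" unfolding S r0_def by (simp add: power_divide)
  show ?A
  proof -
    consider "g \<le> 1/3" | "1/3 < g" "g \<le> 2/3" | "2/3 < g" by linarith
    then show ?thesis
    proof cases
      case 1
      then show ?thesis unfolding gamma_min_def gam using half2 by simp
    next
      case 2
      have "1 \<le> sqrt (3 * g)" using 2 by simp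
      then have "1 \<le> 2 * r0\<^sup>2" using half2 by linarith
      from min_mid[OF _ this] 2 show ?thesis unfolding gamma_min_def gam by (simp add: algebra_simps)
    next
      case 3
      then show ?thesis unfolding gamma_min_def gam using min_high[of g] by simp
    qed
  qed
  show ?B
  proof -
    consider "g \<le> 4/9" | "4/9 < g" "g \<le> 2/3" | "2/3 < g" by linarith
    then show ?thesis
    proof cases
      case 1
      then show ?thesis unfolding gamma_max_def gam using max_low[of g] by simp
    next
      case 2
      then show ?thesis unfolding gamma_max_def gam using max_mid[of g] by simp
    next
      case 3
      then show ?thesis unfolding gamma_max_def gam using r0_sq by simp
    qed
  qed
  show ?C using gam r0_sq by linarith
  show ?D by (rule ge)
qed

section \<open>Values on the extremal families\<close>

lemma sum_sqrt_iswap: "0 \<le> c \<Longrightarrow> c \<le> 1 \<Longrightarrow> sum_sqrt 0 0 c = 2"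
  by (simp add: sum_sqrt_def real_sqrt_divide)

lemma sum_sqrt_controlled:
  assumes "0 \<le> a" "a \<le> 1"
  shows "(sum_sqrt a 1 1)\<^sup>2 = 1 + sqrt (1 - a\<^sup>2)"
proof -
  have "sum_sqrt a 1 1 = sqrt ((1 + a) / 2) + sqrt ((1 - a) / 2)"
  proof -
    have *: "(1 + 1 * 1 + a * 1 + a * 1) / 4 = (1 + a) / 2" "(1 + 1 * 1 - a * 1 - a * 1) / 4 = (1 - a) / 2"
      "(1 - 1 * 1 + a * 1 - a * 1) / 4 = 0" "(1 - 1 * 1 - a * 1 + a * 1) / 4 = 0"
      by (simp_all add: field_simps)
    show ?thesis unfolding sum_sqrt_def * by simp
  qed
  then have "(sum_sqrt a 1 1)\<^sup>2 = (1 + a) / 2 + (1 - a) / 2 + 2 * (sqrt ((1 + a) / 2) * sqrt ((1 - a) / 2))"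
    using assms by (simp add: power2_sum)
  also have "sqrt ((1 + a) / 2) * sqrt ((1 - a) / 2) = sqrt ((1 - a\<^sup>2) / 4)"
    unfolding real_sqrt_mult[symmetric] by (simp add: power2_eq_square field_simps)
  finally show ?thesis by (simp add: real_sqrt_divide field_simps)
qed

lemma sum_sqrt_cnot_swap:
  assumes "0 \<le> a" "a \<le> 1"
  shows "(sum_sqrt 0 a a)\<^sup>2 = 2 + 2 * sqrt (1 - (a\<^sup>2)\<^sup>2)"
proof -
  have "sum_sqrt 0 a a = sqrt (1 + a\<^sup>2) + sqrt (1 - a\<^sup>2)"
    unfolding sum_sqrt_def by (simp add: real_sqrt_divide power2_eq_square)
  moreover have "a\<^sup>2 \<le> 1" using assms by (simp add: power_le_one)
  ultimately have "(sum_sqrt 0 a a)\<^sup>2 = (1 + a\<^sup>2) + (1 - a\<^sup>2) + 2 * (sqrt (1 + a\<^sup>2) * sqrt (1 - a\<^sup>2))"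
    by (simp add: power2_sum)
  also have "sqrt (1 + a\<^sup>2) * sqrt (1 - a\<^sup>2) = sqrt (1 - (a\<^sup>2)\<^sup>2)"
    unfolding real_sqrt_mult[symmetric] by (simp add: poly_simps)
  finally show ?thesis by simp
qed

lemma sum_sqrt_iso:
  assumes "0 \<le> a" "a \<le> 1" and g: "g = 1 - a\<^sup>2"
  shows "2 * (sum_sqrt a a a)\<^sup>2 - 1 = 1 + 3 * g + 3 * sqrt (g * (4 - 3 * g))"
proof -
  have g0: "0 \<le> g" "g \<le> 1" using assms by (auto simp: power_le_one)
  have "sum_sqrt a a a = sqrt ((4 - 3 * g) / 4) + 3 * sqrt (g / 4)"
    unfolding sum_sqrt_def g by (simp add: power2_eq_square)
  then have "(sum_sqrt a a a)\<^sup>2 = (4 - 3 * g) / 4 + 9 * (g / 4) + 6 * (sqrt (g / 4) * sqrt ((4 - 3 * g) / 4))"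
    using g0 by (simp add: power2_sum power_mult_distrib)
  also have "sqrt (g / 4) * sqrt ((4 - 3 * g) / 4) = sqrt (g * (4 - 3 * g)) / 4"
    by (simp add: real_sqrt_mult real_sqrt_divide)
  finally show ?thesis by (simp add: field_simps)
qed

lemma sum_sqrt_xy:
  assumes "0 \<le> a" "a \<le> 1"
  shows "sum_sqrt a a 1 = 1 + sqrt (1 - a\<^sup>2)"
proof -
  have *: "(1 + a + a + a * a) / 4 = ((1 + a) / 2)\<^sup>2" "(1 - a - a + a * a) / 4 = ((1 - a) / 2)\<^sup>2"
    by (simp_all add: power2_eq_square field_simps)
  have "sum_sqrt a a 1 = sqrt (((1 + a) / 2)\<^sup>2) + 2 * sqrt ((1 - a\<^sup>2) / 4) + sqrt (((1 - a) / 2)\<^sup>2)"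
    unfolding sum_sqrt_def *[symmetric] by (simp add: power2_eq_square)
  then show ?thesis using assms by (simp add: real_sqrt_divide field_simps)
qed

subsection \<open>Bell-diagonal form of the Cartan gates\<close>

lemma sum_pair2: "(\<Sum>p\<in>UNIV. f p) = f (1,1) + f (1,2) + f (2,1) + f (2,2)" for f :: "2 \<times> 2 \<Rightarrow> 'a::comm_monoid_add"
  by (simp only: UNIV_Times_UNIV[symmetric] sum.cartesian_product[symmetric] UNIV_2) (simp add: add.assoc)

lemma forall_pair2: "(\<forall>p. P p) \<longleftrightarrow> P (1,1) \<and> P (1,2) \<and> P (2,1) \<and> P (2,2)" for P :: "2 \<times> 2 \<Rightarrow> bool"
  unfolding split_paired_All forall_2 by blast

lemma forall_four: "(\<forall>j. P j) \<longleftrightarrow> P 0 \<and> P 1 \<and> P 2 \<and> P 3" for P :: "4 \<Rightarrow> bool"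
proof -
  have "(4::4) = 0" by simp
  then show ?thesis by (metis forall_4)
qed

lemma sum_four: "(\<Sum>j\<in>UNIV. f j) = f 0 + f 1 + f 2 + f 3" for f :: "4 \<Rightarrow> 'a::comm_monoid_add"
proof -
  have "(4::4) = 0" by simp
  then have "f 4 = f 0" by (rule arg_cong)
  then show ?thesis unfolding sum_4 by (simp only: ac_simps)
qed

lemma cscale_nth [simp]: "cscale c A $ i $ j = c * A $ i $ j"
  by (simp add: cscale_def)

lemma dagger_nth [simp]: "dagger A $ i $ j = cnj (A $ j $ i)"
  by (simp add: dagger_def)

lemma kron_nth [simp]: "kron A B $ p $ q = A $ fst p $ fst q * B $ snd p $ snd q"
  by (simp add: kron_def)

lemma rank_one_proj_nth [simp]: "rank_one_proj v $ i $ j = v $ i * cnj (v $ j)"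
  by (simp add: rank_one_proj_def)

lemma pauli_simps [simp]: "pauli 0 = mat 1" "pauli 1 = pauli_X" "pauli 2 = pauli_Y" "pauli 3 = pauli_Z"
  by (simp_all add: pauli_def)

lemma pauli_X_nth [simp]: "pauli_X $ 1 $ 1 = 0" "pauli_X $ 1 $ 2 = 1" "pauli_X $ 2 $ 1 = 1" "pauli_X $ 2 $ 2 = 0"
  by (simp_all add: pauli_X_def)
lemma pauli_Y_nth [simp]: "pauli_Y $ 1 $ 1 = 0" "pauli_Y $ 1 $ 2 = - \<i>" "pauli_Y $ 2 $ 1 = \<i>" "pauli_Y $ 2 $ 2 = 0"
  by (simp_all add: pauli_Y_def)
lemma pauli_Z_nth [simp]: "pauli_Z $ 1 $ 1 = 1" "pauli_Z $ 1 $ 2 = 0" "pauli_Z $ 2 $ 1 = 0" "pauli_Z $ 2 $ 2 = - 1"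
  by (simp_all add: pauli_Z_def)

lemma mat_two_nth [simp]: "mat c $ (1::2) $ 1 = c" "mat c $ (1::2) $ 2 = 0" "mat c $ (2::2) $ 1 = 0" "mat c $ (2::2) $ 2 = c"
  by (simp_all add: mat_def)

lemma matrix_mul_nth: "(A ** B) $ i $ j = (\<Sum>k\<in>UNIV. A $ i $ k * B $ k $ j)"
  by (simp add: matrix_matrix_mult_def)

lemma matrix_vector_nth: "(A *v x) $ i = (\<Sum>k\<in>UNIV. A $ i $ k * x $ k)"
  by (simp add: matrix_vector_mult_def)

lemma bounded_linear_cscale: "bounded_linear (\<lambda>c. cscale c A)"
proof -
  have "linear (\<lambda>c. cscale c A)"
    by (rule linearI) (simp_all add: vec_eq_iff algebra_simps scaleR_conv_of_real[where 'a=complex])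
  then show ?thesis by (simp add: linear_conv_bounded_linear)
qed

lemma matrix_mul_sum_left: "(\<Sum>k\<in>K. A k) ** B = (\<Sum>k\<in>K. A k ** B)" for A :: "'k \<Rightarrow> 'a::semiring_1 ^ 'n ^ 'm"
  by (simp add: vec_eq_iff matrix_mul_nth sum_distrib_right) (subst sum.swap, simp)

lemma matrix_mul_sum_right: "B ** (\<Sum>k\<in>K. A k) = (\<Sum>k\<in>K. B ** A k)" for A :: "'k \<Rightarrow> 'a::semiring_1 ^ 'n ^ 'm"
  by (simp add: vec_eq_iff matrix_mul_nth sum_distrib_left) (subst sum.swap, simp)

lemma cscale_mul: "cscale c A ** cscale d B = cscale (c * d) (A ** B)"
  by (simp add: vec_eq_iff matrix_matrix_mult_def sum_distrib_left algebra_simps)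

lemma mat_exp_spectral:
  fixes P :: "'k::finite \<Rightarrow> complex ^ 'n ^ 'n"
  assumes orth: "\<And>k l. P k ** P l = (if k = l then P k else 0)" and total: "(\<Sum>k\<in>UNIV. P k) = mat 1"
  shows "mat_exp (\<Sum>k\<in>UNIV. cscale (c k) (P k)) = (\<Sum>k\<in>UNIV. cscale (exp (c k)) (P k))"
proof -
  define A where "A = (\<Sum>k\<in>UNIV. cscale (c k) (P k))"
  have cs0: "cscale x 0 = (0 :: complex ^ 'n ^ 'n)" for x by (simp add: vec_eq_iff)
  have pow: "(((**) A) ^^ n) (mat 1) = (\<Sum>k\<in>UNIV. cscale (c k ^ n) (P k))" for n
  proof (induction n)
    case 0
    have "cscale 1 B = B" for B :: "complex ^ 'n ^ 'n" by (simp add: vec_eq_iff)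
    then show ?case by (simp add: total)
  next
    case (Suc n)
    have "A ** (\<Sum>k\<in>UNIV. cscale (c k ^ n) (P k)) =
        (\<Sum>l\<in>UNIV. \<Sum>k\<in>UNIV. cscale (c k * c l ^ n) (if k = l then P k else 0))"
      unfolding A_def matrix_mul_sum_right by (simp add: matrix_mul_sum_left cscale_mul orth)
    also have "\<dots> = (\<Sum>l\<in>UNIV. \<Sum>k\<in>UNIV. if k = l then cscale (c k * c l ^ n) (P k) else 0)"
      by (intro sum.cong refl) (simp add: cs0)
    also have "\<dots> = (\<Sum>l\<in>UNIV. cscale (c l ^ Suc n) (P l))" by simp
    finally show ?case using Suc by simp
  qed
  have "(\<lambda>n. \<Sum>k\<in>UNIV. cscale (c k ^ n /\<^sub>R fact n) (P k)) sums (\<Sum>k\<in>UNIV. cscale (exp (c k)) (P k))"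
    by (intro sums_sum bounded_linear.sums[OF bounded_linear_cscale] exp_converges)
  moreover have "(\<Sum>k\<in>UNIV. cscale (c k ^ n /\<^sub>R fact n) (P k)) = (1 / fact n) *\<^sub>R (((**) A) ^^ n) (mat 1)" for n
    unfolding pow scaleR_sum_right
    by (intro sum.cong refl) (simp add: vec_eq_iff divide_inverse)
  ultimately show ?thesis unfolding mat_exp_def A_def[symmetric] by (simp add: sums_iff)
qed

text \<open>Read as 2 x 2 matrices, these are 1, iX, iY, iZ divided by sqrt 2. The phases make the
  real span the quaternions, on which V A W^T with V, W in SU(2) acts by real rotations.\<close>

definition magic :: "4 \<Rightarrow> complex ^ (2 \<times> 2)" where
  "magic k = (\<chi> p. (if k = 0 then 1 else \<i>) * pauli k $ fst p $ snd p / sqrt 2)"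

lemma magic_nth:
  "magic 0 $ (1,1) = 1 / sqrt 2" "magic 0 $ (1,2) = 0" "magic 0 $ (2,1) = 0" "magic 0 $ (2,2) = 1 / sqrt 2"
  "magic 1 $ (1,1) = 0" "magic 1 $ (1,2) = \<i> / sqrt 2" "magic 1 $ (2,1) = \<i> / sqrt 2" "magic 1 $ (2,2) = 0"
  "magic 2 $ (1,1) = 0" "magic 2 $ (1,2) = 1 / sqrt 2" "magic 2 $ (2,1) = - 1 / sqrt 2" "magic 2 $ (2,2) = 0"
  "magic 3 $ (1,1) = \<i> / sqrt 2" "magic 3 $ (1,2) = 0" "magic 3 $ (2,1) = 0" "magic 3 $ (2,2) = - \<i> / sqrt 2"
  by (simp_all add: magic_def)

lemma csqrt2_sq [simp]: "complex_of_real (sqrt 2) * complex_of_real (sqrt 2) = 2"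
  by (metis of_real_mult of_real_numeral real_sqrt_mult_self abs_numeral)

text \<open>The eigenvalue of x XX + y YY + z ZZ on \<open>magic k\<close>; the four of them add up
  to zero.\<close>

definition cartan_phase :: "real \<Rightarrow> real \<Rightarrow> real \<Rightarrow> 4 \<Rightarrow> real" where
  "cartan_phase x y z k = (if k = 0 then x - y + z else if k = 1 then x + y - z
     else if k = 2 then - x - y - z else - x + y + z)"

lemma cartan_phase_simps [simp]:
  "cartan_phase x y z 0 = x - y + z" "cartan_phase x y z 1 = x + y - z"
  "cartan_phase x y z 2 = - x - y - z" "cartan_phase x y z 3 = - x + y + z"
  by (simp_all add: cartan_phase_def)

lemma magic_orth: "(\<Sum>p\<in>UNIV. cnj (magic k $ p) * magic l $ p) = (if k = l then 1 else 0)"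
proof -
  have "\<forall>k l. (\<Sum>p\<in>UNIV. cnj (magic k $ p) * magic l $ p) = (if k = l then 1 else 0)"
    unfolding forall_four by (simp add: sum_pair2 magic_nth field_simps)
  then show ?thesis by blast
qed

lemma magic_complete: "(\<Sum>k\<in>UNIV. magic k $ p * cnj (magic k $ q)) = (if p = q then 1 else 0)"
proof -
  have "\<forall>p q. (\<Sum>k\<in>UNIV. magic k $ p * cnj (magic k $ q)) = (if p = q then 1 else 0)"
    unfolding forall_pair2 by (simp add: sum_four magic_nth field_simps)
  then show ?thesis by blast
qed

lemma rank_one_proj_mul: "rank_one_proj v ** rank_one_proj w = cscale (\<Sum>p\<in>UNIV. cnj (v $ p) * w $ p) (\<chi> i j. v $ i * cnj (w $ j))"
  by (simp add: vec_eq_iff matrix_matrix_mult_def sum_distrib_left sum_distrib_right algebra_simps)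

abbreviation magic_diag :: "(4 \<Rightarrow> complex) \<Rightarrow> two_qubit" where
  "magic_diag c \<equiv> (\<Sum>k\<in>UNIV. cscale (c k) (rank_one_proj (magic k)))"

lemma rank_one_proj_magic_orth:
  "rank_one_proj (magic k) ** rank_one_proj (magic l) = (if k = l then rank_one_proj (magic k) else 0)"
  unfolding rank_one_proj_mul magic_orth by (auto simp: vec_eq_iff)

lemma sum_rank_one_proj_magic: "(\<Sum>k\<in>UNIV. rank_one_proj (magic k)) = mat 1"
  by (simp add: vec_eq_iff magic_complete mat_def)

lemma U_d_spectral: "U_d x y z = magic_diag (\<lambda>k. exp (\<i> * cartan_phase x y z k))"
proof -
  have "cscale \<i> (x *\<^sub>R kron pauli_X pauli_X + y *\<^sub>R kron pauli_Y pauli_Y + z *\<^sub>R kron pauli_Z pauli_Z)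
     = magic_diag (\<lambda>k. \<i> * cartan_phase x y z k)"
    unfolding vec_eq_iff forall_pair2
    by (simp add: sum_four magic_nth scaleR_conv_of_real[where 'a=complex] field_simps)
  then show ?thesis unfolding U_d_def
    by (simp add: mat_exp_spectral rank_one_proj_magic_orth sum_rank_one_proj_magic)
qed


text \<open>The eigenvalue of \<open>kron (pauli j) (pauli j)\<close> on
  \<open>magic k\<close>.\<close>

definition pauli_sign :: "4 \<Rightarrow> 4 \<Rightarrow> complex" where
  "pauli_sign j k = (if j = 0 \<or> k = 0 \<and> j \<noteq> 2 \<or> j = k \<and> j \<noteq> 2 \<or> j = 2 \<and> (k = 1 \<or> k = 3) then 1 else - 1)"

definition pauli_coeff :: "real \<Rightarrow> real \<Rightarrow> real \<Rightarrow> 4 \<Rightarrow> complex" where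
  "pauli_coeff x y z j = (\<Sum>k\<in>UNIV. pauli_sign j k * exp (\<i> * cartan_phase x y z k)) / 4"

lemma rank_one_proj_magic:
  "rank_one_proj (magic k) = (\<Sum>j\<in>UNIV. cscale (pauli_sign j k / 4) (kron (pauli j) (pauli j)))"
proof -
  have "\<forall>k. rank_one_proj (magic k) = (\<Sum>j\<in>UNIV. cscale (pauli_sign j k / 4) (kron (pauli j) (pauli j)))"
    unfolding vec_eq_iff forall_pair2 forall_four
    by (simp add: sum_four magic_nth pauli_sign_def)
  then show ?thesis by blast
qed

lemma U_d_pauli: "U_d x y z = (\<Sum>j\<in>UNIV. cscale (pauli_coeff x y z j) (kron (pauli j) (pauli j)))"
proof -
  have "U_d x y z = (\<Sum>k\<in>UNIV. \<Sum>j\<in>UNIV. cscale (pauli_sign j k * exp (\<i> * cartan_phase x y z k) / 4) (kron (pauli j) (pauli j)))"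
    unfolding U_d_spectral rank_one_proj_magic
    by (intro sum.cong refl) (simp add: vec_eq_iff sum_distrib_left mult_ac)
  also have "\<dots> = (\<Sum>j\<in>UNIV. \<Sum>k\<in>UNIV. cscale (pauli_sign j k * exp (\<i> * cartan_phase x y z k) / 4) (kron (pauli j) (pauli j)))"
    by (rule sum.swap)
  also have "\<dots> = (\<Sum>j\<in>UNIV. cscale (pauli_coeff x y z j) (kron (pauli j) (pauli j)))"
    unfolding pauli_coeff_def
    by (intro sum.cong refl) (simp add: vec_eq_iff sum_distrib_right sum_divide_distrib)
  finally show ?thesis .
qed

lemma pauli_expansion_unique:
  assumes "(\<Sum>j\<in>UNIV. cscale (u j) (kron (pauli j) (pauli j))) = (\<Sum>j\<in>UNIV. cscale (w j) (kron (pauli j) (pauli j)))"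
  shows "u j = w j"
proof -
  have "u 0 + u 3 = w 0 + w 3" "u 0 - u 3 = w 0 - w 3" "u 1 + u 2 = w 1 + w 2" "u 1 - u 2 = w 1 - w 2"
    using assms unfolding vec_eq_iff forall_pair2 by (simp_all add: sum_four algebra_simps)
  moreover have "p = p' \<and> q = q'" if "p + q = p' + q'" "p - q = p' - q'" for p q p' q' :: complex
    using that by algebra
  ultimately have "u 0 = w 0" "u 1 = w 1" "u 2 = w 2" "u 3 = w 3" by blast+
  then have "\<forall>j. u j = w j" unfolding forall_four by simp
  then show ?thesis by blast
qed

lemma pauli_coeffs_nth: "pauli_coeffs x y z $ j = pauli_coeff x y z j"
proof -
  have "pauli_coeffs x y z = (\<chi> j. pauli_coeff x y z j)"
    unfolding pauli_coeffs_def
  proof (rule the_equality)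
    show "U_d x y z = (\<Sum>j\<in>UNIV. cscale ((\<chi> j. pauli_coeff x y z j) $ j) (kron (pauli j) (pauli j)))"
      using U_d_pauli by simp
    show "u = (\<chi> j. pauli_coeff x y z j)"
      if "U_d x y z = (\<Sum>j\<in>UNIV. cscale (u $ j) (kron (pauli j) (pauli j)))" for u
    proof -
      have "u $ j = pauli_coeff x y z j" for j
        by (rule pauli_expansion_unique) (use that in \<open>simp only: U_d_pauli\<close>)
      then show ?thesis by (simp add: vec_eq_iff)
    qed
  qed
  then show ?thesis by simp
qed

lemma cmod_sq_sum4_cis:
  "(cmod (cis a + cis b + cis c + cis d))\<^sup>2 =
     4 + 2 * (cos (a - b) + cos (c - d) + cos (a - c) + cos (b - d) + cos (a - d) + cos (b - c))"
proof -
  have 1: "(cos x)\<^sup>2 + (sin x)\<^sup>2 = 1" for x :: real by simp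
  have "(cmod (cis a + cis b + cis c + cis d))\<^sup>2 =
     (cos a + cos b + cos c + cos d)\<^sup>2 + (sin a + sin b + sin c + sin d)\<^sup>2" by (simp add: cmod_power2)
  also have "\<dots> = ((cos a)\<^sup>2 + (sin a)\<^sup>2) + ((cos b)\<^sup>2 + (sin b)\<^sup>2) + ((cos c)\<^sup>2 + (sin c)\<^sup>2) + ((cos d)\<^sup>2 + (sin d)\<^sup>2)
     + 2 * (cos (a - b) + cos (c - d) + cos (a - c) + cos (b - d) + cos (a - d) + cos (b - c))"
    by (simp only: cos_diff) algebra
  finally show ?thesis unfolding 1 by simp
qed

lemma schmidt_prob_eq:
  "schmidt_prob x y z 0 = (1 + cos (2 * y) * cos (2 * z) + cos (2 * x) * cos (2 * z) + cos (2 * x) * cos (2 * y)) / 4" (is ?A)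
  "schmidt_prob x y z 1 = (1 + cos (2 * y) * cos (2 * z) - cos (2 * x) * cos (2 * z) - cos (2 * x) * cos (2 * y)) / 4" (is ?B)
  "schmidt_prob x y z 2 = (1 - cos (2 * y) * cos (2 * z) + cos (2 * x) * cos (2 * z) - cos (2 * x) * cos (2 * y)) / 4" (is ?C)
  "schmidt_prob x y z 3 = (1 - cos (2 * y) * cos (2 * z) - cos (2 * x) * cos (2 * z) + cos (2 * x) * cos (2 * y)) / 4" (is ?D)
proof -
  \<comment> \<open>Signs are absorbed as phase shifts by pi, so that one formula for the modulus of
    a sum of four phases serves all four coefficients.\<close>
  have neg: "- cis a = cis (a + pi)" for a by (simp add: complex_eq_iff)
  note cm = cmod_sq_sum4_cis
  have e: "exp (\<i> * complex_of_real t) = cis t" for t by (simp add: cis_conv_exp)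
  define l where "l = cartan_phase x y z"
  have pairs: "cos (l 0 - l 1) + cos (l 2 - l 3) = 2 * (cos (2 * y) * cos (2 * z))"
    "cos (l 0 - l 2) + cos (l 1 - l 3) = 2 * (cos (2 * x) * cos (2 * z))"
    "cos (l 0 - l 3) + cos (l 1 - l 2) = 2 * (cos (2 * x) * cos (2 * y))"
  proof -
    have "l 0 - l 1 = -(2 * y - 2 * z)" "l 2 - l 3 = -(2 * y + 2 * z)" "l 0 - l 2 = 2 * x + 2 * z" "l 1 - l 3 = 2 * x - 2 * z"
      "l 0 - l 3 = 2 * x - 2 * y" "l 1 - l 2 = 2 * x + 2 * y" unfolding l_def by simp_all
    then show "cos (l 0 - l 1) + cos (l 2 - l 3) = 2 * (cos (2 * y) * cos (2 * z))"
      "cos (l 0 - l 2) + cos (l 1 - l 3) = 2 * (cos (2 * x) * cos (2 * z))"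
      "cos (l 0 - l 3) + cos (l 1 - l 2) = 2 * (cos (2 * x) * cos (2 * y))"
      by (simp_all only: cos_minus) (simp_all add: cos_add cos_diff)
  qed
  have sg: "cos (a + pi - b) = - cos (a - b)" "cos (a - (b + pi)) = - cos (a - b)" "cos (a + pi - (b + pi)) = cos (a - b)" for a b :: real
    by (simp_all add: cos_diff cos_add)
  have co: "schmidt_prob x y z j = (cmod (\<Sum>k\<in>UNIV. pauli_sign j k * cis (l k)))\<^sup>2 / 16" for j
    unfolding schmidt_prob_def pauli_coeffs_nth pauli_coeff_def l_def e by (simp add: norm_divide power_divide)
  have c0: "schmidt_prob x y z 0 = (cmod (cis (l 0) + cis (l 1) + cis (l 2) + cis (l 3)))\<^sup>2 / 16"
    unfolding co by (simp add: sum_four pauli_sign_def)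
  have c1: "schmidt_prob x y z 1 = (cmod (cis (l 0) + cis (l 1) + cis (l 2 + pi) + cis (l 3 + pi)))\<^sup>2 / 16"
    unfolding co neg[symmetric] by (simp add: sum_four pauli_sign_def)
  have c2: "schmidt_prob x y z 2 = (cmod (cis (l 0 + pi) + cis (l 1) + cis (l 2 + pi) + cis (l 3)))\<^sup>2 / 16"
    unfolding co neg[symmetric] by (simp add: sum_four pauli_sign_def)
  have c3: "schmidt_prob x y z 3 = (cmod (cis (l 0) + cis (l 1 + pi) + cis (l 2 + pi) + cis (l 3)))\<^sup>2 / 16"
    unfolding co neg[symmetric] by (simp add: sum_four pauli_sign_def)
  show ?A unfolding c0 cm using pairs by argo
  show ?B unfolding c1 cm sg using pairs by argo
  show ?C unfolding c2 cm sg using pairs by argo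
  show ?D unfolding c3 cm sg using pairs by argo
qed

lemma sum_sqrt_schmidt:
  "(\<Sum>j\<in>UNIV. sqrt (schmidt_prob x y z j)) = sum_sqrt (cos (2 * x)) (cos (2 * y)) (cos (2 * z))"
  unfolding sum_four schmidt_prob_eq sum_sqrt_def ..

subsection \<open>Unitary invariance of the uniform distribution on pure states\<close>

lemma measurable_linear: "linear F \<Longrightarrow> F \<in> borel_measurable borel"
  for F :: "'c::euclidean_space \<Rightarrow> 'd::euclidean_space"
  by (intro borel_measurable_continuous_onI linear_continuous_on) (simp add: linear_conv_bounded_linear)

text \<open>Matching two orthonormal bases carries boxes to boxes with the same side lengths, and
  boxes determine Lebesgue measure. This identifies \<open>complex ^ 2\<close> with
  \<open>real ^ 4\<close>.\<close>

lemma distr_lborel_basis_map: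
  fixes h :: "'a::euclidean_space \<Rightarrow> 'b::euclidean_space"
  assumes h: "bij_betw h Basis Basis"
  defines "f \<equiv> \<lambda>x. \<Sum>b\<in>Basis. (x \<bullet> b) *\<^sub>R h b"
  shows "linear f" "\<And>x y. f x \<bullet> f y = x \<bullet> y" "distr lborel borel f = lborel"
proof -
  show lin: "linear f" unfolding f_def by (rule linearI) (simp_all add: algebra_simps sum.distrib scaleR_sum_right)
  have hB: "h b \<in> Basis" if "b \<in> Basis" for b using h that by (auto simp: bij_betw_def)
  have hh: "h b \<bullet> h c = (if b = c then 1 else 0)" if "b \<in> Basis" "c \<in> Basis" for b c
    using h hB that by (auto simp: inner_Basis bij_betw_def inj_on_def)
  have coord: "f x \<bullet> h c = x \<bullet> c" if "c \<in> Basis" for x c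
  proof -
    have "f x \<bullet> h c = (\<Sum>b\<in>Basis. if b = c then x \<bullet> b else 0)"
      unfolding f_def inner_sum_left by (intro sum.cong refl) (simp add: hh that)
    then show ?thesis using that by simp
  qed
  show "f x \<bullet> f y = x \<bullet> y" for x y
  proof -
    have "f x \<bullet> f y = (\<Sum>b\<in>Basis. (y \<bullet> b) * (f x \<bullet> h b))" by (subst (2) f_def) (simp add: inner_sum_right)
    also have "\<dots> = x \<bullet> y" by (subst euclidean_inner) (simp add: coord mult.commute)
    finally show ?thesis .
  qed
  note meas = measurable_linear[OF lin]
  have "lborel = distr lborel borel f"
  proof (rule lborel_eqI)
    fix l u :: 'b
    assume lu: "\<And>b. b \<in> Basis \<Longrightarrow> l \<bullet> b \<le> u \<bullet> b"
    define l' u' where "l' = (\<Sum>b\<in>Basis. (l \<bullet> h b) *\<^sub>R b)" and "u' = (\<Sum>b\<in>Basis. (u \<bullet> h b) *\<^sub>R b)"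
    have l': "l' \<bullet> b = l \<bullet> h b" and u': "u' \<bullet> b = u \<bullet> h b" if "b \<in> Basis" for b
      using that unfolding l'_def u'_def by (simp_all add: inner_sum_left_Basis)
    have "f -` box l u = box l' u'"
    proof -
      have "h ` Basis = Basis" using h by (rule bij_betw_imp_surj_on)
      then have "(\<forall>c\<in>Basis. P c) \<longleftrightarrow> (\<forall>b\<in>Basis. P (h b))" for P by (metis imageE imageI)
      then have "f x \<in> box l u \<longleftrightarrow> (\<forall>b\<in>Basis. l \<bullet> h b < f x \<bullet> h b \<and> f x \<bullet> h b < u \<bullet> h b)" for x
        unfolding mem_box .
      then show ?thesis by (auto simp: mem_box l' u' coord)
    qed
    then have "emeasure (distr lborel borel f) (box l u) = emeasure lborel (box l' u')"
      using meas by (simp add: emeasure_distr)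
    also have "\<dots> = (\<Prod>b\<in>Basis. (u' - l') \<bullet> b)"
      using lu l' u' hB by (subst emeasure_lborel_box) auto
    also have "(\<Prod>b\<in>Basis. (u' - l') \<bullet> b) = (\<Prod>b\<in>Basis. (u - l) \<bullet> h b)"
      by (intro prod.cong refl) (simp add: inner_diff_left l' u')
    also have "\<dots> = (\<Prod>b\<in>Basis. (u - l) \<bullet> b)" by (rule prod.reindex_bij_betw[OF h])
    finally show "emeasure (distr lborel borel f) (box l u) = ennreal (\<Prod>b\<in>Basis. (u - l) \<bullet> b)" .
  qed simp
  then show "distr lborel borel f = lborel" ..
qed

lemma distr_lborel_orthogonal_cart:
  fixes f :: "real ^ 'n::{finite,wellorder} \<Rightarrow> real ^ 'n::_"
  assumes f: "orthogonal_transformation f"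
  shows "distr lborel borel f = lborel"
proof -
  have lin: "linear f" and surj: "surj f" and inj: "inj f"
    using f by (auto simp: orthogonal_transformation_linear orthogonal_transformation_surj orthogonal_transformation_inj)
  have inv: "orthogonal_transformation (inv f)" using f by (rule orthogonal_transformation_inv)
  note meas = measurable_linear[OF lin]
  have "lborel = distr lborel borel f"
  proof (rule lborel_eqI)
    fix l u :: "real ^ 'n::_"
    assume lu: "\<And>b. b \<in> Basis \<Longrightarrow> l \<bullet> b \<le> u \<bullet> b"
    have eq: "f -` box l u = inv f ` box l u" using inj surj by (simp add: bij_def bij_vimage_eq_inv_image)
    have "emeasure (distr lborel borel f) (box l u) = emeasure lborel (f -` box l u)"
      using meas by (simp add: emeasure_distr)
    also have "\<dots> = emeasure lebesgue (inv f ` box l u)"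
      unfolding eq[symmetric] using measurable_sets[OF meas, of "box l u"] by simp
    also have "\<dots> = measure lebesgue (inv f ` box l u)"
      using measurable_orthogonal_image[OF inv, of "box l u"] by (simp add: emeasure_eq_measure2)
    also have "\<dots> = measure lebesgue (box l u)"
      using measure_orthogonal_image[OF inv, of "box l u"] by simp
    also have "\<dots> = (\<Prod>b\<in>Basis. (u - l) \<bullet> b)"
      using lu by simp
    finally show "emeasure (distr lborel borel f) (box l u) = ennreal (\<Prod>b\<in>Basis. (u - l) \<bullet> b)" .
  qed simp
  then show ?thesis ..
qed

text \<open>The isometry is conjugated by the basis identification f into one of
  \<open>real ^ 'n\<close>, where orthogonal maps are known to preserve volume.\<close>

lemma distr_lborel_isometry:
  fixes T :: "'a::euclidean_space \<Rightarrow> 'a"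
  assumes dim: "DIM('a) = CARD('n::{finite,wellorder})" and T: "orthogonal_transformation T"
  shows "distr lborel borel T = lborel"
proof -
  have "card (Basis :: (real ^ 'n::_) set) = card (Basis :: 'a set)" using dim by simp
  then obtain h where h: "bij_betw h (Basis :: (real ^ 'n::_) set) (Basis :: 'a set)"
    using finite_same_card_bij[OF finite_Basis finite_Basis] by blast
  define f where "f = (\<lambda>x. \<Sum>b\<in>Basis. (x \<bullet> b) *\<^sub>R h b)"
  have f: "linear f" "\<And>x y. f x \<bullet> f y = x \<bullet> y" "distr lborel borel f = lborel"
    unfolding f_def by (rule distr_lborel_basis_map[OF h])+
  have "inj f"
  proof (rule injI)
    fix x y assume "f x = f y"
    then have "f (x - y) = 0" using f(1) by (simp add: linear_diff)
    then have "(x - y) \<bullet> (x - y) = 0" using f(2)[of "x - y" "x - y"] by simp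
    then show "x = y" by simp
  qed
  have "surj f"
    unfolding surj_def
  proof
    fix y
    have "h ` Basis = Basis" using h by (rule bij_betw_imp_surj_on)
    then have "Basis \<subseteq> range f"
    proof -
      have "f b = h b" if "b \<in> Basis" for b
      proof -
        have "f b = (\<Sum>c\<in>Basis. if c = b then h c else 0)" unfolding f_def
          by (intro sum.cong refl) (use that in \<open>auto simp: inner_Basis\<close>)
        then show ?thesis using that by simp
      qed
      then show ?thesis using \<open>h ` Basis = Basis\<close> by (metis image_subset_iff rangeI subsetI image_iff)
    qed
    moreover have "subspace (range f)" using f(1) by (simp add: linear_subspace_image)
    ultimately have "span Basis \<subseteq> range f" by (rule span_minimal)
    then show "\<exists>x. y = f x" by (auto simp: span_Basis)
  qed
  define g where "g = inv f"
  have fg: "f (g y) = y" for y unfolding g_def using \<open>surj f\<close> by (rule surj_f_inv_f)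
  have gf: "g (f x) = x" for x unfolding g_def using \<open>inj f\<close> by simp
  have ling: "linear g"
    using f(1) by (intro linearI) (metis fg gf linear_add, metis fg gf linear_scale)
  have linT: "linear T" using T by (rule orthogonal_transformation_linear)
  have orth: "orthogonal_transformation (g \<circ> T \<circ> f)"
    unfolding orthogonal_transformation_def
  proof (intro conjI allI)
    show "linear (g \<circ> T \<circ> f)" using f(1) ling linT by (intro linear_compose)
    show "(g \<circ> T \<circ> f) v \<bullet> (g \<circ> T \<circ> f) w = v \<bullet> w" for v w
    proof -
      have "(g \<circ> T \<circ> f) v \<bullet> (g \<circ> T \<circ> f) w = f (g (T (f v))) \<bullet> f (g (T (f w)))" by (simp add: f(2))
      also have "\<dots> = T (f v) \<bullet> T (f w)" by (simp only: fg)
      also have "\<dots> = v \<bullet> w" using T by (simp add: orthogonal_transformation_def f(2))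
      finally show ?thesis .
    qed
  qed
  note meas = measurable_linear
  have "distr lborel borel T = distr (distr lborel borel f) borel T" by (simp only: f(3))
  also have "\<dots> = distr lborel borel (T \<circ> f)" using meas[OF linT] meas[OF f(1)] by (intro distr_distr) auto
  also have "T \<circ> f = f \<circ> (g \<circ> T \<circ> f)" by (auto simp: fg)
  also have "distr lborel borel (f \<circ> (g \<circ> T \<circ> f)) = distr (distr lborel borel (g \<circ> T \<circ> f)) borel f"
    using meas[OF f(1)] meas[OF orthogonal_transformation_linear[OF orth]] by (intro distr_distr[symmetric]) auto
  also have "\<dots> = lborel" unfolding distr_lborel_orthogonal_cart[OF orth] by (rule f(3))
  finally show ?thesis .
qed

lemma linear_matrix_vector: "linear ((*v) V)" for V :: "complex ^ 'n ^ 'm"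
  by (rule linearI)
    (simp_all add: vec_eq_iff matrix_vector_mult_def scaleR_sum_right distrib_left sum.distrib)

lemma norm_sq_sum: "complex_of_real ((norm x)\<^sup>2) = (\<Sum>i\<in>UNIV. x $ i * cnj (x $ i))" for x :: "complex ^ 'n"
  unfolding norm_vec_def L2_set_def
  by (simp add: sum_nonneg complex_norm_square[symmetric])

lemma unitary_inner:
  fixes V :: "complex ^ 'n ^ 'n"
  assumes "unitary V"
  shows "(\<Sum>i\<in>UNIV. cnj ((V *v x) $ i) * (V *v y) $ i) = (\<Sum>i\<in>UNIV. cnj (x $ i) * y $ i)"
proof -
  have "(\<Sum>i\<in>UNIV. cnj ((V *v x) $ i) * (V *v y) $ i)
     = (\<Sum>i\<in>UNIV. \<Sum>a\<in>UNIV. \<Sum>b\<in>UNIV. cnj (V $ i $ a * x $ a) * (V $ i $ b * y $ b))"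
    unfolding matrix_vector_nth cnj_sum sum_product ..
  also have "\<dots> = (\<Sum>a\<in>UNIV. \<Sum>b\<in>UNIV. \<Sum>i\<in>UNIV. cnj (V $ i $ a * x $ a) * (V $ i $ b * y $ b))"
    by (rule trans[OF sum.swap]) (rule sum.cong[OF refl], rule sum.swap)
  also have "\<dots> = (\<Sum>a\<in>UNIV. \<Sum>b\<in>UNIV. cnj (x $ a) * y $ b * (dagger V ** V) $ a $ b)"
    by (intro sum.cong refl) (simp add: matrix_mul_nth sum_distrib_left mult_ac)
  also have "\<dots> = (\<Sum>a\<in>UNIV. \<Sum>b\<in>UNIV. if a = b then cnj (x $ a) * y $ b else 0)"
    using assms unfolding unitary_def by (intro sum.cong refl) (simp add: mat_def)
  finally show ?thesis by simp
qed

lemma unitary_mul_vec_orthogonal: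
  fixes V :: "complex ^ 'n ^ 'n"
  assumes "unitary V"
  shows "orthogonal_transformation ((*v) V)"
proof -
  have "complex_of_real ((norm (V *v x))\<^sup>2) = complex_of_real ((norm x)\<^sup>2)" for x
    using unitary_inner[OF assms, of x x] unfolding norm_sq_sum by (simp add: mult.commute)
  then have "norm (V *v x) = norm x" for x by (simp only: of_real_eq_iff) simp
  then show ?thesis using linear_matrix_vector by (simp add: orthogonal_transformation)
qed

lemma measurable_matrix_vector [measurable]: "(\<lambda>v. V *v v) \<in> borel_measurable borel" for V :: "complex ^ 'n ^ 'm"
  by (rule measurable_linear) (rule linear_matrix_vector)

lemma distr_lborel_unitary: "unitary V \<Longrightarrow> distr lborel borel ((*v) V) = lborel" for V :: "complex ^ 2 ^ 2"
  by (rule distr_lborel_isometry[where 'n = 4]) (auto intro: unitary_mul_vec_orthogonal)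

text \<open>A unitary preserves both the norm and Lebesgue measure, so it fixes the uniform measure
  on the ball and commutes with the radial projection.\<close>

lemma haar_state_unitary:
  assumes V: "unitary V"
  shows "distr haar_state borel ((*v) V) = haar_state"
proof -
  have nv: "norm (V *v x) = norm x" for x
    using unitary_mul_vec_orthogonal[OF V] by (simp add: orthogonal_transformation)
  have ball: "((*v) V) -` (ball 0 1 \<inter> A) = ball 0 1 \<inter> ((*v) V) -` A" for A by (auto simp: nv)
  have inv: "distr (uniform_measure lborel (ball 0 1)) borel ((*v) V) = uniform_measure lborel (ball 0 1)"
  proof (rule measure_eqI)
    fix A assume "A \<in> sets (distr (uniform_measure lborel (ball (0 :: complex ^ 2) 1)) borel ((*v) V))"
    then have A: "A \<in> sets borel" by simp
    have "emeasure (distr (uniform_measure lborel (ball 0 1)) borel ((*v) V)) A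
       = emeasure (uniform_measure lborel (ball 0 1)) (((*v) V) -` A)"
      using A by (subst emeasure_distr) auto
    also have "\<dots> = emeasure lborel (ball 0 1 \<inter> ((*v) V) -` A) / emeasure lborel (ball (0 :: complex ^ 2) 1)"
      using A measurable_sets[OF measurable_matrix_vector A, of V] by (subst emeasure_uniform_measure) auto
    also have "emeasure lborel (ball 0 1 \<inter> ((*v) V) -` A) = emeasure (distr lborel borel ((*v) V)) (ball 0 1 \<inter> A)"
      unfolding ball[symmetric] using A by (subst emeasure_distr) auto
    also have "\<dots> = emeasure lborel (ball 0 1 \<inter> A)" unfolding distr_lborel_unitary[OF V] ..
    finally show "emeasure (distr (uniform_measure lborel (ball 0 1)) borel ((*v) V)) A
       = emeasure (uniform_measure lborel (ball 0 1)) A"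
      using A by (simp add: emeasure_uniform_measure)
  qed simp
  have "distr haar_state borel ((*v) V) = distr (uniform_measure lborel (ball 0 1)) borel ((*v) V \<circ> (\<lambda>v. v /\<^sub>R norm v))"
    unfolding haar_state_def by (rule distr_distr) auto
  also have "(*v) V \<circ> (\<lambda>v. v /\<^sub>R norm v) = (\<lambda>v. v /\<^sub>R norm v) \<circ> (*v) V"
    by (auto simp: nv linear_scale[OF linear_matrix_vector])
  also have "distr (uniform_measure lborel (ball 0 1)) borel ((\<lambda>v. v /\<^sub>R norm v) \<circ> (*v) V)
     = distr (distr (uniform_measure lborel (ball 0 1)) borel ((*v) V)) borel (\<lambda>v. v /\<^sub>R norm v)"
    by (rule distr_distr[symmetric]) auto
  also have "\<dots> = haar_state" unfolding inv haar_state_def ..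
  finally show ?thesis .
qed

lemma dagger_mul: "dagger (A ** B) = dagger B ** dagger A"
  by (simp add: vec_eq_iff matrix_mul_nth mult.commute)

lemma dagger_dagger [simp]: "dagger (dagger A) = A"
  by (simp add: vec_eq_iff)

lemma dagger_mat_one [simp]: "dagger (mat 1) = mat 1"
  by (auto simp add: vec_eq_iff mat_def)

lemma kron_mul: "kron A B ** kron C D = kron (A ** C) (B ** D)"
  for A :: "complex ^ 'a ^ 'b" and C :: "complex ^ 'c ^ 'a"
proof -
  have "(kron A B ** kron C D) $ p $ q = kron (A ** C) (B ** D) $ p $ q" for p q
  proof -
    have "(kron A B ** kron C D) $ p $ q
      = (\<Sum>(k, l)\<in>UNIV \<times> UNIV. (A $ fst p $ k * C $ k $ fst q) * (B $ snd p $ l * D $ l $ snd q))"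
      unfolding matrix_mul_nth by (simp add: case_prod_unfold mult_ac)
    also have "\<dots> = kron (A ** C) (B ** D) $ p $ q"
      unfolding kron_nth matrix_mul_nth sum_product sum.cartesian_product ..
    finally show ?thesis .
  qed
  then show ?thesis unfolding vec_eq_iff by blast
qed

lemma dagger_kron: "dagger (kron A B) = kron (dagger A) (dagger B)"
  by (simp add: vec_eq_iff)

lemma kron_one: "kron (mat 1) (mat 1) = mat 1"
  by (auto simp: vec_eq_iff mat_def prod_eq_iff)

lemma unitary_mul: "unitary A \<Longrightarrow> unitary B \<Longrightarrow> unitary (A ** B)"
  unfolding unitary_def dagger_mul by (metis matrix_mul_assoc matrix_mul_rid)

lemma unitary_kron: "unitary A \<Longrightarrow> unitary B \<Longrightarrow> unitary (kron A B)"
  unfolding unitary_def dagger_kron kron_mul by (simp add: kron_one)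

lemma unitary_one: "unitary (mat 1)"
  by (simp add: unitary_def)

lemma unitary_dagger: "unitary A \<Longrightarrow> unitary (dagger A)"
  by (simp add: unitary_def)

lemma magic_diagonal_mul:
  "magic_diag c ** magic_diag d
   = magic_diag (\<lambda>k. c k * d k)"
proof -
  have cs0: "cscale x 0 = (0 :: two_qubit)" for x by (simp add: vec_eq_iff)
  have "magic_diag c ** magic_diag d
     = (\<Sum>l\<in>UNIV. \<Sum>k\<in>UNIV. if k = l then cscale (c k * d l) (rank_one_proj (magic k)) else 0)"
    unfolding matrix_mul_sum_right matrix_mul_sum_left cscale_mul rank_one_proj_magic_orth
    by (intro sum.cong refl) (simp add: cs0)
  then show ?thesis by simp
qed

lemma unitary_U_d: "unitary (U_d x y z)"
proof -
  have d: "dagger (U_d x y z) = magic_diag (\<lambda>k. exp (- (\<i> * cartan_phase x y z k)))"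
    unfolding U_d_spectral by (simp add: vec_eq_iff exp_cnj mult_ac)
  have cs1: "cscale 1 A = A" for A :: two_qubit by (simp add: vec_eq_iff)
  show ?thesis
    unfolding unitary_def d unfolding U_d_spectral magic_diagonal_mul
    by (simp add: exp_minus cs1 sum_rank_one_proj_magic)
qed

subsection \<open>Moments of the uniform distribution on pure states\<close>

lemma sets_haar_state [simp, measurable_cong]: "sets haar_state = sets borel"
  by (simp add: haar_state_def)

lemma space_haar_state [simp]: "space haar_state = UNIV"
  by (simp add: haar_state_def)

lemma emeasure_unit_ball: "emeasure lborel (ball (0 :: complex ^ 2) 1) \<noteq> 0" "emeasure lborel (ball (0 :: complex ^ 2) 1) < \<infinity>"
proof -
  show "emeasure lborel (ball (0 :: complex ^ 2) 1) < \<infinity>" by (rule emeasure_bounded_finite) simp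
  show "emeasure lborel (ball (0 :: complex ^ 2) 1) \<noteq> 0"
    using content_ball_pos[of 1 "0 :: complex ^ 2"] by (auto simp: measure_def)
qed

lemma haar_state_total: "emeasure haar_state UNIV = 1"
proof -
  have "emeasure haar_state UNIV = emeasure (uniform_measure lborel (ball (0 :: complex ^ 2) 1)) UNIV"
    unfolding haar_state_def by (subst emeasure_distr) auto
  also have "\<dots> = 1" using emeasure_unit_ball by (subst emeasure_uniform_measure) auto
  finally show ?thesis .
qed

interpretation haar: finite_measure haar_state
  by standard (simp add: haar_state_total)

lemma AE_haar_norm: "AE v in haar_state. norm v = 1"
proof -
  have "AE v in lborel. v \<noteq> (0 :: complex ^ 2)" by (rule AE_lborel_singleton)
  then have "AE v in uniform_measure lborel (ball (0 :: complex ^ 2) 1). norm (v /\<^sub>R norm v) = 1"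
    using emeasure_unit_ball by (subst AE_uniform_measure) (auto elim!: eventually_mono)
  then show ?thesis unfolding haar_state_def by (subst AE_distr_iff) auto
qed

lemma haar_integrable:
  fixes f :: "complex ^ 2 \<Rightarrow> real"
  assumes f: "continuous_on UNIV f"
  shows "integrable haar_state f"
proof -
  have "compact (f ` sphere 0 1)"
    by (rule compact_continuous_image) (use f continuous_on_subset in \<open>blast, simp\<close>)
  then have "bounded (f ` sphere 0 1)" by (rule compact_imp_bounded)
  then obtain B where "\<forall>y\<in>f ` sphere 0 1. norm y \<le> B" unfolding bounded_iff ..
  then have B: "norm (f v) \<le> B" if "norm v = 1" for v using that by auto
  have "f \<in> borel_measurable haar_state"
    unfolding measurable_cong_sets[OF sets_haar_state refl] using f by (rule borel_measurable_continuous_onI)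
  then show ?thesis
    using AE_haar_norm B by (intro haar.integrable_const_bound[of _ B]) (auto elim!: eventually_mono)
qed

lemma haar_integral_unitary:
  fixes f :: "complex ^ 2 \<Rightarrow> real"
  assumes f: "continuous_on UNIV f" and V: "unitary V"
  shows "(\<integral>v. f (V *v v) \<partial>haar_state) = (\<integral>v. f v \<partial>haar_state)"
proof -
  have "(\<integral>v. f v \<partial>haar_state) = (\<integral>v. f v \<partial>(distr haar_state borel ((*v) V)))"
    unfolding haar_state_unitary[OF V] ..
  also have "\<dots> = (\<integral>v. f (V *v v) \<partial>haar_state)"
    using f by (intro integral_distr) (auto intro: borel_measurable_continuous_onI simp: measurable_cong_sets[OF sets_haar_state refl])
  finally show ?thesis ..
qed

lemma unitary_2I:
  assumes "V $ 1 $ 1 * cnj (V $ 1 $ 1) + V $ 1 $ 2 * cnj (V $ 1 $ 2) = 1"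
    "V $ 2 $ 1 * cnj (V $ 2 $ 1) + V $ 2 $ 2 * cnj (V $ 2 $ 2) = 1"
    "V $ 1 $ 1 * cnj (V $ 2 $ 1) + V $ 1 $ 2 * cnj (V $ 2 $ 2) = 0"
  shows "unitary (V :: one_qubit)"
proof -
  have "V $ 2 $ 1 * cnj (V $ 1 $ 1) + V $ 2 $ 2 * cnj (V $ 1 $ 2) = 0"
    using arg_cong[OF assms(3), of cnj] by (simp add: mult.commute)
  then have "V ** dagger V = mat 1"
    using assms by (simp add: vec_eq_iff forall_2 matrix_mul_nth sum_2)
  then show ?thesis unfolding unitary_def using matrix_left_right_inverse by blast
qed

abbreviation qform :: "complex \<Rightarrow> complex \<Rightarrow> complex \<Rightarrow> complex ^ 2 \<Rightarrow> complex" where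
  "qform c0 c1 c2 v \<equiv> c0 * (v $ 1)\<^sup>2 + c1 * (v $ 1 * v $ 2) + c2 * (v $ 2)\<^sup>2"

text \<open>A discrete Fourier average: the terms carry weights 1, w, w^2 with w running through the
  fourth roots of unity, so all cross terms cancel.\<close>

lemma four_phase_average:
  "(cmod (x + y + z))\<^sup>2 + (cmod (x + \<i> * y - z))\<^sup>2 + (cmod (x - y + z))\<^sup>2 + (cmod (x - \<i> * y - z))\<^sup>2
   = 4 * ((cmod x)\<^sup>2 + (cmod y)\<^sup>2 + (cmod z)\<^sup>2)"
  by (simp only: cmod_power2) (simp add: poly_simps)

text \<open>Invariance under diagonal phases reduces every quadratic form to three moments. These
  are fixed by invariance under X and under the Hadamard gate, together with the total mass.\<close>

lemma haar_moments:
  "(\<integral>v. (cmod (qform c0 c1 c2 v))\<^sup>2 \<partial>haar_state) = ((cmod c0)\<^sup>2 + (cmod c2)\<^sup>2) / 3 + (cmod c1)\<^sup>2 / 6" (is ?A)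
  "(\<integral>v. ((norm v)\<^sup>2)\<^sup>2 \<partial>haar_state) = 1" (is ?B)
proof -
  define m0 m1 m2 where "m0 = (\<integral>v. (cmod ((v $ 1)\<^sup>2))\<^sup>2 \<partial>haar_state)"
    and "m1 = (\<integral>v. (cmod (v $ 1 * v $ 2))\<^sup>2 \<partial>haar_state)" and "m2 = (\<integral>v. (cmod ((v $ 2)\<^sup>2))\<^sup>2 \<partial>haar_state)"
  have int: "integrable haar_state (\<lambda>v. (cmod ((v $ 1)\<^sup>2))\<^sup>2)" "integrable haar_state (\<lambda>v. (cmod (v $ 1 * v $ 2))\<^sup>2)"
    "integrable haar_state (\<lambda>v. (cmod ((v $ 2)\<^sup>2))\<^sup>2)"
    by (intro haar_integrable continuous_intros)+
  have form: "(\<integral>v. (cmod (qform c0 c1 c2 v))\<^sup>2 \<partial>haar_state) = (cmod c0)\<^sup>2 * m0 + (cmod c1)\<^sup>2 * m1 + (cmod c2)\<^sup>2 * m2"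
    for c0 c1 c2
  proof -
    define f where "f v = (cmod (qform c0 c1 c2 v))\<^sup>2" for v
    have cont: "continuous_on UNIV f" unfolding f_def by (intro continuous_intros)
    define D :: "complex \<Rightarrow> one_qubit" where "D w = vector [vector [1, 0], vector [0, w]]" for w
    have Dv: "(D w *v v) $ 1 = v $ 1" "(D w *v v) $ 2 = w * v $ 2" for w v
      unfolding D_def by (simp_all add: matrix_vector_nth sum_2)
    have uD: "unitary (D w)" if "w * cnj w = 1" for w
      by (rule unitary_2I) (simp_all add: D_def that)
    have contD: "continuous_on UNIV (\<lambda>v. f (D w *v v))" for w
      unfolding f_def Dv by (intro continuous_intros)
    have inv: "(\<integral>v. f (D w *v v) \<partial>haar_state) = (\<integral>v. f v \<partial>haar_state)" if "w * cnj w = 1" for w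
      by (rule haar_integral_unitary[OF cont uD[OF that]])
    have "4 * (\<integral>v. f v \<partial>haar_state) = (\<integral>v. f (D 1 *v v) \<partial>haar_state) + (\<integral>v. f (D \<i> *v v) \<partial>haar_state)
        + (\<integral>v. f (D (-1) *v v) \<partial>haar_state) + (\<integral>v. f (D (-\<i>) *v v) \<partial>haar_state)"
      by (simp add: inv)
    also have "\<dots> = (\<integral>v. f (D 1 *v v) + f (D \<i> *v v) + f (D (-1) *v v) + f (D (-\<i>) *v v) \<partial>haar_state)"
      by (simp add: haar_integrable contD)
    also have "(\<lambda>v. f (D 1 *v v) + f (D \<i> *v v) + f (D (-1) *v v) + f (D (-\<i>) *v v))
      = (\<lambda>v. 4 * ((cmod c0)\<^sup>2 * (cmod ((v $ 1)\<^sup>2))\<^sup>2 + (cmod c1)\<^sup>2 * (cmod (v $ 1 * v $ 2))\<^sup>2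
         + (cmod c2)\<^sup>2 * (cmod ((v $ 2)\<^sup>2))\<^sup>2))"
    proof
      fix v
      show "f (D 1 *v v) + f (D \<i> *v v) + f (D (-1) *v v) + f (D (-\<i>) *v v)
        = 4 * ((cmod c0)\<^sup>2 * (cmod ((v $ 1)\<^sup>2))\<^sup>2 + (cmod c1)\<^sup>2 * (cmod (v $ 1 * v $ 2))\<^sup>2
         + (cmod c2)\<^sup>2 * (cmod ((v $ 2)\<^sup>2))\<^sup>2)"
        using four_phase_average[of "c0 * (v $ 1)\<^sup>2" "c1 * (v $ 1 * v $ 2)" "c2 * (v $ 2)\<^sup>2"]
        unfolding f_def Dv by (simp add: norm_mult power_mult_distrib mult_ac)
    qed
    also have "(\<integral>v. 4 * ((cmod c0)\<^sup>2 * (cmod ((v $ 1)\<^sup>2))\<^sup>2 + (cmod c1)\<^sup>2 * (cmod (v $ 1 * v $ 2))\<^sup>2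
         + (cmod c2)\<^sup>2 * (cmod ((v $ 2)\<^sup>2))\<^sup>2) \<partial>haar_state)
       = 4 * ((cmod c0)\<^sup>2 * m0 + (cmod c1)\<^sup>2 * m1 + (cmod c2)\<^sup>2 * m2)"
      unfolding m0_def m1_def m2_def by (simp add: int del: norm_power norm_mult)
    finally show ?thesis unfolding f_def by simp
  qed
  have swap: "m0 = m2"
  proof -
    have "unitary pauli_X" by (rule unitary_2I) simp_all
    moreover have "continuous_on UNIV (\<lambda>v :: complex ^ 2. (cmod ((v $ 1)\<^sup>2))\<^sup>2)" by (intro continuous_intros)
    ultimately have "(\<integral>v. (cmod (((pauli_X *v v) $ 1)\<^sup>2))\<^sup>2 \<partial>haar_state) = m0"
      unfolding m0_def by (intro haar_integral_unitary)
    then show ?thesis unfolding m2_def by (simp add: matrix_vector_nth sum_2)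
  qed
  have nrm: "((norm v)\<^sup>2)\<^sup>2 = (cmod ((v $ 1)\<^sup>2))\<^sup>2 + 2 * (cmod (v $ 1 * v $ 2))\<^sup>2 + (cmod ((v $ 2)\<^sup>2))\<^sup>2" for v :: "complex ^ 2"
  proof -
    have "(norm v)\<^sup>2 = (cmod (v $ 1))\<^sup>2 + (cmod (v $ 2))\<^sup>2" unfolding norm_vec_def L2_set_def by (simp add: sum_2)
    then show ?thesis by (simp add: norm_mult norm_power poly_simps)
  qed
  have total: "(\<integral>v. ((norm v)\<^sup>2)\<^sup>2 \<partial>haar_state) = m0 + 2 * m1 + m2"
    unfolding nrm m0_def m1_def m2_def by (simp add: int del: norm_power norm_mult)
  have one: "(\<integral>v. ((norm v)\<^sup>2)\<^sup>2 \<partial>haar_state) = 1"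
  proof -
    have "(\<integral>v. ((norm v)\<^sup>2)\<^sup>2 \<partial>haar_state) = (\<integral>v. 1 \<partial>haar_state)"
      using AE_haar_norm by (intro integral_cong_AE) (auto elim!: eventually_mono simp: measurable_cong_sets[OF sets_haar_state refl])
    also have "\<dots> = 1" using haar_state_total by (simp add: measure_def)
    finally show ?thesis .
  qed
  have hadamard: "m0 = m0 / 4 + m1 + m2 / 4"
  proof -
    define H :: one_qubit where "H = vector [vector [1 / sqrt 2, 1 / sqrt 2], vector [1 / sqrt 2, - 1 / sqrt 2]]"
    have "unitary H" by (rule unitary_2I) (simp_all add: H_def)
    moreover have "continuous_on UNIV (\<lambda>v :: complex ^ 2. (cmod ((v $ 1)\<^sup>2))\<^sup>2)" by (intro continuous_intros)
    ultimately have "(\<integral>v. (cmod (((H *v v) $ 1)\<^sup>2))\<^sup>2 \<partial>haar_state) = m0"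
      unfolding m0_def by (intro haar_integral_unitary)
    moreover have "((H *v v) $ 1)\<^sup>2 = qform (1/2) 1 (1/2) v" for v
      by (simp add: H_def matrix_vector_nth sum_2 power2_eq_square field_simps)
    ultimately have "m0 = (\<integral>v. (cmod (qform (1/2) 1 (1/2) v))\<^sup>2 \<partial>haar_state)" by simp
    also have "\<dots> = m0 / 4 + m1 + m2 / 4" unfolding form by (simp add: power2_eq_square)
    finally show ?thesis .
  qed
  have m: "m0 = 1/3" "m1 = 1/6" "m2 = 1/3" using one total swap hadamard by auto
  show ?A
    unfolding form m by simp
  show ?B by (rule one)
qed

subsection \<open>Entangling power in Cartan coordinates\<close>

definition tensor_vec :: "complex ^ 'a \<Rightarrow> complex ^ 'b \<Rightarrow> complex ^ ('a \<times> 'b)" where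
  "tensor_vec v w = (\<chi> p. v $ fst p * w $ snd p)"

lemma tensor_vec_nth [simp]: "tensor_vec v w $ p = v $ fst p * w $ snd p"
  by (simp add: tensor_vec_def)

text \<open>For a pure state the linear entropy is \<open>1 - Tr \<rho>\<^sub>A\<^sup>2 = 2 \<bar>det\<bar>\<^sup>2\<close> of its coefficient matrix, and on a
  Cartan gate this determinant is a quadratic form in each input.\<close>

definition concurrence_form :: "complex ^ (2 \<times> 2) \<Rightarrow> complex" where
  "concurrence_form x = x $ (1,1) * x $ (2,2) - x $ (1,2) * x $ (2,1)"

lemma kron_tensor_vec: "kron A B *v tensor_vec v w = tensor_vec (A *v v) (B *v w)"
  for v :: "complex ^ 'a" and w :: "complex ^ 'b"
proof -
  have "(kron A B *v tensor_vec v w) $ p = tensor_vec (A *v v) (B *v w) $ p" for p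
  proof -
    have "(kron A B *v tensor_vec v w) $ p
      = (\<Sum>(k, l)\<in>UNIV \<times> UNIV. (A $ fst p $ k * v $ k) * (B $ snd p $ l * w $ l))"
      unfolding matrix_vector_nth by (simp add: case_prod_unfold mult_ac)
    also have "\<dots> = tensor_vec (A *v v) (B *v w) $ p"
      unfolding tensor_vec_nth matrix_vector_nth sum_product sum.cartesian_product ..
    finally show ?thesis .
  qed
  then show ?thesis unfolding vec_eq_iff by blast
qed

lemma norm_tensor_vec: "(norm (tensor_vec v w))\<^sup>2 = (norm v)\<^sup>2 * (norm w)\<^sup>2"
  for v :: "complex ^ 'a" and w :: "complex ^ 'b"
proof -
  have "complex_of_real ((norm (tensor_vec v w))\<^sup>2) = (\<Sum>(k, l)\<in>UNIV \<times> UNIV. (v $ k * cnj (v $ k)) * (w $ l * cnj (w $ l)))"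
    unfolding norm_sq_sum by (simp add: case_prod_unfold mult_ac)
  also have "\<dots> = complex_of_real ((norm v)\<^sup>2 * (norm w)\<^sup>2)"
    unfolding of_real_mult norm_sq_sum sum_product sum.cartesian_product ..
  finally show ?thesis by (simp only: of_real_eq_iff)
qed

text \<open>A local gate turns the coefficient matrix M of x into V M W^T, and
  \<open>concurrence_form\<close> is the determinant of that matrix.\<close>

lemma det_kron_form: "concurrence_form (kron V W *v x) = det V * det W * concurrence_form x" for V W :: one_qubit
  unfolding concurrence_form_def matrix_vector_nth sum_pair2 kron_nth det_2 fst_conv snd_conv by algebra

lemma cmod_det_unitary: "unitary V \<Longrightarrow> cmod (det V) = 1" for V :: one_qubit
proof -
  assume "unitary V"
  then have "det (dagger V) * det V = 1" unfolding unitary_def by (metis det_I det_mul)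
  moreover have "det (dagger V) = cnj (det V)" by (simp add: det_2 mult.commute)
  ultimately have "complex_of_real ((cmod (det V))\<^sup>2) = 1" by (simp only: complex_norm_square mult.commute)
  then have "(cmod (det V))\<^sup>2 = 1" by (simp only: of_real_eq_1_iff)
  then show ?thesis by (simp add: power2_eq_1_iff) (metis norm_ge_zero le_minus_one_simps(3))
qed

lemma kron_rank_one_proj: "kron (rank_one_proj v) (rank_one_proj w) = rank_one_proj (tensor_vec v w)"
  by (simp add: vec_eq_iff mult_ac)

lemma conj_rank_one_proj: "A ** rank_one_proj x ** dagger A = rank_one_proj (A *v x)"
proof -
  have "(A ** rank_one_proj x ** dagger A) $ i $ j = rank_one_proj (A *v x) $ i $ j" for i j
    unfolding matrix_mul_nth rank_one_proj_nth matrix_vector_nth dagger_nth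
    by (simp add: sum_distrib_left sum_distrib_right mult_ac)
  then show ?thesis unfolding vec_eq_iff by blast
qed

text \<open>The inputs are not normalised, so the square of the trace of the reduced operator stays
  as a fourth power of the norm; its average over \<open>haar_state\<close> is 1.\<close>

lemma linear_entropy_eq:
  "1 - Re (trace (reduced_output U v w ** reduced_output U v w))
   = 1 - ((norm (U *v tensor_vec v w))\<^sup>2)\<^sup>2 + 2 * (cmod (concurrence_form (U *v tensor_vec v w)))\<^sup>2"
proof -
  obtain x where x: "x = U *v tensor_vec v w" by simp
  have nth: "reduced_output U v w $ i $ j = x $ (i, 1) * cnj (x $ (j, 1)) + x $ (i, 2) * cnj (x $ (j, 2))" for i j
    unfolding reduced_output_def kron_rank_one_proj conj_rank_one_proj partial_trace_B_def x by (simp add: sum_2)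
  have "trace (reduced_output U v w ** reduced_output U v w)
    = (\<Sum>p\<in>UNIV. x $ p * cnj (x $ p))\<^sup>2 - 2 * (concurrence_form x * cnj (concurrence_form x))"
    unfolding trace_def matrix_mul_nth sum_2 nth sum_pair2 concurrence_form_def complex_cnj_diff complex_cnj_mult
    by algebra
  also have "\<dots> = complex_of_real (((norm x)\<^sup>2)\<^sup>2 - 2 * (cmod (concurrence_form x))\<^sup>2)"
    unfolding norm_sq_sum[symmetric] unfolding complex_norm_square[symmetric] by simp
  finally show ?thesis unfolding x[symmetric] by simp
qed

lemma U_d_nth:
  fixes x y z
  defines "e \<equiv> \<lambda>k. exp (\<i> * cartan_phase x y z k)"
  shows "U_d x y z $ (1,1) $ (1,1) = (e 0 + e 3) / 2" "U_d x y z $ (1,1) $ (2,2) = (e 0 - e 3) / 2"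
    "U_d x y z $ (2,2) $ (1,1) = (e 0 - e 3) / 2" "U_d x y z $ (2,2) $ (2,2) = (e 0 + e 3) / 2"
    "U_d x y z $ (1,2) $ (1,2) = (e 1 + e 2) / 2" "U_d x y z $ (1,2) $ (2,1) = (e 1 - e 2) / 2"
    "U_d x y z $ (2,1) $ (1,2) = (e 1 - e 2) / 2" "U_d x y z $ (2,1) $ (2,1) = (e 1 + e 2) / 2"
    "U_d x y z $ (1,1) $ (1,2) = 0" "U_d x y z $ (1,1) $ (2,1) = 0" "U_d x y z $ (2,2) $ (1,2) = 0" "U_d x y z $ (2,2) $ (2,1) = 0"
    "U_d x y z $ (1,2) $ (1,1) = 0" "U_d x y z $ (1,2) $ (2,2) = 0" "U_d x y z $ (2,1) $ (1,1) = 0" "U_d x y z $ (2,1) $ (2,2) = 0"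
  unfolding U_d_spectral e_def by (simp_all add: sum_four magic_nth field_simps)

lemma cmod_cis_diff: "(cmod (cis a - cis b))\<^sup>2 = 2 - 2 * cos (a - b)"
proof -
  have "(cmod (cis a - cis b))\<^sup>2 = (cos a - cos b)\<^sup>2 + (sin a - sin b)\<^sup>2" by (simp add: cmod_power2)
  also have "\<dots> = ((cos a)\<^sup>2 + (sin a)\<^sup>2) + ((cos b)\<^sup>2 + (sin b)\<^sup>2) - 2 * cos (a - b)"
    by (simp only: cos_diff) algebra
  finally show ?thesis by simp
qed

text \<open>In magic coordinates \<open>concurrence_form\<close> is half the sum of squares, so a
  Cartan gate only multiplies these squares by the doubled phases. On product inputs this is a
  quadratic form in each factor; two applications of \<open>haar_moments\<close> integrate it, and
  local unitaries drop out by invariance.\<close>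

lemma entangling_power_cartan:
  assumes "cartan_form U x y z"
  shows "entangling_power U = (3 - cos (4 * x) * cos (4 * y) - cos (4 * y) * cos (4 * z) - cos (4 * z) * cos (4 * x)) / 18"
proof -
  obtain V1 V2 V3 V4 :: one_qubit where V: "unitary V1" "unitary V2" "unitary V3" "unitary V4"
    and U: "U = kron V1 V2 ** U_d x y z ** kron V3 V4"
    using assms unfolding cartan_form_def by blast
  have uU: "unitary U" unfolding U using V by (intro unitary_mul unitary_kron unitary_U_d)
  define l where "l = cartan_phase x y z"
  define P Q K where "P = (cis (2 * l 0) - cis (2 * l 3)) / 4" and "Q = (cis (2 * l 1) - cis (2 * l 2)) / 4"
    and "K = (cis (2 * l 0) + cis (2 * l 3) - cis (2 * l 1) - cis (2 * l 2)) / 2"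
  have cis2: "cis (2 * t) = cis t * cis t" for t by (simp add: cis_mult)
  have e: "exp (\<i> * complex_of_real t) = cis t" for t by (simp add: cis_conv_exp)
  have form: "concurrence_form (U_d x y z *v tensor_vec v w)
     = qform (qform P 0 (- Q) v) (qform 0 K 0 v) (qform (- Q) 0 P v) w" for v w
    unfolding concurrence_form_def matrix_vector_nth sum_pair2 U_d_nth e tensor_vec_nth fst_conv snd_conv
      P_def Q_def K_def cis2 l_def[symmetric]
    by (simp add: field_simps power2_eq_square)
  have integrand: "1 - Re (trace (reduced_output U v w ** reduced_output U v w))
     = 1 - ((norm v)\<^sup>2)\<^sup>2 * ((norm w)\<^sup>2)\<^sup>2
       + 2 * (cmod (qform (qform P 0 (- Q) (V3 *v v)) (qform 0 K 0 (V3 *v v)) (qform (- Q) 0 P (V3 *v v)) (V4 *v w)))\<^sup>2" for v w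
  proof -
    have "norm (U *v tensor_vec v w) = norm (tensor_vec v w)"
      using unitary_mul_vec_orthogonal[OF uU] by (simp add: orthogonal_transformation)
    then have n: "((norm (U *v tensor_vec v w))\<^sup>2)\<^sup>2 = ((norm v)\<^sup>2)\<^sup>2 * ((norm w)\<^sup>2)\<^sup>2"
      by (simp only: norm_tensor_vec power_mult_distrib)
    have "U *v tensor_vec v w = kron V1 V2 *v (U_d x y z *v tensor_vec (V3 *v v) (V4 *v w))"
      unfolding U kron_tensor_vec[symmetric] by (simp only: matrix_vector_mul_assoc matrix_mul_assoc)
    then have "cmod (concurrence_form (U *v tensor_vec v w)) = cmod (concurrence_form (U_d x y z *v tensor_vec (V3 *v v) (V4 *v w)))"
      using V by (simp add: det_kron_form norm_mult cmod_det_unitary)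
    then show ?thesis unfolding linear_entropy_eq n form by simp
  qed
  have cont: "continuous_on UNIV (\<lambda>v. (cmod (qform a b c v))\<^sup>2)" for a b c by (intro continuous_intros)
  have contV: "continuous_on UNIV (\<lambda>v. (cmod (qform a b c (V *v v)))\<^sup>2)" for a b c and V :: one_qubit
    unfolding matrix_vector_nth sum_2 by (intro continuous_intros)
  have moment: "(\<integral>v. (cmod (qform a b c (V *v v)))\<^sup>2 \<partial>haar_state) = ((cmod a)\<^sup>2 + (cmod c)\<^sup>2) / 3 + (cmod b)\<^sup>2 / 6"
    if "unitary V" for a b c V
    unfolding haar_moments(1)[symmetric] by (rule haar_integral_unitary[OF cont that])
  have intn: "integrable haar_state (\<lambda>v. ((norm v)\<^sup>2)\<^sup>2)" by (intro haar_integrable continuous_intros)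
  have one: "measure haar_state UNIV = 1" using haar_state_total by (simp add: measure_def)
  have inner: "(\<integral>w. 1 - Re (trace (reduced_output U v w ** reduced_output U v w)) \<partial>haar_state)
     = 1 - ((norm v)\<^sup>2)\<^sup>2 + 2 * (((cmod (qform P 0 (- Q) (V3 *v v)))\<^sup>2 + (cmod (qform (- Q) 0 P (V3 *v v)))\<^sup>2) / 3
          + (cmod (qform 0 K 0 (V3 *v v)))\<^sup>2 / 6)" for v
  proof -
    have "(\<integral>w. 1 - N * ((norm w)\<^sup>2)\<^sup>2 + 2 * f w \<partial>haar_state) = 1 - N + 2 * I"
      if "integrable haar_state f" "(\<integral>w. f w \<partial>haar_state) = I" for f :: "complex ^ 2 \<Rightarrow> real" and N I
      using that by (simp add: intn[simplified] one haar_moments(2)[simplified])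
    from this[OF haar_integrable[OF contV] moment[OF V(4)]] show ?thesis unfolding integrand .
  qed
  have "entangling_power U = 1 - 1 + 2 * ((((cmod P)\<^sup>2 + (cmod (- Q))\<^sup>2) / 3 + (cmod 0)\<^sup>2 / 6
      + (((cmod (- Q))\<^sup>2 + (cmod P)\<^sup>2) / 3 + (cmod 0)\<^sup>2 / 6)) / 3
      + (((cmod 0)\<^sup>2 + (cmod 0)\<^sup>2) / 3 + (cmod K)\<^sup>2 / 6) / 6)"
  proof -
    have "(\<integral>v. 1 - ((norm v)\<^sup>2)\<^sup>2 + 2 * ((f v + g v) / 3 + k v / 6) \<partial>haar_state) = 1 - 1 + 2 * ((F + G) / 3 + H / 6)"
      if "integrable haar_state f" "(\<integral>w. f w \<partial>haar_state) = F" "integrable haar_state g" "(\<integral>w. g w \<partial>haar_state) = G"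
        "integrable haar_state k" "(\<integral>w. k w \<partial>haar_state) = H" for f g k :: "complex ^ 2 \<Rightarrow> real" and F G H
      using that by (simp add: intn[simplified] one haar_moments(2)[simplified])
    note gen = this
    show ?thesis
      unfolding entangling_power_def inner
      by (rule gen[OF haar_integrable[OF contV] moment[OF V(3)] haar_integrable[OF contV] moment[OF V(3)]
          haar_integrable[OF contV] moment[OF V(3)]])
  qed
  also have "\<dots> = (3 - cos (4 * x) * cos (4 * y) - cos (4 * y) * cos (4 * z) - cos (4 * z) * cos (4 * x)) / 18"
  proof -
    have PP: "(cmod P)\<^sup>2 = (2 - 2 * cos (2 * l 0 - 2 * l 3)) / 16" "(cmod Q)\<^sup>2 = (2 - 2 * cos (2 * l 1 - 2 * l 2)) / 16"
      unfolding P_def Q_def norm_divide power_divide cmod_cis_diff by simp_all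
    have neg: "- cis a = cis (a + pi)" for a by (simp add: complex_eq_iff)
    have sg: "cos (a - (b + pi)) = - cos (a - b)" "cos (a + pi - b) = - cos (a - b)" for a b :: real
      by (simp_all add: cos_diff cos_add)
    have Keq: "K = (cis (2 * l 0) + cis (2 * l 3) + cis (2 * l 1 + pi) + cis (2 * l 2 + pi)) / 2"
      unfolding K_def neg[symmetric] by simp
    have KK: "(cmod K)\<^sup>2 = (4 + 2 * (cos (2 * l 0 - 2 * l 3) + cos (2 * l 1 - 2 * l 2)
       - cos (2 * l 0 - 2 * l 1) - cos (2 * l 3 - 2 * l 2) - cos (2 * l 0 - 2 * l 2) - cos (2 * l 3 - 2 * l 1))) / 4"
      unfolding Keq norm_divide power_divide cmod_sq_sum4_cis sg by simp
    have ang: "2 * l 0 - 2 * l 3 = 4 * x - 4 * y" "2 * l 1 - 2 * l 2 = 4 * x + 4 * y"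
      "2 * l 0 - 2 * l 1 = - (4 * y - 4 * z)" "2 * l 3 - 2 * l 2 = 4 * y + 4 * z"
      "2 * l 0 - 2 * l 2 = 4 * x + 4 * z" "2 * l 3 - 2 * l 1 = - (4 * x - 4 * z)"
      unfolding l_def by simp_all
    show ?thesis unfolding norm_minus_cancel PP KK ang cos_minus by (simp add: cos_add cos_diff field_simps)
  qed
  finally show ?thesis .
qed

subsection \<open>Local invariants\<close>

text \<open>Rows collect the indices of qubit A and columns those of qubit B, so the singular values
  are the operator-Schmidt coefficients and local gates act by unitaries on either side.\<close>

definition realign :: "two_qubit \<Rightarrow> two_qubit" where
  "realign U = (\<chi> p q. U $ (fst p, fst q) $ (snd p, snd q))"

lemma realign_nth [simp]: "realign U $ p $ q = U $ (fst p, fst q) $ (snd p, snd q)"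
  by (simp add: realign_def)

lemma transpose_nth [simp]: "transpose A $ i $ j = A $ j $ i"
  by (simp add: transpose_def)

lemma unitary_transpose: "unitary A \<Longrightarrow> unitary (transpose A)"
proof -
  assume A: "unitary A"
  have t: "dagger (transpose A) = transpose (dagger A)" by (simp add: vec_eq_iff)
  have tr: "transpose A ** transpose B = transpose (B ** A)" for A B :: "complex ^ 'n ^ 'n"
    by (simp add: vec_eq_iff matrix_mul_nth mult.commute)
  show ?thesis using A unfolding unitary_def t tr by (simp add: transpose_mat)
qed

lemma realign_local:
  "realign (kron V1 V2 ** U ** kron V3 V4) = kron V1 (transpose V3) ** realign U ** transpose (kron V2 (transpose V4))"
proof -
  have "realign (kron V1 V2 ** U ** kron V3 V4) $ (i, k) $ (j, l)
    = (kron V1 (transpose V3) ** realign U ** transpose (kron V2 (transpose V4))) $ (i, k) $ (j, l)" for i j k l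
    by (simp add: matrix_mul_nth sum_pair2) (simp add: algebra_simps)
  then show ?thesis by (simp add: vec_eq_iff split_paired_All)
qed

definition realign_gram :: "two_qubit \<Rightarrow> two_qubit" where
  "realign_gram U = realign U ** dagger (realign U)"

lemma trace_unitary_conj:
  assumes "unitary X"
  shows "trace (X ** N ** dagger X) = trace N"
proof -
  have "trace (X ** N ** dagger X) = trace (dagger X ** (X ** N))" by (rule trace_mul_sym)
  also have "\<dots> = trace N" using assms by (simp add: matrix_mul_assoc unitary_def)
  finally show ?thesis .
qed

lemma unitary_conj_mul:
  assumes "unitary X"
  shows "(X ** M ** dagger X) ** (X ** N ** dagger X) = X ** (M ** N) ** dagger X"
proof -
  have "(X ** M ** dagger X) ** (X ** N ** dagger X) = X ** M ** (dagger X ** X) ** N ** dagger X"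
    by (simp only: matrix_mul_assoc)
  also have "dagger X ** X = mat 1" using assms by (simp add: unitary_def)
  finally show ?thesis by (simp add: matrix_mul_assoc)
qed

lemma realign_gram_local:
  assumes "unitary V1" "unitary V2" "unitary V3" "unitary V4"
  obtains X where "unitary X" "realign_gram (kron V1 V2 ** U ** kron V3 V4) = X ** realign_gram U ** dagger X"
proof
  define X Y where "X = kron V1 (transpose V3)" and "Y = transpose (kron V2 (transpose V4))"
  show "unitary (kron V1 (transpose V3))" using assms by (intro unitary_kron unitary_transpose)
  have "unitary Y" unfolding Y_def using assms by (intro unitary_kron unitary_transpose)
  then have "Y ** dagger Y = mat 1" by (simp add: unitary_def)
  have "realign_gram (kron V1 V2 ** U ** kron V3 V4) = X ** realign U ** Y ** (dagger Y ** (dagger (realign U) ** dagger X))"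
    unfolding realign_gram_def realign_local X_def[symmetric] Y_def[symmetric] dagger_mul ..
  also have "\<dots> = X ** realign U ** (Y ** dagger Y) ** dagger (realign U) ** dagger X"
    by (simp only: matrix_mul_assoc)
  also have "\<dots> = X ** realign_gram U ** dagger X"
    unfolding \<open>Y ** dagger Y = mat 1\<close> realign_gram_def by (simp add: matrix_mul_assoc)
  finally show "realign_gram (kron V1 V2 ** U ** kron V3 V4)
     = kron V1 (transpose V3) ** realign_gram U ** dagger (kron V1 (transpose V3))" unfolding X_def .
qed

lemma pauli_orth: "(\<Sum>r\<in>UNIV. pauli k $ fst r $ snd r * cnj (pauli l $ fst r $ snd r)) = (if k = l then 2 else 0)"
proof -
  have "\<forall>k l. (\<Sum>r\<in>UNIV. pauli k $ fst r $ snd r * cnj (pauli l $ fst r $ snd r)) = (if k = l then 2 else 0)"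
    unfolding forall_four by (simp add: sum_pair2)
  then show ?thesis by blast
qed

lemma rank_one_proj_magic_pauli:
  "rank_one_proj (magic k) $ p $ q = pauli k $ fst p $ snd p * cnj (pauli k $ fst q $ snd q) / 2"
  by (simp add: magic_def)

text \<open>The realigned gate is a sum of rank-one terms in the vectorised Pauli matrices, which
  are magic vectors up to phase. Their squared norm 2 enters once from the inner product and once
  from normalising the projection, hence the factor 4.\<close>

lemma realign_gram_U_d:
  "realign_gram (U_d x y z) = magic_diag (\<lambda>k. of_real (4 * schmidt_prob x y z k))"
proof -
  define u where "u = pauli_coeff x y z"
  define s where "s k r = pauli k $ fst r $ snd r" for k and r :: "2 \<times> 2"
  have R: "realign (U_d x y z) $ p $ r = (\<Sum>k\<in>UNIV. u k * s k p * s k r)" for p r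
    unfolding U_d_pauli u_def s_def by (simp add: mult_ac)
  have orth: "(\<Sum>r\<in>UNIV. s k r * cnj (s l r)) = (if k = l then 2 else 0)" for k l
    unfolding s_def by (rule pauli_orth)
  have "realign_gram (U_d x y z) $ p $ q
     = (magic_diag (\<lambda>k. of_real (4 * schmidt_prob x y z k))) $ p $ q" for p q
  proof -
    have "realign_gram (U_d x y z) $ p $ q
       = (\<Sum>r\<in>UNIV. \<Sum>k\<in>UNIV. \<Sum>l\<in>UNIV. (u k * s k p * s k r) * cnj (u l * s l q * s l r))"
      unfolding realign_gram_def matrix_mul_nth dagger_nth R cnj_sum sum_product ..
    also have "\<dots> = (\<Sum>k\<in>UNIV. \<Sum>l\<in>UNIV. \<Sum>r\<in>UNIV. (u k * s k p * s k r) * cnj (u l * s l q * s l r))"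
      by (rule trans[OF sum.swap]) (rule sum.cong[OF refl], rule sum.swap)
    also have "\<dots> = (\<Sum>k\<in>UNIV. \<Sum>l\<in>UNIV. u k * cnj (u l) * s k p * cnj (s l q) * (\<Sum>r\<in>UNIV. s k r * cnj (s l r)))"
      by (intro sum.cong refl) (simp add: sum_distrib_left mult_ac)
    also have "\<dots> = (\<Sum>k\<in>UNIV. \<Sum>l\<in>UNIV. if k = l then 2 * (u k * cnj (u k)) * s k p * cnj (s k q) else 0)"
      unfolding orth by (intro sum.cong refl) auto
    also have "\<dots> = (\<Sum>k\<in>UNIV. 2 * (u k * cnj (u k)) * s k p * cnj (s k q))" by simp
    also have "\<dots> = (magic_diag (\<lambda>k. of_real (4 * schmidt_prob x y z k))) $ p $ q"
      unfolding complex_norm_square[symmetric]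
      by (simp add: rank_one_proj_magic_pauli schmidt_prob_def pauli_coeffs_nth u_def s_def mult_ac del: rank_one_proj_nth)
    finally show ?thesis .
  qed
  then show ?thesis unfolding vec_eq_iff by blast
qed

lemma trace_magic_diagonal: "trace (magic_diag c) = (\<Sum>k\<in>UNIV. c k)"
proof -
  have "trace (magic_diag c)
     = (\<Sum>p\<in>UNIV. \<Sum>k\<in>UNIV. c k * (cnj (magic k $ p) * magic k $ p))"
    by (simp add: trace_def mult_ac)
  also have "\<dots> = (\<Sum>k\<in>UNIV. c k * (\<Sum>p\<in>UNIV. cnj (magic k $ p) * magic k $ p))"
    by (rule trans[OF sum.swap]) (simp add: sum_distrib_left)
  finally show ?thesis by (simp add: magic_orth)
qed

lemma schmidt_power_sums:
  assumes "cartan_form U x y z"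
  shows "trace (realign_gram U ** realign_gram U) = of_real (16 * (\<Sum>k\<in>UNIV. schmidt_prob x y z k ^ 2))" (is ?A)
    "trace (realign_gram U ** (realign_gram U ** realign_gram U)) = of_real (64 * (\<Sum>k\<in>UNIV. schmidt_prob x y z k ^ 3))" (is ?B)
proof -
  obtain V1 V2 V3 V4 :: one_qubit where V: "unitary V1" "unitary V2" "unitary V3" "unitary V4"
    and U: "U = kron V1 V2 ** U_d x y z ** kron V3 V4"
    using assms unfolding cartan_form_def by blast
  obtain X where X: "unitary X" "realign_gram U = X ** realign_gram (U_d x y z) ** dagger X"
    unfolding U using V by (rule realign_gram_local)
  show ?A
    unfolding X(2) unitary_conj_mul[OF X(1)] trace_unitary_conj[OF X(1)]
    unfolding realign_gram_U_d magic_diagonal_mul trace_magic_diagonal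
    by (simp add: sum_distrib_left power2_eq_square)
  show ?B
    unfolding X(2) unitary_conj_mul[OF X(1)] trace_unitary_conj[OF X(1)]
    unfolding realign_gram_U_d magic_diagonal_mul trace_magic_diagonal
    by (simp add: sum_distrib_left power3_eq_cube mult_ac)
qed

text \<open>The monic cubics coincide, so the smallest root of each is a root of the other and they
  agree; the remaining quadratics are compared in the same way.\<close>

lemma sorted_triple_unique:
  fixes a b c :: real
  assumes s: "a \<le> b" "b \<le> c" and s': "a' \<le> b'" "b' \<le> c'"
    and e: "a + b + c = a' + b' + c'" "a * b + b * c + c * a = a' * b' + b' * c' + c' * a'" "a * b * c = a' * b' * c'"
  shows "a = a' \<and> b = b' \<and> c = c'"
proof -
  have cubic: "(t - a) * (t - b) * (t - c) = (t - a') * (t - b') * (t - c')" for t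
  proof -
    have "(t - p) * (t - q) * (t - r) = t^3 - (p + q + r) * t\<^sup>2 + (p * q + q * r + r * p) * t - p * q * r" for p q r
      by (simp add: poly_simps)
    then show ?thesis using e by simp
  qed
  have "a = a'" using cubic[of a] cubic[of a'] s s' by auto
  moreover have quad: "(t - b) * (t - c) = (t - b') * (t - c')" for t
  proof -
    have "a * (b + c) + b * c = a * (b' + c') + b' * c'" using e(2) \<open>a = a'\<close> by (simp add: algebra_simps)
    moreover have "b + c = b' + c'" using e(1) \<open>a = a'\<close> by simp
    ultimately have "b * c = b' * c'" by simp
    moreover have "(t - p) * (t - q) = t * t - (p + q) * t + p * q" for p q by (simp add: algebra_simps)
    ultimately show ?thesis using \<open>b + c = b' + c'\<close> by simp
  qed
  have "b = b'" using quad[of b] quad[of b'] s s' by auto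
  ultimately show ?thesis using e(1) by simp
qed

lemma cartan_cos_sorted:
  assumes "cartan_form U x y z"
  shows "0 \<le> cos (2 * x)" (is ?A) "cos (2 * x) \<le> cos (2 * y)" (is ?B) "cos (2 * y) \<le> cos (2 * z)" (is ?C) "cos (2 * z) \<le> 1"
proof -
  have o: "\<bar>z\<bar> \<le> y" "y \<le> x" "x \<le> pi / 4" using assms by (auto simp: cartan_form_def)
  show ?A using o by (intro cos_ge_zero) auto
  show ?B using o by (intro cos_monotone_0_pi_le) auto
  have "cos (2 * y) \<le> cos (2 * \<bar>z\<bar>)" using o pi_gt_zero by (intro cos_monotone_0_pi_le) auto
  also have "cos (2 * \<bar>z\<bar>) = cos (2 * z)" by (cases "0 \<le> z") auto
  finally show ?C .
qed simp

text \<open>Second and third power sums of the Schmidt probabilities together with \<open>e\<^sub>p\<close> give the three elementary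
  symmetric functions of \<open>cos\<^sup>2 2\<theta>\<^sub>j\<close>; this is needed because the probabilities alone do not
  determine \<open>g\<^sub>t\<close> when they are all equal.\<close>

lemma cartan_cos_unique:
  assumes U: "cartan_form U x y z" and U': "cartan_form U x' y' z'"
  shows "cos (2 * x) = cos (2 * x')" "cos (2 * y) = cos (2 * y')" "cos (2 * z) = cos (2 * z')"
proof -
  define a b c a' b' c' where "a = cos (2 * x)" and "b = cos (2 * y)" and "c = cos (2 * z)"
    and "a' = cos (2 * x')" and "b' = cos (2 * y')" and "c' = cos (2 * z')"
  note defs = a_def b_def c_def a'_def b'_def c'_def
  have o: "0 \<le> a" "a \<le> b" "b \<le> c" "0 \<le> a'" "a' \<le> b'" "b' \<le> c'"
    unfolding defs using cartan_cos_sorted[OF U] cartan_cos_sorted[OF U'] by auto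
  have s2: "(\<Sum>k\<in>UNIV. schmidt_prob x y z k ^ 2) = (1 + (b * c)\<^sup>2 + (a * c)\<^sup>2 + (a * b)\<^sup>2) / 4"
    "(\<Sum>k\<in>UNIV. schmidt_prob x' y' z' k ^ 2) = (1 + (b' * c')\<^sup>2 + (a' * c')\<^sup>2 + (a' * b')\<^sup>2) / 4"
    unfolding sum_four schmidt_prob_eq defs[symmetric] by (simp_all add: power2_eq_square field_simps)
  have s3: "(\<Sum>k\<in>UNIV. schmidt_prob x y z k ^ 3) = (1 + 3 * ((b * c)\<^sup>2 + (a * c)\<^sup>2 + (a * b)\<^sup>2) + 6 * (a\<^sup>2 * b\<^sup>2 * c\<^sup>2)) / 16"
    "(\<Sum>k\<in>UNIV. schmidt_prob x' y' z' k ^ 3) = (1 + 3 * ((b' * c')\<^sup>2 + (a' * c')\<^sup>2 + (a' * b')\<^sup>2) + 6 * (a'\<^sup>2 * b'\<^sup>2 * c'\<^sup>2)) / 16"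
    unfolding sum_four schmidt_prob_eq defs[symmetric] by (simp_all add: power2_eq_square power3_eq_cube field_simps)
  have "(\<Sum>k\<in>UNIV. schmidt_prob x y z k ^ 2) = (\<Sum>k\<in>UNIV. schmidt_prob x' y' z' k ^ 2)"
    using schmidt_power_sums(1)[OF U] schmidt_power_sums(1)[OF U'] by (simp only: of_real_eq_iff)
  then have e2: "(b * c)\<^sup>2 + (a * c)\<^sup>2 + (a * b)\<^sup>2 = (b' * c')\<^sup>2 + (a' * c')\<^sup>2 + (a' * b')\<^sup>2"
    unfolding s2 by simp
  have "(\<Sum>k\<in>UNIV. schmidt_prob x y z k ^ 3) = (\<Sum>k\<in>UNIV. schmidt_prob x' y' z' k ^ 3)"
    using schmidt_power_sums(2)[OF U] schmidt_power_sums(2)[OF U'] by (simp only: of_real_eq_iff)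
  then have e3: "a\<^sup>2 * b\<^sup>2 * c\<^sup>2 = a'\<^sup>2 * b'\<^sup>2 * c'\<^sup>2"
    unfolding s3 e2 by simp
  have c4: "cos (4 * t) = 2 * (cos (2 * t))\<^sup>2 - 1" for t :: real
    using cos_double_cos[of "2 * t"] by simp
  have "18 * entangling_power U = 4 * (a\<^sup>2 + b\<^sup>2 + c\<^sup>2) - 4 * ((b * c)\<^sup>2 + (a * c)\<^sup>2 + (a * b)\<^sup>2)"
    unfolding entangling_power_cartan[OF U] c4 defs[symmetric] by (simp add: power2_eq_square field_simps)
  moreover have "18 * entangling_power U = 4 * (a'\<^sup>2 + b'\<^sup>2 + c'\<^sup>2) - 4 * ((b' * c')\<^sup>2 + (a' * c')\<^sup>2 + (a' * b')\<^sup>2)"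
    unfolding entangling_power_cartan[OF U'] c4 defs[symmetric] by (simp add: power2_eq_square field_simps)
  ultimately have e1: "a\<^sup>2 + b\<^sup>2 + c\<^sup>2 = a'\<^sup>2 + b'\<^sup>2 + c'\<^sup>2" using e2 by argo
  have "a\<^sup>2 = a'\<^sup>2 \<and> b\<^sup>2 = b'\<^sup>2 \<and> c\<^sup>2 = c'\<^sup>2"
    using o e1 e2 e3 by (intro sorted_triple_unique power_mono) (auto simp: power_mult_distrib mult.commute)
  then show "cos (2 * x) = cos (2 * x')" "cos (2 * y) = cos (2 * y')" "cos (2 * z) = cos (2 * z')"
    unfolding defs[symmetric] using o by (auto simp: power2_eq_iff_nonneg)
qed

lemma quasi_extent_cartan:
  assumes "cartan_form U x y z"
  shows "quasi_extent U = 2 * (sum_sqrt (cos (2 * x)) (cos (2 * y)) (cos (2 * z)))\<^sup>2 - 1"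
  unfolding quasi_extent_def
proof (rule the_equality)
  show "\<exists>\<theta>1 \<theta>2 \<theta>3. cartan_form U \<theta>1 \<theta>2 \<theta>3 \<and> 2 * (sum_sqrt (cos (2 * x)) (cos (2 * y)) (cos (2 * z)))\<^sup>2 - 1
      = 2 * (\<Sum>j\<in>UNIV. sqrt (schmidt_prob \<theta>1 \<theta>2 \<theta>3 j))\<^sup>2 - 1"
    using assms sum_sqrt_schmidt by metis
qed (use cartan_cos_unique[OF assms] in \<open>auto simp: sum_sqrt_schmidt\<close>)

lemma sin_sq_eq: "(sin (2 * t))\<^sup>2 = 1 - (cos (2 * t))\<^sup>2" for t :: real
  by (simp add: sin_squared_eq)

lemma gate_typicality_cartan:
  assumes "cartan_form U x y z"
  shows "gate_typicality U = (3 - (cos (2 * x))\<^sup>2 - (cos (2 * y))\<^sup>2 - (cos (2 * z))\<^sup>2) / 3"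
  unfolding gate_typicality_def
proof (rule the_equality)
  show "\<exists>\<theta>1 \<theta>2 \<theta>3. cartan_form U \<theta>1 \<theta>2 \<theta>3 \<and> (3 - (cos (2 * x))\<^sup>2 - (cos (2 * y))\<^sup>2 - (cos (2 * z))\<^sup>2) / 3
     = ((sin (2 * \<theta>1))\<^sup>2 + (sin (2 * \<theta>2))\<^sup>2 + (sin (2 * \<theta>3))\<^sup>2) / 3"
    using assms by (intro exI[of _ x] exI[of _ y] exI[of _ z]) (simp add: sin_sq_eq)
qed (use cartan_cos_unique[OF assms] in \<open>auto simp: sin_sq_eq\<close>)

subsection \<open>Simultaneous diagonalisation\<close>

text \<open>The first-order condition at a maximum of the Rayleigh quotient.\<close>

lemma nonneg_quadratic_linear_zero:
  fixes c q :: real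
  assumes "\<And>t. 0 \<le> 2 * t * c + t\<^sup>2 * q"
  shows "c = 0"
proof (rule ccontr)
  assume "c \<noteq> 0"
  have q: "0 \<le> q" using assms[of 1] assms[of "-1"] by simp
  define t where "t = - c / (q + 1)"
  have "(q + 1) * t = - c" unfolding t_def using q by simp
  then have ct: "c = - ((q + 1) * t)" by simp
  have "2 * t * c + t\<^sup>2 * q = - (t\<^sup>2 * (q + 2))" unfolding ct by (simp add: poly_simps)
  moreover have "t \<noteq> 0" unfolding t_def using q \<open>c \<noteq> 0\<close> by simp
  then have "0 < t\<^sup>2 * (q + 2)" using q by simp
  ultimately show False using assms[of t] by linarith
qed

lemma self_adjoint_eigenvector:
  fixes f :: "'a::euclidean_space \<Rightarrow> 'a"
  assumes lin: "linear f" and sa: "\<And>x y. f x \<bullet> y = x \<bullet> f y"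
    and S: "subspace S" "\<And>x. x \<in> S \<Longrightarrow> f x \<in> S" and ne: "\<exists>x\<in>S. x \<noteq> 0"
  obtains x l where "x \<in> S" "norm x = 1" "f x = l *\<^sub>R x"
proof -
  have cont: "continuous_on T f" for T
    using lin by (intro linear_continuous_on) (simp add: linear_conv_bounded_linear)
  have "compact (sphere 0 1 \<inter> S)" using closed_subspace[OF S(1)] by (intro compact_Int_closed) auto
  moreover obtain x0 where x0: "x0 \<in> S" "x0 \<noteq> 0" using ne by blast
  then have "x0 /\<^sub>R norm x0 \<in> sphere 0 1 \<inter> S" using S(1) by (auto simp: subspace_scale)
  then have "sphere 0 1 \<inter> S \<noteq> {}" by blast
  moreover have "continuous_on (sphere 0 1 \<inter> S) (\<lambda>x. x \<bullet> f x)" by (intro continuous_intros cont)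
  ultimately obtain x where x: "x \<in> sphere 0 1 \<inter> S" and max: "\<And>y. y \<in> sphere 0 1 \<inter> S \<Longrightarrow> y \<bullet> f y \<le> x \<bullet> f x"
    using continuous_attains_sup by metis
  define l where "l = x \<bullet> f x"
  have xS: "x \<in> S" and x1: "x \<bullet> x = 1" "norm x = 1" using x by (auto simp: dot_square_norm)
  have q: "0 \<le> l * (y \<bullet> y) - y \<bullet> f y" if "y \<in> S" for y
  proof (cases "y = 0")
    case True
    then show ?thesis using lin by (simp add: linear_0)
  next
    case False
    define u where "u = y /\<^sub>R norm y"
    have y: "y = norm y *\<^sub>R u" unfolding u_def using False by simp
    have "u \<in> sphere 0 1 \<inter> S" unfolding u_def using False that S(1) by (auto simp: subspace_scale)
    from max[OF this] have "u \<bullet> f u \<le> l" unfolding l_def .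
    moreover have "y \<bullet> f y = (norm y)\<^sup>2 * (u \<bullet> f u)"
      by (subst (1 2) y) (simp add: linear_scale[OF lin] power2_eq_square)
    ultimately show ?thesis
      using mult_left_mono[of "u \<bullet> f u" l "(norm y)\<^sup>2"] by (simp add: dot_square_norm mult.commute)
  qed
  \<comment> \<open>z is the residual of the eigenvalue equation at the maximiser of x . f x on the
    unit sphere of S. It lies in S and is orthogonal to all of S, hence to itself.\<close>
  define z where "z = l *\<^sub>R x - f x"
  have "z \<in> S" unfolding z_def using S xS by (simp add: subspace_diff subspace_scale)
  have "z \<bullet> y = 0" if y: "y \<in> S" for y
  proof (rule nonneg_quadratic_linear_zero)
    fix t :: real
    have "x + t *\<^sub>R y \<in> S" using S xS y by (simp add: subspace_add subspace_scale)
    from q[OF this] have "0 \<le> l * ((x + t *\<^sub>R y) \<bullet> (x + t *\<^sub>R y)) - (x + t *\<^sub>R y) \<bullet> f (x + t *\<^sub>R y)" .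
    also have "\<dots> = 2 * t * (z \<bullet> y) + t\<^sup>2 * (l * (y \<bullet> y) - y \<bullet> f y)"
    proof -
      have f: "f (x + t *\<^sub>R y) = f x + t *\<^sub>R f y" using lin by (simp add: linear_add linear_scale)
      have c: "y \<bullet> f x = f x \<bullet> y" "x \<bullet> f y = f x \<bullet> y" "y \<bullet> x = x \<bullet> y" using sa by (auto simp: inner_commute)
      show ?thesis unfolding f z_def
        by (simp add: inner_add_left inner_add_right inner_diff_left c x1 l_def[symmetric] poly_simps)
    qed
    finally show "0 \<le> 2 * t * (z \<bullet> y) + t\<^sup>2 * (l * (y \<bullet> y) - y \<bullet> f y)" .
  qed
  from this[OF \<open>z \<in> S\<close>] have "f x = l *\<^sub>R x" unfolding z_def by simp
  then show ?thesis using that xS x1 by blast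
qed

context
  fixes f g :: "'a::euclidean_space \<Rightarrow> 'a"
  assumes f: "linear f" "\<And>x y. f x \<bullet> y = x \<bullet> f y" and g: "linear g" "\<And>x y. g x \<bullet> y = x \<bullet> g y"
    and comm: "\<And>x. f (g x) = g (f x)"
begin

text \<open>An eigenspace of f inside S is invariant under g, so g has an eigenvector there.\<close>

lemma commuting_eigenvector:
  assumes S: "subspace S" "\<And>x. x \<in> S \<Longrightarrow> f x \<in> S" "\<And>x. x \<in> S \<Longrightarrow> g x \<in> S" and ne: "\<exists>x\<in>S. x \<noteq> 0"
  obtains x l m where "x \<in> S" "norm x = 1" "f x = l *\<^sub>R x" "g x = m *\<^sub>R x"
proof -
  obtain x0 l where x0: "x0 \<in> S" "norm x0 = 1" "f x0 = l *\<^sub>R x0"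
    using self_adjoint_eigenvector[OF f S(1,2) ne] by blast
  define E where "E = {x \<in> S. f x = l *\<^sub>R x}"
  have "subspace E" unfolding E_def subspace_def
    using S(1) f(1) by (auto simp: subspace_0 linear_0 subspace_add linear_add subspace_scale linear_scale scaleR_right_distrib)
  moreover have "g x \<in> E" if "x \<in> E" for x
    using that S(3) comm g(1) unfolding E_def by (auto simp: linear_scale)
  moreover have "\<exists>x\<in>E. x \<noteq> 0" using x0 unfolding E_def by force
  ultimately obtain x m where "x \<in> E" "norm x = 1" "g x = m *\<^sub>R x"
    using self_adjoint_eigenvector[OF g] by blast
  then show ?thesis using that unfolding E_def by blast
qed

text \<open>The orthogonal complement of joint eigenvectors is invariant under both self-adjoint
  maps, and it is nonzero by dimension.\<close>

lemma commuting_eigenvector_orthogonal: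
  assumes B: "finite B" "card B < DIM('a)" "\<And>b. b \<in> B \<Longrightarrow> (\<exists>l. f b = l *\<^sub>R b) \<and> (\<exists>m. g b = m *\<^sub>R b)"
  obtains x where "norm x = 1" "(\<exists>l. f x = l *\<^sub>R x) \<and> (\<exists>m. g x = m *\<^sub>R x)" "\<And>b. b \<in> B \<Longrightarrow> x \<bullet> b = 0"
proof -
  define S where "S = {x. \<forall>b\<in>B. x \<bullet> b = 0}"
  have sub: "subspace S" unfolding S_def subspace_def by (auto simp: inner_add_left)
  have inv: "h x \<in> S" if "x \<in> S" "\<And>x y. h x \<bullet> y = x \<bullet> h y" "\<And>b. b \<in> B \<Longrightarrow> \<exists>l. h b = l *\<^sub>R b" for h x
    using that unfolding S_def by (auto, metis inner_scaleR_right mult_zero_right)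
  have "dim B < DIM('a)" using B by (meson dim_le_card' le_less_trans)
  then obtain y where y: "y \<noteq> 0" "\<And>b. b \<in> span B \<Longrightarrow> orthogonal y b"
    using orthogonal_to_subspace_exists by blast
  then have "y \<in> S" unfolding S_def by (auto simp: orthogonal_def span_base)
  then have "\<exists>x\<in>S. x \<noteq> 0" using y(1) by blast
  then obtain x l m where "x \<in> S" "norm x = 1" "f x = l *\<^sub>R x" "g x = m *\<^sub>R x"
    using commuting_eigenvector[OF sub inv[OF _ f(2)] inv[OF _ g(2)]] B(3) by blast
  then show ?thesis using that unfolding S_def by blast
qed

end

lemma commuting_eigenbasis_4:
  fixes f g :: "real ^ 4 \<Rightarrow> real ^ 4"
  assumes f: "linear f" "\<And>x y. f x \<bullet> y = x \<bullet> f y" and g: "linear g" "\<And>x y. g x \<bullet> y = x \<bullet> g y"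
    and comm: "\<And>x. f (g x) = g (f x)"
  obtains X :: "4 \<Rightarrow> real ^ 4" and l m where "\<And>j k. X j \<bullet> X k = (if j = k then 1 else 0)"
    "\<And>k. f (X k) = l k *\<^sub>R X k" "\<And>k. g (X k) = m k *\<^sub>R X k"
proof -
  let ?e = "\<lambda>x. (\<exists>l. f x = l *\<^sub>R x) \<and> (\<exists>m. g x = m *\<^sub>R x)"
  have step: "\<exists>x. norm x = 1 \<and> ?e x \<and> (\<forall>b\<in>set bs. x \<bullet> b = 0)" if "length bs < 4" "\<forall>b\<in>set bs. ?e b" for bs
  proof -
    have "card (set bs) < DIM(real ^ 4)" using that(1) card_length[of bs] by simp
    then show ?thesis using commuting_eigenvector_orthogonal[OF f g comm, of "set bs"] that(2) by (metis List.finite_set)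
  qed
  obtain x0 where x0: "norm x0 = 1" "?e x0" using step[of "[]"] by auto
  obtain x1 where x1: "norm x1 = 1" "?e x1" "x1 \<bullet> x0 = 0" using step[of "[x0]"] x0 by auto
  obtain x2 where x2: "norm x2 = 1" "?e x2" "x2 \<bullet> x0 = 0" "x2 \<bullet> x1 = 0" using step[of "[x0, x1]"] x0 x1 by auto
  obtain x3 where x3: "norm x3 = 1" "?e x3" "x3 \<bullet> x0 = 0" "x3 \<bullet> x1 = 0" "x3 \<bullet> x2 = 0"
    using step[of "[x0, x1, x2]"] x0 x1 x2 by auto
  define X where "X k = (if k = 0 then x0 else if k = 1 then x1 else if k = 2 then x2 else x3)" for k :: 4
  have X: "X 0 = x0" "X 1 = x1" "X 2 = x2" "X 3 = x3" unfolding X_def by simp_all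
  have "\<forall>j k. X j \<bullet> X k = (if j = k then 1 else 0)"
    unfolding forall_four using x0 x1 x2 x3 by (simp add: X dot_square_norm inner_commute)
  moreover have "\<forall>k. ?e (X k)" unfolding forall_four X using x0 x1 x2 x3 by blast
  ultimately show ?thesis using that by metis
qed

definition cvec :: "real ^ 'n \<Rightarrow> complex ^ 'n" where
  "cvec x = (\<chi> i. complex_of_real (x $ i))"

lemma cvec_nth [simp]: "cvec x $ i = complex_of_real (x $ i)"
  by (simp add: cvec_def)

text \<open>If \<open>M\<close> is unitary, the symmetric unitary matrix \<open>M\<^sup>T M\<close> has commuting real and imaginary
  parts, hence a real eigenbasis \<open>X\<close>; dividing \<open>M X\<^sub>k\<close> by a square root of its eigenvalue makes it
  real.\<close>

lemma unitary_real_frames: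
  fixes M :: "complex ^ 4 ^ 4"
  assumes M: "unitary M"
  obtains X Y :: "4 \<Rightarrow> real ^ 4" and c where
    "\<And>j k. X j \<bullet> X k = (if j = k then 1 else 0)" "\<And>j k. Y j \<bullet> Y k = (if j = k then 1 else 0)"
    "\<And>k. cmod (c k) = 1" "\<And>k. M *v cvec (X k) = c k *s cvec (Y k)"
proof -
  define m where "m = transpose M ** M"
  define A B :: "real ^ 4 ^ 4" where "A = (\<chi> i j. Re (m $ i $ j))" and "B = (\<chi> i j. Im (m $ i $ j))"
  define cM where "cM = dagger (transpose M)"
  have uT: "unitary (transpose M)" using M by (rule unitary_transpose)
  have cMT: "cM ** transpose M = mat 1" using uT unfolding cM_def unitary_def by simp
  have cM: "cM ** m = M" unfolding m_def by (simp add: matrix_mul_assoc cMT)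
  have um: "unitary m" unfolding m_def by (intro unitary_mul uT M)
  have sym: "m $ i $ j = m $ j $ i" for i j unfolding m_def by (simp add: matrix_mul_nth mult.commute)
  have symA: "A $ i $ j = A $ j $ i" and symB: "B $ i $ j = B $ j $ i" for i j
    unfolding A_def B_def by (simp_all add: sym[of i j])
  have sa: "(N *v x) \<bullet> y = x \<bullet> (N *v y)" if "\<And>i j. N $ i $ j = N $ j $ i" for N :: "real ^ 4 ^ 4" and x y
  proof -
    have "(N *v x) \<bullet> y = (\<Sum>i\<in>UNIV. \<Sum>j\<in>UNIV. N $ i $ j * x $ j * y $ i)"
      by (simp add: inner_vec_def matrix_vector_nth sum_distrib_right)
    also have "\<dots> = (\<Sum>j\<in>UNIV. \<Sum>i\<in>UNIV. N $ i $ j * x $ j * y $ i)" by (rule sum.swap)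
    also have "\<dots> = (\<Sum>j\<in>UNIV. \<Sum>i\<in>UNIV. x $ j * (N $ j $ i * y $ i))"
      by (intro sum.cong refl) (subst that, simp)
    also have "\<dots> = x \<bullet> (N *v y)" by (simp add: inner_vec_def matrix_vector_nth sum_distrib_left)
    finally show ?thesis .
  qed
  \<comment> \<open>For symmetric m = A + iB the imaginary part of m^dagger m = 1 is A B - B
    A.\<close>
  have comm: "A ** B = B ** A"
  proof -
    have "(A ** B) $ i $ j = (B ** A) $ i $ j" for i j
    proof -
      have "(dagger m ** m) $ i $ j = mat 1 $ i $ j" using um by (simp add: unitary_def)
      then have "Im (\<Sum>k\<in>UNIV. cnj (m $ k $ i) * m $ k $ j) = 0"
        by (simp add: matrix_mul_nth mat_def split: if_splits)
      then have "(\<Sum>k\<in>UNIV. A $ i $ k * B $ k $ j - B $ i $ k * A $ k $ j) = 0"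
        unfolding A_def B_def by (simp add: sym[of _ i])
      then show ?thesis by (simp add: matrix_mul_nth sum_subtractf)
    qed
    then show ?thesis by (simp add: vec_eq_iff)
  qed
  have comm': "A *v (B *v x) = B *v (A *v x)" for x by (simp add: matrix_vector_mul_assoc comm)
  obtain X :: "4 \<Rightarrow> real ^ 4" and l n where X: "\<And>j k. X j \<bullet> X k = (if j = k then 1 else 0)"
    and l: "\<And>k. A *v X k = l k *\<^sub>R X k" and n: "\<And>k. B *v X k = n k *\<^sub>R X k"
    by (rule commuting_eigenbasis_4[OF matrix_vector_mul_linear sa[OF symA] matrix_vector_mul_linear sa[OF symB] comm']) blast
  define mu where "mu k = Complex (l k) (n k)" for k
  have eig: "m *v cvec (X k) = mu k *s cvec (X k)" for k
  proof -
    have "(m *v cvec (X k)) $ i = (mu k *s cvec (X k)) $ i" for i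
    proof -
      have "(A *v X k) $ i = l k * X k $ i" "(B *v X k) $ i = n k * X k $ i" unfolding l n by simp_all
      then show ?thesis unfolding mu_def A_def B_def matrix_vector_nth by (simp add: complex_eq_iff)
    qed
    then show ?thesis by (simp add: vec_eq_iff)
  qed
  have nrm: "norm (cvec (X k)) = 1" for k
  proof -
    have "(norm (cvec (X k)))\<^sup>2 = (norm (X k))\<^sup>2" unfolding norm_vec_def L2_set_def by (simp add: sum_nonneg)
    also have "\<dots> = 1" using X[of k k] by (simp add: dot_square_norm)
    finally show ?thesis by (simp add: power2_eq_1_iff) (metis norm_ge_zero le_minus_one_simps(3))
  qed
  have mu1: "cmod (mu k) = 1" for k
  proof -
    have "norm (m *v cvec (X k)) = norm (cvec (X k))"
      using unitary_mul_vec_orthogonal[OF um] by (simp add: orthogonal_transformation)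
    moreover have "norm (a *s x) = cmod a * norm x" for a and x :: "complex ^ 4"
      unfolding norm_vec_def by (simp add: norm_mult L2_set_right_distrib)
    ultimately show ?thesis using eig[of k] nrm[of k] by simp
  qed
  define c where "c k = csqrt (mu k)" for k
  have c2: "c k * c k = mu k" for k unfolding c_def by (metis power2_csqrt power2_eq_square)
  have c1: "cmod (c k) = 1" for k
  proof -
    have "cmod (c k) * cmod (c k) = 1" using mu1[of k] by (simp add: c2[symmetric] norm_mult)
    then show ?thesis using norm_ge_zero[of "c k"] by (auto simp: square_eq_1_iff)
  qed
  have cc: "c k * cnj (c k) = 1" for k using c1[of k] by (simp add: complex_norm_square[symmetric])
  define w where "w k = M *v cvec (X k)" for k
  \<comment> \<open>Unitarity gives M = conj(M) m. Applied to the real eigenvector X k, this yields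
    w = mu conj(w), so dividing w by a square root of mu leaves a real vector.\<close>
  have real: "cnj (w k $ i) * mu k = w k $ i" for k i
  proof -
    have "w k = cM *v (m *v cvec (X k))" unfolding w_def by (simp add: matrix_vector_mul_assoc cM)
    also have "\<dots> = mu k *s (cM *v cvec (X k))" unfolding eig by (simp add: vec_eq_iff matrix_vector_nth sum_distrib_left mult_ac)
    finally have "w k $ i = mu k * (cM *v cvec (X k)) $ i" by simp
    moreover have "(cM *v cvec (X k)) $ i = cnj (w k $ i)"
      unfolding w_def cM_def matrix_vector_nth by simp
    ultimately show ?thesis by (simp add: mult.commute)
  qed
  define Y where "Y k = (\<chi> i. Re (cnj (c k) * w k $ i))" for k
  have Yw: "complex_of_real (Y k $ i) = cnj (c k) * w k $ i" for k i
  proof -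
    have "cnj (cnj (c k) * w k $ i) = (c k * cnj (c k)) * (c k * cnj (w k $ i))" unfolding cc by simp
    also have "\<dots> = cnj (c k) * (cnj (w k $ i) * (c k * c k))" by (simp only: mult_ac)
    also have "\<dots> = cnj (c k) * w k $ i" unfolding c2 real ..
    finally have "Im (cnj (c k) * w k $ i) = 0" by (simp only: complex_is_Real_iff[symmetric] Reals_cnj_iff)
    then show ?thesis unfolding Y_def by (simp add: complex_eq_iff)
  qed
  have wY: "w k = c k *s cvec (Y k)" for k
    by (simp add: vec_eq_iff Yw mult.assoc[symmetric] cc)
  have Yorth: "Y j \<bullet> Y k = (if j = k then 1 else 0)" for j k
  proof -
    have "complex_of_real (Y j \<bullet> Y k) = (\<Sum>i\<in>UNIV. cnj (complex_of_real (Y j $ i)) * complex_of_real (Y k $ i))"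
      by (simp add: inner_vec_def)
    also have "\<dots> = c j * cnj (c k) * (\<Sum>i\<in>UNIV. cnj (w j $ i) * w k $ i)"
      unfolding Yw by (simp add: sum_distrib_left mult_ac)
    also have "(\<Sum>i\<in>UNIV. cnj (w j $ i) * w k $ i) = complex_of_real (X j \<bullet> X k)"
      unfolding w_def unitary_inner[OF M] by (simp add: inner_vec_def)
    finally show ?thesis unfolding X by (auto simp: cc split: if_splits)
  qed
  show ?thesis using X Yorth c1 wY[unfolded w_def] by (rule that[of X Y c])
qed

subsection \<open>Local rotations of frames\<close>

lemma one_qubit_eqI:
  assumes "A $ 1 $ 1 = B $ 1 $ 1" "A $ 1 $ 2 = B $ 1 $ 2" "A $ 2 $ 1 = B $ 2 $ 1" "A $ 2 $ 2 = B $ 2 $ 2"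
  shows "A = (B :: one_qubit)"
  using assms by (simp add: vec_eq_iff forall_2)

definition mat2 :: "complex \<Rightarrow> complex \<Rightarrow> complex \<Rightarrow> complex \<Rightarrow> one_qubit" where
  "mat2 a b c d = vector [vector [a, b], vector [c, d]]"

lemma mat2_nth [simp]: "mat2 a b c d $ 1 $ 1 = a" "mat2 a b c d $ 1 $ 2 = b" "mat2 a b c d $ 2 $ 1 = c" "mat2 a b c d $ 2 $ 2 = d"
  by (simp_all add: mat2_def)

lemma mat2_mul: "mat2 a b c d ** mat2 a' b' c' d' = mat2 (a * a' + b * c') (a * b' + b * d') (c * a' + d * c') (c * b' + d * d')"
  by (rule one_qubit_eqI) (simp_all add: matrix_mul_nth sum_2)

lemma dagger_mat2: "dagger (mat2 a b c d) = mat2 (cnj a) (cnj c) (cnj b) (cnj d)"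
  by (rule one_qubit_eqI) simp_all

lemma mat2_eq_iff: "mat2 a b c d = mat2 a' b' c' d' \<longleftrightarrow> a = a' \<and> b = b' \<and> c = c' \<and> d = d'"
  by (metis mat2_nth)

lemma mat2_cases: obtains a b c d where "A = mat2 a b c d"
proof
  show "A = mat2 (A $ 1 $ 1) (A $ 1 $ 2) (A $ 2 $ 1) (A $ 2 $ 2)" by (rule one_qubit_eqI) simp_all
qed

lemma mat_one_mat2: "(mat 1 :: one_qubit) = mat2 1 0 0 1"
  by (rule one_qubit_eqI) simp_all

lemma mat2_add: "mat2 a b c d + mat2 a' b' c' d' = mat2 (a + a') (b + b') (c + c') (d + d')"
  by (rule one_qubit_eqI) simp_all

lemma hermitian_involution_diagonalise:
  assumes H: "dagger H = H" "H ** H = mat 1" "trace H = 0"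
  obtains T :: one_qubit where "unitary T" "T ** H ** dagger T = pauli_Z"
proof -
  obtain p g g' q where Hm: "H = mat2 p g g' q" by (rule mat2_cases)
  have q: "q = - p" using H(3) unfolding Hm trace_def sum_2 by (simp add: add_eq_0_iff)
  have g': "g' = cnj g" "cnj p = p" using H(1) unfolding Hm dagger_mat2 mat2_eq_iff by auto
  define h where "h = Re p"
  have p: "p = complex_of_real h" unfolding h_def using g'(2) by (simp add: complex_eq_iff)
  have pg: "p * p + g * cnj g = 1" using H(2) unfolding Hm mat2_mul mat_one_mat2 mat2_eq_iff g' by simp
  then have hg: "h\<^sup>2 + (cmod g)\<^sup>2 = 1"
    unfolding p complex_norm_square[symmetric] by (metis of_real_1 of_real_add of_real_eq_iff of_real_mult power2_eq_square)
  show ?thesis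
  proof (cases "h = -1")
    case True
    then have "g = 0" using hg by simp
    have "pauli_X ** H ** dagger pauli_X = pauli_Z"
      by (rule one_qubit_eqI) (simp_all add: Hm matrix_mul_nth sum_2 q g' p True \<open>g = 0\<close>)
    moreover have "unitary pauli_X" by (rule unitary_2I) simp_all
    ultimately show ?thesis using that by blast
  next
    case False
    have "h\<^sup>2 \<le> 1" using hg zero_le_power2[of "cmod g"] by linarith
    then have "\<bar>h\<bar> \<le> 1" by (simp only: abs_square_le_1)
    then have "-1 < h" using False by auto
    define n where "n = sqrt (2 * (1 + h))"
    have n: "complex_of_real n * complex_of_real n = 2 * (1 + p)" "n \<noteq> 0"
    proof -
      have "n * n = 2 * (1 + h)" unfolding n_def using \<open>-1 < h\<close> by simp
      then have "complex_of_real (n * n) = complex_of_real (2 * (1 + h))" by (rule arg_cong)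
      then show "complex_of_real n * complex_of_real n = 2 * (1 + p)" unfolding p by simp
      show "n \<noteq> 0" unfolding n_def using \<open>-1 < h\<close> by simp
    qed
    \<comment> \<open>T is (1 + Z H) / n. Since Z and H are involutions, T H and Z T are both (Z +
      H) / n. The construction degenerates only for H = - Z, where X conjugates H into Z.\<close>
    define T where "T = mat2 ((1 + p) / n) (g / n) (- cnj g / n) ((1 + p) / n)"
    have gg: "g * cnj g = (1 + p) * (1 - p)" using pg by (simp add: algebra_simps)
    have p1: "1 + p \<noteq> 0" unfolding p using \<open>-1 < h\<close> by (metis n(1) n(2) mult_eq_0_iff of_real_eq_0_iff p)
    have p2: "2 + p * 2 \<noteq> 0"
    proof
      assume "2 + p * 2 = 0"
      then have "2 * (1 + p) = 0" by (simp add: algebra_simps)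
      then show False using p1 by (simp only: mult_eq_0_iff) simp
    qed
    have key: "((1 + p) * (1 + p) + g * cnj g) = 2 * (1 + p)" unfolding gg by (simp add: algebra_simps)
    have uT: "unitary T"
    proof (rule unitary_2I)
      show "T $ 1 $ 1 * cnj (T $ 1 $ 1) + T $ 1 $ 2 * cnj (T $ 1 $ 2) = 1"
        "T $ 2 $ 1 * cnj (T $ 2 $ 1) + T $ 2 $ 2 * cnj (T $ 2 $ 2) = 1"
        unfolding T_def using key g'(2) p1 p2 n(2) by (simp_all add: n(1) add_divide_distrib[symmetric] mult.commute add.commute)
      show "T $ 1 $ 1 * cnj (T $ 2 $ 1) + T $ 1 $ 2 * cnj (T $ 2 $ 2) = 0"
        unfolding T_def using g'(2) by (simp add: mult.commute)
    qed
    have "T ** H = pauli_Z ** T"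
    proof -
      have "T ** H = mat2 (((1 + p) * p + g * cnj g) / n) (((1 + p) * g - g * p) / n)
          ((- cnj g * p + (1 + p) * cnj g) / n) ((- (g * cnj g) - (1 + p) * p) / n)"
        unfolding T_def Hm g' q mat2_mul mat2_eq_iff using n(2) by (simp add: field_simps)
      also have "\<dots> = mat2 ((1 + p) / n) (g / n) (cnj g / n) (- (1 + p) / n)"
        unfolding gg mat2_eq_iff by (simp add: algebra_simps)
      also have "\<dots> = pauli_Z ** T"
        by (rule one_qubit_eqI) (simp_all add: T_def matrix_mul_nth sum_2)
      finally show ?thesis .
    qed
    then have "T ** H ** dagger T = pauli_Z ** (T ** dagger T)" by (simp add: matrix_mul_assoc)
    also have "\<dots> = pauli_Z" using uT by (simp add: unitary_def)
    finally show ?thesis using that uT by blast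
  qed
qed

text \<open>Anticommuting with H1 makes H3 traceless, so it can be rotated to Z; the other two then
  become off-diagonal, and a diagonal phase sends the first to X. What remains of the second is Y up
  to a sign e, the orientation of the triple.\<close>

lemma anticommuting_involutions_rotate:
  assumes H: "dagger H1 = H1" "dagger H2 = H2" "dagger H3 = H3"
    and sq: "H1 ** H1 = mat 1" "H2 ** H2 = mat 1" "H3 ** H3 = mat 1"
    and anti: "H1 ** H2 + H2 ** H1 = 0" "H1 ** H3 + H3 ** H1 = 0" "H2 ** H3 + H3 ** H2 = 0"
  obtains T :: one_qubit and e where "unitary T" "cmod e = 1" "T ** H1 ** dagger T = pauli_X"
    "T ** H2 ** dagger T = cscale e pauli_Y" "T ** H3 ** dagger T = pauli_Z"
proof -
  have neg: "A + B = 0 \<longleftrightarrow> A = cscale (-1) B" for A B :: one_qubit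
    by (simp add: vec_eq_iff add_eq_0_iff2)
  have "trace H3 = trace (H1 ** (H1 ** H3))" by (simp add: matrix_mul_assoc sq)
  also have "\<dots> = trace ((H1 ** H3) ** H1)" by (rule trace_mul_sym)
  also have "H1 ** H3 = cscale (-1) (H3 ** H1)" using anti(2) by (simp add: neg)
  also have "cscale (-1) (H3 ** H1) ** H1 = cscale (-1) (H3 ** (H1 ** H1))"
    by (simp add: vec_eq_iff forall_2 matrix_mul_nth sum_2 algebra_simps)
  also have "trace (cscale (-1) (H3 ** (H1 ** H1))) = - trace H3"
    by (simp add: sq trace_def sum_negf)
  finally have "trace H3 = 0" by (simp add: equal_neg_zero)
  then obtain T where T: "unitary T" "T ** H3 ** dagger T = pauli_Z"
    using hermitian_involution_diagonalise[OF H(3) sq(3)] by blast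
  define G1 G2 where "G1 = T ** H1 ** dagger T" and "G2 = T ** H2 ** dagger T"
  have TT: "T ** mat 1 ** dagger T = mat 1" using T by (simp add: unitary_def)
  have conj: "T ** (A ** B + C ** D) ** dagger T = (T ** A ** dagger T) ** (T ** B ** dagger T) + (T ** C ** dagger T) ** (T ** D ** dagger T)"
    for A B C D
    unfolding unitary_conj_mul[OF T(1)]
    by (simp add: vec_eq_iff forall_2 matrix_mul_nth sum_2 algebra_simps)
  have zero: "T ** 0 ** dagger T = 0" by (simp add: vec_eq_iff matrix_mul_nth)
  have G: "dagger G1 = G1" "dagger G2 = G2" "G1 ** G1 = mat 1" "G2 ** G2 = mat 1"
    unfolding G1_def G2_def unitary_conj_mul[OF T(1)] sq TT
    by (simp_all add: dagger_mul H matrix_mul_assoc)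
  have GG: "G1 ** G2 + G2 ** G1 = 0" "G1 ** pauli_Z + pauli_Z ** G1 = 0" "G2 ** pauli_Z + pauli_Z ** G2 = 0"
    unfolding G1_def G2_def T(2)[symmetric] conj[symmetric] anti zero by simp_all
  have Zm: "pauli_Z = mat2 1 0 0 (-1)" by (rule one_qubit_eqI) simp_all
  have zm: "(0 :: one_qubit) = mat2 0 0 0 0" by (rule one_qubit_eqI) simp_all
  obtain p a a' q where G1m: "G1 = mat2 p a a' q" by (rule mat2_cases)
  obtain r b b' s where G2m: "G2 = mat2 r b b' s" by (rule mat2_cases)
  have pq: "p = 0" "q = 0" using GG(2) unfolding G1m Zm mat2_mul mat2_add zm mat2_eq_iff by auto
  have rs: "r = 0" "s = 0" using GG(3) unfolding G2m Zm mat2_mul mat2_add zm mat2_eq_iff by auto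
  have a': "a' = cnj a" using G(1) unfolding G1m dagger_mat2 mat2_eq_iff by simp
  have b': "b' = cnj b" using G(2) unfolding G2m dagger_mat2 mat2_eq_iff by simp
  have aa: "a * cnj a = 1" using G(3) unfolding G1m mat_one_mat2 mat2_mul mat2_eq_iff pq a' by simp
  have bb: "b * cnj b = 1" using G(4) unfolding G2m mat_one_mat2 mat2_mul mat2_eq_iff rs b' by simp
  have ab: "a * cnj b + b * cnj a = 0" using GG(1) unfolding G1m G2m zm mat2_mul mat2_add mat2_eq_iff pq rs a' b' by simp
  define D where "D = mat2 1 0 0 a"
  have uD: "unitary D" unfolding D_def by (rule unitary_2I) (simp_all add: aa)
  define e where "e = \<i> * (b * cnj a)"
  show ?thesis
  proof (rule that)
    show "unitary (D ** T)" using uD T(1) by (rule unitary_mul)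
    have eq: "(D ** T) ** A ** dagger (D ** T) = D ** (T ** A ** dagger T) ** dagger D" for A
      by (simp add: dagger_mul matrix_mul_assoc)
    show "(D ** T) ** H1 ** dagger (D ** T) = pauli_X"
      unfolding eq unfolding G1_def[symmetric] unfolding G1m D_def pq a'
      by (rule one_qubit_eqI) (simp_all add: matrix_mul_nth sum_2 aa)
    show "(D ** T) ** H3 ** dagger (D ** T) = pauli_Z"
      unfolding eq unfolding T(2) D_def
      by (rule one_qubit_eqI) (simp_all add: matrix_mul_nth sum_2 aa)
    show "(D ** T) ** H2 ** dagger (D ** T) = cscale e pauli_Y"
      unfolding eq unfolding G2_def[symmetric] unfolding G2m D_def rs b' e_def
      by (rule one_qubit_eqI) (use ab in \<open>simp_all add: matrix_mul_nth sum_2 eq_neg_iff_add_eq_0 algebra_simps\<close>)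
    have "cmod a * cmod a = 1" "cmod b * cmod b = 1"
      using arg_cong[OF aa, of cmod] arg_cong[OF bb, of cmod] by (simp_all add: norm_mult)
    then have "cmod a = 1" "cmod b = 1"
      using norm_ge_zero[of a] norm_ge_zero[of b] by (auto simp: square_eq_1_iff)
    then show "cmod e = 1" unfolding e_def by (simp add: norm_mult)
  qed
qed

section \<open>Quaternion coordinates\<close>

definition vec_mat :: "one_qubit \<Rightarrow> complex ^ (2 \<times> 2)" where
  "vec_mat A = (\<chi> p. A $ fst p $ snd p)"

lemma vec_mat_nth [simp]: "vec_mat A $ p = A $ fst p $ snd p"
  by (simp add: vec_mat_def)

lemma kron_vec_mat: "kron V W *v vec_mat A = vec_mat (V ** A ** transpose W)"
  unfolding vec_eq_iff forall_pair2 by (simp add: matrix_vector_nth sum_pair2 matrix_mul_nth sum_2 algebra_simps)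

definition magic_vec :: "real ^ 4 \<Rightarrow> complex ^ (2 \<times> 2)" where
  "magic_vec x = (\<Sum>k\<in>UNIV. complex_of_real (x $ k) *s magic k)"

text \<open>The matrix x0 + i (x1 X + x2 Y + x3 Z).\<close>

definition quaternion :: "real ^ 4 \<Rightarrow> one_qubit" where
  "quaternion x = mat2 (Complex (x $ 0) (x $ 3)) (Complex (x $ 2) (x $ 1)) (Complex (- (x $ 2)) (x $ 1)) (Complex (x $ 0) (- (x $ 3)))"

lemma magic_vec_quaternion: "magic_vec x = (1 / sqrt 2) *s vec_mat (quaternion x)"
  unfolding vec_eq_iff forall_pair2 magic_vec_def quaternion_def
  by (simp add: sum_four magic_nth complex_eq_iff)

text \<open>The polarised form of the norm identity for quaternions: orthogonality of real vectors
  becomes an anticommutation relation.\<close>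

lemma quaternion_polar:
  "dagger (quaternion x) ** quaternion y + dagger (quaternion y) ** quaternion x = mat2 (2 * (x \<bullet> y)) 0 0 (2 * (x \<bullet> y))"
  unfolding quaternion_def dagger_mat2 mat2_mul mat2_add mat2_eq_iff inner_vec_def sum_four
  by (simp add: complex_eq_iff algebra_simps)

text \<open>Multiplying by the adjoint of F 0 moves the first frame matrix to 1. Orthogonality to it
  makes the other three i times Hermitian involutions, and mutual orthogonality makes these
  anticommute, so one rotation takes them to the Pauli matrices. The phases in the conclusion let
  frames of either orientation through.\<close>

lemma frame_to_magic:
  fixes X :: "4 \<Rightarrow> real ^ 4"
  assumes X: "\<And>j k. X j \<bullet> X k = (if j = k then 1 else 0)"
  obtains V W :: one_qubit and e where "unitary V" "unitary W" "\<And>k. cmod (e k) = 1"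
    "\<And>k. kron V W *v magic_vec (X k) = e k *s magic k"
proof -
  define F where "F k = quaternion (X k)" for k
  have polar: "dagger (F j) ** F k + dagger (F k) ** F j = (if j = k then mat2 2 0 0 2 else 0)" for j k
    unfolding F_def quaternion_polar X by (auto simp: vec_eq_iff forall_2)
  have FF: "dagger (F k) ** F k = mat 1" for k
  proof -
    have "dagger (F k) ** F k + dagger (F k) ** F k = mat2 2 0 0 2" using polar[of k k] by simp
    then show ?thesis by (simp add: vec_eq_iff forall_2)
  qed
  have uF: "unitary (F k)" for k unfolding unitary_def using FF matrix_left_right_inverse by blast
  define H where "H k = cscale (- \<i>) (dagger (F 0) ** F k)" for k
  have F00: "F 0 ** dagger (F 0) = mat 1" using uF by (simp add: unitary_def)
  have skew: "dagger (F k) ** F 0 = cscale (-1) (dagger (F 0) ** F k)" if "k \<noteq> 0" for k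
    using polar[of 0 k] that by (simp add: vec_eq_iff add_eq_0_iff)
  have dag: "dagger (H k) = H k" if "k \<noteq> 0" for k
  proof -
    have "dagger (H k) = cscale \<i> (dagger (F k) ** F 0)" unfolding H_def
      by (simp add: vec_eq_iff matrix_mul_nth mult.commute)
    then show ?thesis unfolding skew[OF that] H_def by (simp add: vec_eq_iff)
  qed
  have HH: "H j ** H k = dagger (F j) ** F k" if "j \<noteq> 0" for j k
  proof -
    have "H j ** H k = dagger (H j) ** H k" using dag[OF that] by simp
    also have "\<dots> = dagger (F j) ** F 0 ** (dagger (F 0) ** F k)"
    proof -
      have "dagger (H j) = cscale \<i> (dagger (F j) ** F 0)" unfolding H_def
        by (simp add: vec_eq_iff matrix_mul_nth mult.commute)
      moreover have "cscale 1 A = A" for A :: one_qubit by (simp add: vec_eq_iff)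
      ultimately show ?thesis unfolding H_def[of k] by (simp add: cscale_mul)
    qed
    also have "\<dots> = dagger (F j) ** (F 0 ** dagger (F 0)) ** F k" by (simp only: matrix_mul_assoc)
    finally show ?thesis unfolding F00 by simp
  qed
  obtain T e where T: "unitary T" and e: "cmod e = 1" and rot: "T ** H 1 ** dagger T = pauli_X"
    "T ** H 2 ** dagger T = cscale e pauli_Y" "T ** H 3 ** dagger T = pauli_Z"
  proof (rule anticommuting_involutions_rotate[of "H 1" "H 2" "H 3"])
    show "dagger (H 1) = H 1" "dagger (H 2) = H 2" "dagger (H 3) = H 3" by (simp_all add: dag)
    show "H 1 ** H 1 = mat 1" "H 2 ** H 2 = mat 1" "H 3 ** H 3 = mat 1" by (simp_all add: HH FF)
    show "H 1 ** H 2 + H 2 ** H 1 = 0" "H 1 ** H 3 + H 3 ** H 1 = 0" "H 2 ** H 3 + H 3 ** H 2 = 0"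
      using polar[of 1 2] polar[of 1 3] polar[of 2 3] by (simp_all add: HH)
  qed blast
  define V W where "V = T ** dagger (F 0)" and "W = transpose (dagger T)"
  define c where "c k = (if k = 2 then e else 1)" for k :: 4
  have main: "V ** F k ** transpose W = cscale (c k * (if k = 0 then 1 else \<i>)) (pauli k)" for k
  proof -
    have tW: "transpose W = dagger T" unfolding W_def by (simp add: vec_eq_iff)
    have "\<forall>k. V ** F k ** dagger T = cscale (c k * (if k = 0 then 1 else \<i>)) (pauli k)"
      unfolding forall_four
    proof (intro conjI)
      have "V ** F 0 ** dagger T = T ** (dagger (F 0) ** F 0) ** dagger T" unfolding V_def by (simp only: matrix_mul_assoc)
      also have "\<dots> = mat 1" unfolding FF using T by (simp add: unitary_def)
      finally show "V ** F 0 ** dagger T = cscale (c 0 * (if (0::4) = 0 then 1 else \<i>)) (pauli 0)"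
        by (simp add: c_def vec_eq_iff)
      have iH: "V ** F k ** dagger T = cscale \<i> (T ** H k ** dagger T)" for k
      proof -
        have "F k = F 0 ** cscale \<i> (H k)"
        proof -
          have "cscale \<i> (H k) = dagger (F 0) ** F k" unfolding H_def by (simp add: vec_eq_iff)
          then show ?thesis by (simp add: matrix_mul_assoc F00)
        qed
        then have "V ** F k ** dagger T = T ** (dagger (F 0) ** F 0) ** cscale \<i> (H k) ** dagger T"
          unfolding V_def by (simp only: matrix_mul_assoc)
        then show ?thesis unfolding FF by (simp add: vec_eq_iff forall_2 matrix_mul_nth sum_2 algebra_simps)
      qed
      show "V ** F 1 ** dagger T = cscale (c 1 * (if (1::4) = 0 then 1 else \<i>)) (pauli 1)"
        unfolding iH rot by (simp add: c_def)
      show "V ** F 2 ** dagger T = cscale (c 2 * (if (2::4) = 0 then 1 else \<i>)) (pauli 2)"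
        unfolding iH rot by (simp add: c_def vec_eq_iff)
      show "V ** F 3 ** dagger T = cscale (c 3 * (if (3::4) = 0 then 1 else \<i>)) (pauli 3)"
        unfolding iH rot by (simp add: c_def)
    qed
    then show ?thesis unfolding tW by blast
  qed
  show ?thesis
  proof (rule that[of V W c])
    show "unitary V" unfolding V_def using T uF by (intro unitary_mul unitary_dagger)
    show "unitary W" unfolding W_def using T by (intro unitary_transpose unitary_dagger)
    show "cmod (c k) = 1" for k using e by (simp add: c_def)
    show "kron V W *v magic_vec (X k) = c k *s magic k" for k
    proof -
      have "kron V W *v magic_vec (X k) = (1 / sqrt 2) *s (kron V W *v vec_mat (F k))"
        unfolding magic_vec_quaternion F_def by (simp add: vec_eq_iff matrix_vector_nth sum_distrib_left mult_ac)
      also have "\<dots> = c k *s magic k"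
        unfolding kron_vec_mat main by (simp add: vec_eq_iff magic_def)
      finally show ?thesis .
    qed
  qed
qed

subsection \<open>Cartan decomposition\<close>

definition locally_equiv :: "two_qubit \<Rightarrow> two_qubit \<Rightarrow> bool" where
  "locally_equiv U W \<longleftrightarrow> (\<exists>V1 V2 V3 V4 :: one_qubit. unitary V1 \<and> unitary V2 \<and> unitary V3 \<and> unitary V4 \<and>
     U = kron V1 V2 ** W ** kron V3 V4)"

lemma locally_equivI:
  "unitary V1 \<Longrightarrow> unitary V2 \<Longrightarrow> unitary V3 \<Longrightarrow> unitary V4 \<Longrightarrow> U = kron V1 V2 ** W ** kron V3 V4 \<Longrightarrow> locally_equiv U W"
  unfolding locally_equiv_def by blast

lemma locally_equiv_trans: "locally_equiv U W \<Longrightarrow> locally_equiv W S \<Longrightarrow> locally_equiv U S"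
proof -
  assume "locally_equiv U W" "locally_equiv W S"
  then obtain V1 V2 V3 V4 W1 W2 W3 W4 where V: "unitary V1" "unitary V2" "unitary V3" "unitary V4" "U = kron V1 V2 ** W ** kron V3 V4"
    and W: "unitary W1" "unitary W2" "unitary W3" "unitary W4" "W = kron W1 W2 ** S ** kron W3 W4"
    unfolding locally_equiv_def by blast
  have "U = (kron V1 V2 ** kron W1 W2) ** S ** (kron W3 W4 ** kron V3 V4)"
    unfolding V(5) W(5) by (simp only: matrix_mul_assoc)
  then have "U = kron (V1 ** W1) (V2 ** W2) ** S ** kron (W3 ** V3) (W4 ** V4)" by (simp only: kron_mul)
  then show ?thesis
    by (rule locally_equivI[OF unitary_mul[OF V(1) W(1)] unitary_mul[OF V(2) W(2)] unitary_mul[OF W(3) V(3)] unitary_mul[OF W(4) V(4)]])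
qed

lemma unitary_cscale: "cmod c = 1 \<Longrightarrow> unitary V \<Longrightarrow> unitary (cscale c V)"
proof -
  assume c: "cmod c = 1" and V: "unitary V"
  have d: "dagger (cscale c V) = cscale (cnj c) (dagger V)" by (simp add: vec_eq_iff)
  have "c * cnj c = 1" using c by (simp add: complex_norm_square[symmetric])
  moreover have "cscale 1 A = A" for A :: "complex ^ 'a ^ 'a" by (simp add: vec_eq_iff)
  ultimately show ?thesis using V unfolding unitary_def d cscale_mul by (simp add: mult.commute)
qed

definition magic_mat :: "complex ^ 4 ^ (2 \<times> 2)" where
  "magic_mat = (\<chi> p k. magic k $ p)"

lemma magic_mat_isometry: "dagger magic_mat ** magic_mat = mat 1" "magic_mat ** dagger magic_mat = mat 1"
  by (simp_all add: vec_eq_iff matrix_mul_nth magic_mat_def magic_orth magic_complete mat_def)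

lemma magic_mat_cvec: "magic_mat *v cvec x = magic_vec x"
  by (simp add: vec_eq_iff matrix_vector_nth magic_mat_def magic_vec_def mult.commute)

lemma magic_diagonalI:
  assumes "\<And>k. A *v magic k = c k *s magic k"
  shows "A = magic_diag c"
proof -
  have "A = A ** (\<Sum>k\<in>UNIV. rank_one_proj (magic k))" by (simp add: sum_rank_one_proj_magic)
  also have "\<dots> = (\<Sum>k\<in>UNIV. A ** rank_one_proj (magic k))" by (rule matrix_mul_sum_right)
  also have "\<dots> = magic_diag c"
  proof (intro sum.cong refl)
    fix k
    have "(A ** rank_one_proj (magic k)) $ p $ q = (A *v magic k) $ p * cnj (magic k $ q)" for p q
      by (simp add: matrix_mul_nth matrix_vector_nth sum_distrib_left mult_ac)
    then show "A ** rank_one_proj (magic k) = cscale (c k) (rank_one_proj (magic k))"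
      unfolding assms by (simp add: vec_eq_iff)
  qed
  finally show ?thesis .
qed

text \<open>Moving the input frame X and the output frame Y of \<open>unitary_real_frames\<close> to
  the magic basis by local gates leaves a gate diagonal in that basis.\<close>

lemma cartan_angles_exist:
  assumes U: "unitary U"
  shows "\<exists>x y z. locally_equiv U (U_d x y z)"
proof -
  define M where "M = dagger magic_mat ** U ** magic_mat"
  have "unitary M"
  proof -
    have "dagger M ** M = dagger magic_mat ** (dagger U ** (magic_mat ** dagger magic_mat) ** U) ** magic_mat"
      unfolding M_def dagger_mul by (simp add: matrix_mul_assoc)
    also have "\<dots> = mat 1" using U unfolding magic_mat_isometry unitary_def by (simp add: magic_mat_isometry)
    finally show ?thesis unfolding unitary_def using matrix_left_right_inverse by blast
  qed
  then obtain X Y :: "4 \<Rightarrow> real ^ 4" and c where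
    X: "\<And>j k. X j \<bullet> X k = (if j = k then 1 else 0)" and Y: "\<And>j k. Y j \<bullet> Y k = (if j = k then 1 else 0)"
    and c: "\<And>k. cmod (c k) = 1" and M: "\<And>k. M *v cvec (X k) = c k *s cvec (Y k)"
    by (rule unitary_real_frames) blast
  have sc: "A *v (a *s x) = a *s (A *v x)" for A :: two_qubit and a x
    by (simp add: vec_eq_iff matrix_vector_nth sum_distrib_left mult_ac)
  have UX: "U *v magic_vec (X k) = c k *s magic_vec (Y k)" for k
  proof -
    have "U *v magic_vec (X k) = (magic_mat ** dagger magic_mat) *v (U *v (magic_mat *v cvec (X k)))"
      by (simp add: magic_mat_isometry magic_mat_cvec)
    also have "\<dots> = magic_mat *v (M *v cvec (X k))"
      unfolding M_def by (simp add: matrix_vector_mul_assoc matrix_mul_assoc)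
    also have "\<dots> = c k *s magic_vec (Y k)"
      unfolding M magic_mat_cvec[symmetric]
      by (simp add: vec_eq_iff matrix_vector_nth sum_distrib_left mult_ac)
    finally show ?thesis .
  qed
  obtain V1 W1 :: one_qubit and d where V1: "unitary V1" "unitary W1" "\<And>k. cmod (d k) = 1"
    "\<And>k. kron V1 W1 *v magic_vec (X k) = d k *s magic k"
    by (rule frame_to_magic[OF X]) blast
  obtain V2 W2 :: one_qubit and e where V2: "unitary V2" "unitary W2" "\<And>k. cmod (e k) = 1"
    "\<And>k. kron V2 W2 *v magic_vec (Y k) = e k *s magic k"
    by (rule frame_to_magic[OF Y]) blast
  define K L where "K = kron V1 W1" and "L = kron V2 W2"
  have uK: "dagger K ** K = mat 1" "K ** dagger K = mat 1" and uL: "dagger L ** L = mat 1"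
    unfolding K_def L_def using unitary_kron V1 V2 unfolding unitary_def by blast+
  define f where "f k = c k * e k * cnj (d k)" for k
  have f1: "cmod (f k) = 1" for k unfolding f_def by (simp add: norm_mult c V1 V2)
  have "(L ** U ** dagger K) *v magic k = f k *s magic k" for k
  proof -
    have dd: "cnj (d k) * d k = 1" using V1(3)[of k] by (simp add: complex_norm_square[symmetric] mult.commute)
    have "magic k = cnj (d k) *s (d k *s magic k)" by (simp add: vec_eq_iff mult.assoc[symmetric] dd)
    also have "\<dots> = cnj (d k) *s (K *v magic_vec (X k))" unfolding K_def V1(4) ..
    finally have "dagger K *v magic k = cnj (d k) *s (dagger K *v (K *v magic_vec (X k)))" by (metis sc)
    also have "\<dots> = cnj (d k) *s magic_vec (X k)" by (simp add: matrix_vector_mul_assoc uK)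
    finally have "(L ** U ** dagger K) *v magic k = L *v (U *v (cnj (d k) *s magic_vec (X k)))"
      by (simp add: matrix_vector_mul_assoc[symmetric])
    also have "\<dots> = cnj (d k) *s (c k *s (L *v magic_vec (Y k)))" by (simp only: sc UX)
    also have "\<dots> = f k *s magic k" unfolding L_def V2(4) f_def by (simp add: vec_eq_iff mult_ac)
    finally show ?thesis .
  qed
  from magic_diagonalI[OF this] have D: "L ** U ** dagger K = magic_diag f" .
  define t where "t k = Arg (f k)" for k
  have ft: "f k = exp (\<i> * t k)" for k
    unfolding t_def using Arg_eq[of "f k"] f1[of k] by (metis mult_1 norm_zero of_real_1 zero_neq_one)
  \<comment> \<open>Cartan phases sum to zero, so the mean s of the four arguments is a global
    phase, put into one local factor, and pair sums of the rest give the angles.\<close>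
  define s where "s = (t 0 + t 1 + t 2 + t 3) / 4"
  define x y z where "x = (t 0 + t 1) / 2 - s" and "y = (t 1 + t 3) / 2 - s" and "z = (t 0 + t 3) / 2 - s"
  have ph: "t k = s + cartan_phase x y z k" for k
  proof -
    have "\<forall>k. t k = s + cartan_phase x y z k"
      unfolding forall_four by (simp add: x_def y_def z_def s_def field_simps)
    then show ?thesis by blast
  qed
  have D': "L ** U ** dagger K = cscale (exp (\<i> * s)) (U_d x y z)"
    unfolding D U_d_spectral ft ph by (simp add: vec_eq_iff sum_distrib_left exp_add ring_distribs mult_ac)
  have "U = dagger L ** (L ** U ** dagger K) ** K"
    by (simp add: matrix_mul_assoc uL) (simp add: matrix_mul_assoc[symmetric] uK)
  also have "\<dots> = kron (cscale (exp (\<i> * s)) (dagger V2)) (dagger W2) ** U_d x y z ** kron V1 W1"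
  proof -
    have "dagger L ** cscale (exp (\<i> * s)) (U_d x y z) = cscale (exp (\<i> * s)) (dagger L) ** U_d x y z"
      by (simp add: vec_eq_iff matrix_mul_nth mult_ac)
    moreover have "cscale (exp (\<i> * s)) (dagger L) = kron (cscale (exp (\<i> * s)) (dagger V2)) (dagger W2)"
      unfolding L_def dagger_kron by (simp add: vec_eq_iff)
    ultimately show ?thesis unfolding D' unfolding K_def by simp
  qed
  finally have "locally_equiv U (U_d x y z)"
    by (rule locally_equivI[rotated 4]) (simp_all add: V1 V2 unitary_cscale unitary_dagger)
  then show ?thesis by blast
qed

subsection \<open>Reduction to the Weyl chamber\<close>

text \<open>A shift of x by a quarter period multiplies the gate by exp(i pi XX / 2) = i XX or its
  inverse, which is local.\<close>

lemma U_d_shift: "locally_equiv (U_d (x + pi / 2) y z) (U_d x y z)" "locally_equiv (U_d (x - pi / 2) y z) (U_d x y z)"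
proof -
  have XX: "kron (cscale c pauli_X) pauli_X = magic_diag (\<lambda>k. c * pauli_sign 1 k)" for c
    unfolding vec_eq_iff forall_pair2 by (simp add: sum_four magic_nth pauli_sign_def)
  have ph: "cartan_phase (x + a) y z k = cartan_phase x y z k + (if k = 0 \<or> k = 1 then a else - a)" for a k
    unfolding cartan_phase_def by simp
  have uX: "unitary pauli_X" by (rule unitary_2I) simp_all
  have shift: "locally_equiv (U_d (x + a) y z) (U_d x y z)" if w: "cis a = w" "cis (- a) = - w" "cmod w = 1" for a w
  proof -
    have "U_d (x + a) y z = U_d x y z ** kron (cscale w pauli_X) pauli_X"
      unfolding U_d_spectral XX magic_diagonal_mul ph cis_conv_exp[symmetric] cis_mult[symmetric]
      by (intro sum.cong refl arg_cong[of _ _ "\<lambda>c. cscale c _"]) (simp add: w pauli_sign_def)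
    then have "U_d (x + a) y z = kron (mat 1) (mat 1) ** U_d x y z ** kron (cscale w pauli_X) pauli_X"
      unfolding kron_one by simp
    then show ?thesis
      by (rule locally_equivI[OF unitary_one unitary_one unitary_cscale[OF w(3) uX] uX])
  qed
  show "locally_equiv (U_d (x + pi / 2) y z) (U_d x y z)"
    by (rule shift[of _ \<i>]) (simp_all add: complex_eq_iff)
  show "locally_equiv (U_d (x - pi / 2) y z) (U_d x y z)"
    using shift[of "- (pi / 2)" "- \<i>"] by (simp add: complex_eq_iff)
qed

lemma cartan_phase_swap_xy: "cartan_phase y x z 0 = cartan_phase x y z 3" "cartan_phase y x z 1 = cartan_phase x y z 1"
    "cartan_phase y x z 2 = cartan_phase x y z 2" "cartan_phase y x z 3 = cartan_phase x y z 0"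
  and cartan_phase_swap_yz: "cartan_phase x z y 0 = cartan_phase x y z 1" "cartan_phase x z y 1 = cartan_phase x y z 0"
    "cartan_phase x z y 2 = cartan_phase x y z 2" "cartan_phase x z y 3 = cartan_phase x y z 3"
  and cartan_phase_flip_yz: "cartan_phase x (- y) (- z) 0 = cartan_phase x y z 1" "cartan_phase x (- y) (- z) 1 = cartan_phase x y z 0"
    "cartan_phase x (- y) (- z) 2 = cartan_phase x y z 3" "cartan_phase x (- y) (- z) 3 = cartan_phase x y z 2"
  by simp_all

lemma cscale_mul_left: "cscale c A ** B = cscale c (A ** B)"
  and cscale_mul_right: "A ** cscale c B = cscale c (A ** B)"
  by (simp_all add: vec_eq_iff matrix_mul_nth sum_distrib_left mult_ac)

lemma conj_magic_diagonal:
  "A ** magic_diag c ** dagger A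
   = (\<Sum>k\<in>UNIV. cscale (c k) (rank_one_proj (A *v magic k)))"
  by (simp only: conj_rank_one_proj[symmetric] matrix_mul_sum_left matrix_mul_sum_right cscale_mul_left cscale_mul_right)

lemma U_d_swap_xy: "locally_equiv (U_d y x z) (U_d x y z)"
proof -
  \<comment> \<open>S is (X + Y) / sqrt 2, which exchanges X and Y and negates Z under conjugation;
    thus S tensor S exchanges XX and YY and fixes ZZ.\<close>
  define S where "S = mat2 0 ((1 - \<i>) / sqrt 2) ((1 + \<i>) / sqrt 2) 0"
  have u: "unitary S" unfolding S_def by (rule unitary_2I) (simp_all add: complex_eq_iff field_simps)
  have rot: "rank_one_proj (kron S S *v magic 0) = rank_one_proj (magic 3)"
    "rank_one_proj (kron S S *v magic 1) = rank_one_proj (magic 1)"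
    "rank_one_proj (kron S S *v magic 2) = rank_one_proj (magic 2)"
    "rank_one_proj (kron S S *v magic 3) = rank_one_proj (magic 0)"
    unfolding vec_eq_iff forall_pair2 S_def
    by (simp_all add: matrix_vector_nth sum_pair2 magic_nth complex_eq_iff)
  have "U_d y x z = kron S S ** U_d x y z ** dagger (kron S S)"
    unfolding U_d_spectral conj_magic_diagonal
    unfolding sum_four rot cartan_phase_swap_xy[of y x z] by (simp only: add_ac)
  then show ?thesis unfolding dagger_kron
    by (rule locally_equivI[OF u u unitary_dagger[OF u] unitary_dagger[OF u]])
qed

lemma U_d_swap_yz: "locally_equiv (U_d x z y) (U_d x y z)"
proof -
  \<comment> \<open>S is (Y + Z) / sqrt 2, which exchanges Y and Z in the same way.\<close>
  define S where "S = mat2 (1 / sqrt 2) (- \<i> / sqrt 2) (\<i> / sqrt 2) (- 1 / sqrt 2)"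
  have u: "unitary S" unfolding S_def by (rule unitary_2I) (simp_all add: complex_eq_iff field_simps)
  have rot: "rank_one_proj (kron S S *v magic 0) = rank_one_proj (magic 1)"
    "rank_one_proj (kron S S *v magic 1) = rank_one_proj (magic 0)"
    "rank_one_proj (kron S S *v magic 2) = rank_one_proj (magic 2)"
    "rank_one_proj (kron S S *v magic 3) = rank_one_proj (magic 3)"
    unfolding vec_eq_iff forall_pair2 S_def
    by (simp_all add: matrix_vector_nth sum_pair2 magic_nth complex_eq_iff)
  have "U_d x z y = kron S S ** U_d x y z ** dagger (kron S S)"
    unfolding U_d_spectral conj_magic_diagonal
    unfolding sum_four rot cartan_phase_swap_yz[of x z y] by (simp only: add_ac)
  then show ?thesis unfolding dagger_kron
    by (rule locally_equivI[OF u u unitary_dagger[OF u] unitary_dagger[OF u]])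
qed

text \<open>Conjugation by X on one qubit negates YY and ZZ and fixes XX.\<close>

lemma U_d_flip_yz: "locally_equiv (U_d x (- y) (- z)) (U_d x y z)"
proof -
  have u: "unitary pauli_X" by (rule unitary_2I) simp_all
  have "U_d x (- y) (- z) = kron pauli_X (mat 1) ** U_d x y z ** kron pauli_X (mat 1)"
    unfolding vec_eq_iff forall_pair2
    by (simp add: matrix_mul_nth sum_pair2 U_d_nth cartan_phase_flip_yz del: cartan_phase_simps)
  then show ?thesis by (rule locally_equivI[OF u unitary_one u unitary_one])
qed

lemma shift_into_cell:
  fixes x p :: real
  assumes "0 < p"
  obtains n :: int where "\<bar>x - of_int n * (2 * p)\<bar> \<le> p"
proof
  define r where "r = x / (2 * p)"
  have "\<bar>r - of_int (round r)\<bar> \<le> 1 / 2" using of_int_round_abs_le[of r] by (simp add: abs_minus_commute)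
  then have "\<bar>r - of_int (round r)\<bar> * (2 * p) \<le> 1 / 2 * (2 * p)" using assms by (intro mult_right_mono) auto
  moreover have "\<bar>r - of_int (round r)\<bar> * (2 * p) = \<bar>(r - of_int (round r)) * (2 * p)\<bar>" using assms by (simp add: abs_mult)
  moreover have "(r - of_int (round r)) * (2 * p) = x - of_int (round r) * (2 * p)"
    unfolding r_def using assms by (simp add: field_simps)
  ultimately show "\<bar>x - of_int (round r) * (2 * p)\<bar> \<le> p" by simp
qed

text \<open>Shifts bring each angle into [-pi/4, pi/4], permutations sort the absolute values, and
  sign changes come only in pairs. So two angles can be made nonnegative while the smallest may keep
  a sign, which is why the chamber bounds the absolute value of the last angle.\<close>

lemma weyl_reduction:
  fixes P :: "real \<Rightarrow> real \<Rightarrow> real \<Rightarrow> bool"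
  assumes up: "\<And>x y z. P x y z \<Longrightarrow> P (x + pi / 2) y z" and down: "\<And>x y z. P x y z \<Longrightarrow> P (x - pi / 2) y z"
    and xy: "\<And>x y z. P x y z \<Longrightarrow> P y x z" and yz: "\<And>x y z. P x y z \<Longrightarrow> P x z y"
    and flip: "\<And>x y z. P x y z \<Longrightarrow> P x (- y) (- z)" and P: "P x y z"
  shows "\<exists>x y z. P x y z \<and> \<bar>z\<bar> \<le> y \<and> y \<le> x \<and> x \<le> pi / 4"
proof -
  have shift: "P (x - of_int n * (2 * (pi / 4))) y z" if "P x y z" for x y z n
  proof (induction n rule: int_induct[where k = 0])
    case base
    then show ?case using that by simp
  next
    case (step1 i)
    have "x - of_int i * (2 * (pi / 4)) - pi / 2 = x - of_int (i + 1) * (2 * (pi / 4))" by (simp add: field_simps)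
    moreover have "P (x - of_int i * (2 * (pi / 4)) - pi / 2) y z" by (rule down[OF step1(2)])
    ultimately show ?case by (simp only:)
  next
    case (step2 i)
    have "x - of_int i * (2 * (pi / 4)) + pi / 2 = x - of_int (i - 1) * (2 * (pi / 4))" by (simp add: field_simps)
    moreover have "P (x - of_int i * (2 * (pi / 4)) + pi / 2) y z" by (rule up[OF step2(2)])
    ultimately show ?case by (simp only:)
  qed
  have cell: "\<exists>x'. P x' y z \<and> \<bar>x'\<bar> \<le> pi / 4" if "P x y z" for x y z
    using shift[OF that] shift_into_cell[of "pi / 4" x] by (metis pi_gt_zero zero_less_divide_iff zero_less_numeral)
  obtain x1 where x1: "P x1 y z" "\<bar>x1\<bar> \<le> pi / 4" using cell[OF P] by blast
  obtain y1 where y1: "P y1 x1 z" "\<bar>y1\<bar> \<le> pi / 4" using cell[OF xy[OF x1(1)]] by blast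
  obtain z1 where z1: "P z1 y1 x1" "\<bar>z1\<bar> \<le> pi / 4" using cell[OF xy[OF yz[OF xy[OF y1(1)]]]] xy yz by blast
  have sort: "\<exists>x y z. P x y z \<and> \<bar>z\<bar> \<le> \<bar>y\<bar> \<and> \<bar>y\<bar> \<le> \<bar>x\<bar> \<and> \<bar>x\<bar> \<le> pi / 4"
  proof -
    have 1: "P z1 y1 x1" by (rule z1(1))
    have 2: "P y1 z1 x1" by (rule xy[OF 1])
    have 3: "P z1 x1 y1" by (rule yz[OF 1])
    have 4: "P x1 z1 y1" by (rule xy[OF 3])
    have 5: "P y1 x1 z1" by (rule yz[OF 2])
    have 6: "P x1 y1 z1" by (rule yz[OF 4])
    consider "\<bar>x1\<bar> \<le> \<bar>y1\<bar>" "\<bar>y1\<bar> \<le> \<bar>z1\<bar>" | "\<bar>x1\<bar> \<le> \<bar>z1\<bar>" "\<bar>z1\<bar> \<le> \<bar>y1\<bar>" | "\<bar>y1\<bar> \<le> \<bar>x1\<bar>" "\<bar>x1\<bar> \<le> \<bar>z1\<bar>"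
      | "\<bar>y1\<bar> \<le> \<bar>z1\<bar>" "\<bar>z1\<bar> \<le> \<bar>x1\<bar>" | "\<bar>z1\<bar> \<le> \<bar>x1\<bar>" "\<bar>x1\<bar> \<le> \<bar>y1\<bar>" | "\<bar>z1\<bar> \<le> \<bar>y1\<bar>" "\<bar>y1\<bar> \<le> \<bar>x1\<bar>"
      by linarith
    then show ?thesis using 1 2 3 4 5 6 x1(2) y1(2) z1(2) by cases blast+
  qed
  then obtain a b c where abc: "P a b c" "\<bar>c\<bar> \<le> \<bar>b\<bar>" "\<bar>b\<bar> \<le> \<bar>a\<bar>" "\<bar>a\<bar> \<le> pi / 4" by blast
  \<comment> \<open>The pair flip, conjugated by permutations so that it acts on the first two
    coordinates; it is used only when a is negative.\<close>
  have "P (- a) (- b) c" using yz[OF xy[OF flip[OF xy[OF yz[OF abc(1)]]]]] xy yz by blast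
  then obtain b' where b': "P \<bar>a\<bar> b' c" "\<bar>b'\<bar> = \<bar>b\<bar>"
    using abc(1) by (metis abs_minus_cancel abs_if)
  then obtain c' where "P \<bar>a\<bar> \<bar>b\<bar> c'" "\<bar>c'\<bar> = \<bar>c\<bar>"
    using flip[OF b'(1)] by (metis abs_minus_cancel abs_if)
  then show ?thesis using abc by (intro exI[of _ "\<bar>a\<bar>"] exI[of _ "\<bar>b\<bar>"] exI[of _ c']) auto
qed

lemma cartan_form_exists:
  assumes "unitary U"
  obtains x y z where "cartan_form U x y z"
proof -
  obtain x y z where "locally_equiv U (U_d x y z)" using cartan_angles_exist[OF assms] by blast
  then have "\<exists>x y z. locally_equiv U (U_d x y z) \<and> \<bar>z\<bar> \<le> y \<and> y \<le> x \<and> x \<le> pi / 4"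
  proof (rule weyl_reduction[rotated -1])
    fix x y z assume U: "locally_equiv U (U_d x y z)"
    show "locally_equiv U (U_d (x + pi / 2) y z)" using locally_equiv_trans[OF U] U_d_shift(2)[of "x + pi / 2" y z] by simp
    show "locally_equiv U (U_d (x - pi / 2) y z)" using locally_equiv_trans[OF U] U_d_shift(1)[of "x - pi / 2" y z] by simp
    show "locally_equiv U (U_d y x z)" using locally_equiv_trans[OF U U_d_swap_xy] .
    show "locally_equiv U (U_d x z y)" using locally_equiv_trans[OF U U_d_swap_yz] .
    show "locally_equiv U (U_d x (- y) (- z))" using locally_equiv_trans[OF U] U_d_flip_yz[of x "- y" "- z"] by simp
  qed
  then show ?thesis using that unfolding cartan_form_def locally_equiv_def by blast
qed

subsection \<open>The extremal families\<close>

lemma cos_four: "cos (4 * t) = 2 * (cos (2 * t))\<^sup>2 - 1" for t :: real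
  using cos_double_cos[of "2 * t"] by simp

lemma entangling_power_cos:
  assumes "cartan_form U x y z"
  defines "a \<equiv> (cos (2 * x))\<^sup>2" and "b \<equiv> (cos (2 * y))\<^sup>2" and "c \<equiv> (cos (2 * z))\<^sup>2"
  shows "entangling_power U = 2 / 9 * (a + b + c - (a * b + b * c + c * a))"
  unfolding entangling_power_cartan[OF assms(1)] cos_four a_def b_def c_def by (simp add: field_simps)

lemma cartan_form_U_d: "\<bar>z\<bar> \<le> y \<Longrightarrow> y \<le> x \<Longrightarrow> x \<le> pi / 4 \<Longrightarrow> cartan_form (U_d x y z) x y z"
  unfolding cartan_form_def using unitary_one by (metis kron_one matrix_mul_lid matrix_mul_rid)

lemma half_arccos:
  assumes "0 \<le> a" "a \<le> 1"
  obtains t where "t \<in> {0..pi/4}" "cos (2 * t) = a"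
proof
  show "arccos a / 2 \<in> {0..pi/4}" using assms arccos_lbound[of a] arccos_le_pi2[of a] by auto
  show "cos (2 * (arccos a / 2)) = a" using assms by simp
qed

text \<open>A one-parameter family is described by s = cos^2 (2 t). D and Q express descriptor and
  extent through s, and the function s inverts D on the range R.\<close>

lemma attainsI:
  assumes D: "\<And>t s. t \<in> {0..pi/4} \<Longrightarrow> cos (2 * t) = sqrt s \<Longrightarrow> 0 \<le> s \<Longrightarrow> s \<le> 1 \<Longrightarrow> descr (F t) = D s"
    and Q: "\<And>t s. t \<in> {0..pi/4} \<Longrightarrow> cos (2 * t) = sqrt s \<Longrightarrow> 0 \<le> s \<Longrightarrow> s \<le> 1 \<Longrightarrow> quasi_extent (F t) = Q s"
    and s: "\<And>d. d \<in> R \<Longrightarrow> 0 \<le> s d" "\<And>d. d \<in> R \<Longrightarrow> s d \<le> 1"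
    and bd: "\<And>d. d \<in> R \<Longrightarrow> D (s d) = d" "\<And>d. d \<in> R \<Longrightarrow> Q (s d) = bd d"
  shows "attains F descr R bd"
  unfolding attains_def
proof
  fix d assume d: "d \<in> R"
  obtain t where "t \<in> {0..pi/4}" "cos (2 * t) = sqrt (s d)"
    using half_arccos[of "sqrt (s d)"] s[OF d] by auto
  then show "\<exists>\<theta>\<in>{0..pi/4}. descr (F \<theta>) = d \<and> quasi_extent (F \<theta>) = bd d"
    using D Q s[OF d] bd[OF d] by metis
qed

context
  fixes t s :: real
  assumes t: "t \<in> {0..pi/4}" "cos (2 * t) = sqrt s" "0 \<le> s" "s \<le> 1"
begin

lemma controlled_values:
  shows "entangling_power (U_d t 0 0) = 2 / 9 * (1 - s)" (is ?A) "gate_typicality (U_d t 0 0) = (1 - s) / 3" (is ?B)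
    "quasi_extent (U_d t 0 0) = 1 + 2 * sqrt (1 - s)" (is ?C)
proof -
  have c: "cartan_form (U_d t 0 0) t 0 0" using t by (intro cartan_form_U_d) auto
  show ?A ?B ?C
    using entangling_power_cos[OF c] gate_typicality_cartan[OF c] quasi_extent_cartan[OF c]
      sum_sqrt_controlled[of "sqrt s"] t by simp_all
qed

lemma iswap_swap_values:
  shows "entangling_power (U_d (pi/4) (pi/4) t) = 2 / 9 * s" (is ?A) "gate_typicality (U_d (pi/4) (pi/4) t) = 1 - s / 3" (is ?B)
    "quasi_extent (U_d (pi/4) (pi/4) t) = 7" (is ?C)
proof -
  have c: "cartan_form (U_d (pi/4) (pi/4) t) (pi/4) (pi/4) t" using t by (intro cartan_form_U_d) auto
  show ?A ?B ?C
    using entangling_power_cos[OF c] gate_typicality_cartan[OF c] quasi_extent_cartan[OF c]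
      sum_sqrt_iswap[of "sqrt s"] t by simp_all
qed

lemma cnot_swap_values:
  shows "gate_typicality (U_d (pi/4) t t) = 1 - 2 * s / 3" (is ?A)
    "quasi_extent (U_d (pi/4) t t) = 3 + 4 * sqrt (1 - s\<^sup>2)" (is ?B)
proof -
  have c: "cartan_form (U_d (pi/4) t t) (pi/4) t t" using t by (intro cartan_form_U_d) auto
  show ?A ?B
    using gate_typicality_cartan[OF c] quasi_extent_cartan[OF c]
      sum_sqrt_cnot_swap[of "sqrt s"] t by simp_all
qed

lemma fractional_swap_values:
  shows "gate_typicality (U_d t t t) = 1 - s" (is ?A)
    "quasi_extent (U_d t t t) = 1 + 3 * (1 - s) + 3 * sqrt ((1 - s) * (4 - 3 * (1 - s)))" (is ?B)
proof -
  have c: "cartan_form (U_d t t t) t t t" using t by (intro cartan_form_U_d) auto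
  show ?A ?B
    using gate_typicality_cartan[OF c] quasi_extent_cartan[OF c]
      sum_sqrt_iso[of "sqrt s" "1 - s"] t by simp_all
qed

lemma xy_values:
  shows "gate_typicality (U_d t t 0) = 2 * (1 - s) / 3" (is ?A)
    "quasi_extent (U_d t t 0) = 1 + 2 * (1 - s) + 4 * sqrt (1 - s)" (is ?B)
proof -
  have c: "cartan_form (U_d t t 0) t t 0" using t by (intro cartan_form_U_d) auto
  have sq: "(1 + sqrt (1 - s))\<^sup>2 = 1 + (1 - s) + 2 * sqrt (1 - s)" using t by (simp add: power2_sum)
  show ?A ?B
    using gate_typicality_cartan[OF c] quasi_extent_cartan[OF c] sum_sqrt_xy[of "sqrt s"] t sq by simp_all
qed

end

lemma scaled_sqrt_eq: "0 \<le> p \<Longrightarrow> 0 \<le> q \<Longrightarrow> p\<^sup>2 * u = q\<^sup>2 * w \<Longrightarrow> p * sqrt u = q * sqrt w"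
  for p q u w :: real
  by (metis real_sqrt_abs real_sqrt_mult abs_of_nonneg)

text \<open>The definition gives each breakpoint to the piece on its left; this and the next three
  lemmas extend the later formulas to closed intervals, as attainment there requires.\<close>

lemma gamma_min_mid:
  assumes "1/3 \<le> g" "g \<le> 2/3"
  shows "gamma_min g = 3 + 2 * sqrt ((3 * g - 1) * (5 - 3 * g))"
proof (cases "g = 1/3")
  case True
  show ?thesis unfolding True gamma_min_def by simp
qed (use assms in \<open>auto simp: gamma_min_def\<close>)

lemma gamma_min_high:
  assumes "2/3 \<le> g"
  shows "gamma_min g = 1 + 3 * g + 3 * sqrt (g * (4 - 3 * g))"
proof (cases "g = 2/3")
  case True
  have "3 * sqrt (4/3) = 2 * sqrt (3 :: real)" by (rule scaled_sqrt_eq) simp_all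
  then show ?thesis unfolding True gamma_min_def by simp
qed (use assms in \<open>auto simp: gamma_min_def\<close>)

lemma gamma_max_mid:
  assumes "4/9 \<le> g" "g \<le> 2/3"
  shows "gamma_max g = 1 + 3 * g + 4 * sqrt (3 * g / 2)"
proof (cases "g = 4/9")
  case True
  have "3 * sqrt (32/27) = 4 * sqrt (2/3 :: real)" by (rule scaled_sqrt_eq) simp_all
  then show ?thesis unfolding True gamma_max_def by simp
qed (use assms in \<open>auto simp: gamma_max_def\<close>)

lemma gamma_max_high:
  assumes "2/3 \<le> g"
  shows "gamma_max g = 7"
proof (cases "g = 2/3")
  case True
  show ?thesis unfolding True gamma_max_def by simp
qed (use assms in \<open>auto simp: gamma_max_def\<close>)

lemma attained_boundaries:
  "attains (\<lambda>\<theta>. U_d \<theta> 0 0) entangling_power {0..2/9} (\<lambda>e. 1 + 3 * sqrt (2 * e))" (is ?A)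
  "attains (\<lambda>\<theta>. U_d (pi/4) (pi/4) \<theta>) entangling_power {0..2/9} (\<lambda>e. 7)" (is ?B)
  "attains (\<lambda>\<theta>. U_d \<theta> 0 0) gate_typicality {0..1/3} gamma_min" (is ?C)
  "attains (\<lambda>\<theta>. U_d (pi/4) \<theta> \<theta>) gate_typicality {1/3..2/3} gamma_min" (is ?D)
  "attains (\<lambda>\<theta>. U_d \<theta> \<theta> \<theta>) gate_typicality {2/3..1} gamma_min" (is ?E)
  "attains (\<lambda>\<theta>. U_d \<theta> \<theta> \<theta>) gate_typicality {0..4/9} gamma_max" (is ?F)
  "attains (\<lambda>\<theta>. U_d \<theta> \<theta> 0) gate_typicality {4/9..2/3} gamma_max" (is ?G)
  "attains (\<lambda>\<theta>. U_d (pi/4) (pi/4) \<theta>) gate_typicality {2/3..1} gamma_max" (is ?H)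
proof -
  have sqrt18: "2 * sqrt (9 * d / 2) = 3 * sqrt (2 * d)" for d :: real
    by (rule scaled_sqrt_eq) simp_all
  have sqrt_mid: "4 * sqrt (1 - (3 / 2 * (1 - d))\<^sup>2) = 2 * sqrt ((3 * d - 1) * (5 - 3 * d))" for d :: real
    by (rule scaled_sqrt_eq) (simp_all add: power2_eq_square field_simps)
  have lin: "2 / 9 * (1 - (1 - 9 * d / 2)) = d" "2 / 9 * (9 * d / 2) = d" "(1 - (1 - 3 * d)) / 3 = d"
    "1 - 2 * (3 / 2 * (1 - d)) / 3 = d" "1 - (1 - d) = d" "2 * (1 - (1 - 3 * d / 2)) / 3 = d" "1 - (3 - 3 * d) / 3 = d"
    for d :: real by (simp_all add: field_simps)
  show ?A
    by (rule attainsI[where s = "\<lambda>d. 1 - 9 * d / 2"], rule controlled_values(1), assumption+, rule controlled_values(3), assumption+)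
      (simp_all only: lin, simp_all add: sqrt18)
  show ?B
    by (rule attainsI[where s = "\<lambda>d. 9 * d / 2"], rule iswap_swap_values(1), assumption+, rule iswap_swap_values(3), assumption+)
      (simp_all only: lin, simp_all)
  show ?C
    by (rule attainsI[where s = "\<lambda>d. 1 - 3 * d"], rule controlled_values(2), assumption+, rule controlled_values(3), assumption+)
      (simp_all only: lin, simp_all add: gamma_min_def)
  show ?D
    by (rule attainsI[where s = "\<lambda>d. 3 / 2 * (1 - d)"], rule cnot_swap_values(1), assumption+, rule cnot_swap_values(2), assumption+)
      (simp_all only: lin sqrt_mid, simp_all add: gamma_min_mid)
  show ?E
    by (rule attainsI[where s = "\<lambda>d. 1 - d"], rule fractional_swap_values(1), assumption+, rule fractional_swap_values(2), assumption+)
      (simp_all only: lin, simp_all add: gamma_min_high)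
  show ?F
    by (rule attainsI[where s = "\<lambda>d. 1 - d"], rule fractional_swap_values(1), assumption+, rule fractional_swap_values(2), assumption+)
      (simp_all only: lin, simp_all add: gamma_max_def)
  show ?G
    by (rule attainsI[where s = "\<lambda>d. 1 - 3 * d / 2"], rule xy_values(1), assumption+, rule xy_values(2), assumption+)
      (simp_all only: lin, simp_all add: gamma_max_mid)
  show ?H
    by (rule attainsI[where s = "\<lambda>d. 3 - 3 * d"], rule iswap_swap_values(2), assumption+, rule iswap_swap_values(3), assumption+)
      (simp_all only: lin, simp_all add: gamma_max_high)
qed

lemma unitary_gate_bounds:
  assumes "unitary U"
  shows "entangling_power U \<in> {0..2/9}" (is ?A) "gate_typicality U \<in> {0..1}" (is ?B)
    "1 + 3 * sqrt (2 * entangling_power U) \<le> quasi_extent U" (is ?C) "quasi_extent U \<le> 7" (is ?D)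
    "gamma_min (gate_typicality U) \<le> quasi_extent U" (is ?E) "quasi_extent U \<le> gamma_max (gate_typicality U)" (is ?F)
proof -
  obtain x y z where U: "cartan_form U x y z" using assms by (rule cartan_form_exists)
  define a b c where "a = cos (2 * x)" and "b = cos (2 * y)" and "c = cos (2 * z)"
  note o = cartan_cos_sorted[OF U, folded a_def b_def c_def]
  define A B C where "A = a\<^sup>2" and "B = b\<^sup>2" and "C = c\<^sup>2"
  have r: "0 \<le> A" "A \<le> 1" "0 \<le> B" "B \<le> 1" "0 \<le> C" "C \<le> 1"
    unfolding A_def B_def C_def using o by (simp_all add: power_le_one)
  have ep: "entangling_power U = 2 / 9 * (A + B + C - (A * B + B * C + C * A))"
    unfolding entangling_power_cos[OF U] A_def B_def C_def a_def b_def c_def ..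
  have gt: "3 * gate_typicality U = 3 - a\<^sup>2 - b\<^sup>2 - c\<^sup>2"
    unfolding gate_typicality_cartan[OF U] a_def b_def c_def by simp
  have q: "quasi_extent U = 2 * (sum_sqrt a b c)\<^sup>2 - 1"
    unfolding quasi_extent_cartan[OF U] a_def b_def c_def ..
  have "A + B + C - (A * B + B * C + C * A) = A * (1 - B) + B * (1 - C) + C * (1 - A)"
    by (simp add: algebra_simps)
  also have "\<dots> \<ge> 0" using r by simp
  finally have e0: "0 \<le> A + B + C - (A * B + B * C + C * A)" .
  \<comment> \<open>If A, B, C were probabilities of independent events, this would be the
    probability that all or none of them occur.\<close>
  have "1 - (A + B + C - (A * B + B * C + C * A)) = (1 - A) * (1 - B) * (1 - C) + A * B * C"
    by (simp add: algebra_simps)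
  also have "\<dots> \<ge> 0" using r by simp
  finally have "A + B + C - (A * B + B * C + C * A) \<le> 1" by simp
  with e0 show ?A unfolding ep by simp
  have "0 \<le> gate_typicality U" "gate_typicality U \<le> 1"
    using gt r unfolding A_def B_def C_def by linarith+
  then show ?B by simp
  note bounds = sum_sqrt_bounds[OF o gt]
  show ?E ?F
    unfolding q using bounds by auto
  show ?D unfolding q using bounds(3) by simp
  \<comment> \<open>This sum is exactly (3 - A - B - C) minus the normalised entangling power, so
    the Cauchy--Schwarz bound in g_t implies the one in e_p.\<close>
  have "0 \<le> (1 - A) * (1 - B) + (1 - B) * (1 - C) + (1 - C) * (1 - A)" using r by simp
  then have "A + B + C - (A * B + B * C + C * A) \<le> 3 - A - B - C" by (simp add: algebra_simps)
  then have s1: "sqrt (A + B + C - (A * B + B * C + C * A)) \<le> sqrt (3 - A - B - C)" by simp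
  have s2: "1 + sqrt (3 - A - B - C) \<le> (sum_sqrt a b c)\<^sup>2"
    using bounds(4) unfolding A_def B_def C_def .
  have s3: "3 * sqrt (2 * entangling_power U) = 2 * sqrt (A + B + C - (A * B + B * C + C * A))"
    (is "_ = 2 * sqrt ?e")
  proof -
    have "2 * entangling_power U = (2 / 3)\<^sup>2 * ?e" unfolding ep by (simp add: power2_eq_square)
    then show ?thesis by (simp add: real_sqrt_mult)
  qed
  have "1 + 2 * u \<le> 2 * w - 1" if "u \<le> v" "1 + v \<le> w" for u v w :: real using that by linarith
  from this[OF s1 s2] show ?C unfolding q s3 .
qed

lemma attained_member:
  assumes "attains F gate_typicality R bd" "g \<in> R" "\<And>t. unitary (F t)"
  shows "bd g \<in> {quasi_extent U | U. unitary U \<and> gate_typicality U = g}"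
  using assms unfolding attains_def by force

lemma gate_typicality_extrema:
  assumes "g \<in> {0..1}"
  shows "is_minimum {quasi_extent U | U. unitary U \<and> gate_typicality U = g} (gamma_min g)" (is ?A)
    "is_maximum {quasi_extent U | U. unitary U \<and> gate_typicality U = g} (gamma_max g)" (is ?B)
proof -
  have "g \<in> {0..1/3} \<or> g \<in> {1/3..2/3} \<or> g \<in> {2/3..1}" using assms by auto
  then have "gamma_min g \<in> {quasi_extent U | U. unitary U \<and> gate_typicality U = g}"
    using attained_member[OF attained_boundaries(3) _ unitary_U_d] attained_member[OF attained_boundaries(4) _ unitary_U_d]
      attained_member[OF attained_boundaries(5) _ unitary_U_d] by blast
  then show ?A
    unfolding is_minimum_def using unitary_gate_bounds(5) by blast
  have "g \<in> {0..4/9} \<or> g \<in> {4/9..2/3} \<or> g \<in> {2/3..1}" using assms by auto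
  then have "gamma_max g \<in> {quasi_extent U | U. unitary U \<and> gate_typicality U = g}"
    using attained_member[OF attained_boundaries(6) _ unitary_U_d] attained_member[OF attained_boundaries(7) _ unitary_U_d]
      attained_member[OF attained_boundaries(8) _ unitary_U_d] by blast
  then show ?B
    unfolding is_maximum_def using unitary_gate_bounds(6) by blast
qed

theorem theorem1:
  shows "(\<forall>U :: two_qubit. unitary U \<longrightarrow>
            entangling_power U \<in> {0..2/9} \<and> gate_typicality U \<in> {0..1})
    \<and> (\<forall>U :: two_qubit. unitary U \<and> 0 \<le> entangling_power U \<and> entangling_power U \<le> 2/9 \<longrightarrow>
            1 + 3 * sqrt (2 * entangling_power U) \<le> quasi_extent U \<and> quasi_extent U \<le> 7)
    \<and> attains (\<lambda>\<theta>. U_d \<theta> 0 0) entangling_power {0..2/9} (\<lambda>e. 1 + 3 * sqrt (2 * e))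
    \<and> attains (\<lambda>\<theta>. U_d (pi/4) (pi/4) \<theta>) entangling_power {0..2/9} (\<lambda>e. 7)
    \<and> (\<forall>g\<in>{0..1}.
            is_minimum {quasi_extent U | U :: two_qubit. unitary U \<and> gate_typicality U = g} (gamma_min g)
          \<and> is_maximum {quasi_extent U | U :: two_qubit. unitary U \<and> gate_typicality U = g} (gamma_max g))
    \<and> attains (\<lambda>\<theta>. U_d \<theta> 0 0) gate_typicality {0..1/3} gamma_min
    \<and> attains (\<lambda>\<theta>. U_d (pi/4) \<theta> \<theta>) gate_typicality {1/3..2/3} gamma_min
    \<and> attains (\<lambda>\<theta>. U_d \<theta> \<theta> \<theta>) gate_typicality {2/3..1} gamma_min
    \<and> attains (\<lambda>\<theta>. U_d \<theta> \<theta> \<theta>) gate_typicality {0..4/9} gamma_max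
    \<and> attains (\<lambda>\<theta>. U_d \<theta> \<theta> 0) gate_typicality {4/9..2/3} gamma_max
    \<and> attains (\<lambda>\<theta>. U_d (pi/4) (pi/4) \<theta>) gate_typicality {2/3..1} gamma_max"
  using unitary_gate_bounds gate_typicality_extrema attained_boundaries by blast

end
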